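(* Let $G$ be a finite simple chordal graph on the vertex set $\{x_1,\ldots,x_n\}$, let $\mathbb K$ be a field and $R=\mathbb K[x_1,\ldots,x_n]$. Then for every integer $t\geq 2$, \[\mathrm{reg}(R/J_t(G))=(t-1)\,\nu_t(G).\]
   Context: A graph is chordal if it has no induced cycle of length greater than three. For $W\subseteq V(G)$, $G[W]$ denotes the induced subgraph on $W$, and for $F\subseteq V(G)$, $\mathbf x_F=\prod_{x_i\in F}x_i$. For $t\ge 2$, the $t$-connected ideal of $G$ is $J_t(G)=\langle \mathbf x_C \mid C\subseteq V(G),\ |C|=t,\ G[C]\text{ connected}\rangle\subseteq R$ (it is the Stanley–Reisner ideal of the $t$-independence complex of $G$; it is the zero ideal if no such $C$ exists). A $t$-induced matching of $G$ is a collection $\{C_1,\ldots,C_r\}$ of pairwise disjoint subsets of $V(G)$ with $|C_i|=t$ and $G[C_i]$ connected for each $i$, such that $E(G[\bigcup_i C_i])=\bigcup_i E(G[C_i])$; $\nu_t(G)$ is the maximum size of a $t$-induced matching of $G$ (equivalently, the induced matching number of the hypergraph whose edges are the $t$-subsets $C$ with $G[C]$ connected). $\mathrm{reg}$ denotes Castelnuovo–Mumford regularity. *)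

theory Defs
  imports "HOL-Library.Poly_Mapping" "HOL-Library.Disjoint_Sets" "Jordan_Normal_Form.Matrix_Kernel"
begin

text \<open>A finite simple graph is given by its edge set; its vertex set is the whole of the
  (finite) type \<open>'v\<close>.\<close>

definition simple_graph :: "'v set set \<Rightarrow> bool" where
  "simple_graph E \<longleftrightarrow> (\<forall>e\<in>E. card e = 2)"

definition induced_edges :: "'v set set \<Rightarrow> 'v set \<Rightarrow> 'v set set" where
  "induced_edges E W = {e \<in> E. e \<subseteq> W}"

definition induced_connected :: "'v set set \<Rightarrow> 'v set \<Rightarrow> bool" where
  "induced_connected E W \<longleftrightarrow>
     W \<noteq> {} \<and> (\<forall>u\<in>W. \<forall>v\<in>W. (u, v) \<in> {(a, b). {a, b} \<in> induced_edges E W}\<^sup>*)"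

definition induced_cycle :: "'v set set \<Rightarrow> 'v list \<Rightarrow> bool" where
  "induced_cycle E c \<longleftrightarrow> length c \<ge> 3 \<and> distinct c \<and>
     induced_edges E (set c) = (\<lambda>i. {c ! i, c ! (Suc i mod length c)}) ` {..<length c}"

definition chordal :: "'v set set \<Rightarrow> bool" where
  "chordal E \<longleftrightarrow> \<not> (\<exists>c. induced_cycle E c \<and> length c > 3)"

definition connected_sets :: "'v set set \<Rightarrow> nat \<Rightarrow> 'v set set" where
  "connected_sets E t = {C. card C = t \<and> induced_connected E C}"

definition t_induced_matching :: "'v set set \<Rightarrow> nat \<Rightarrow> 'v set set \<Rightarrow> bool" where
  "t_induced_matching E t M \<longleftrightarrow>
     M \<subseteq> connected_sets E t \<and> disjoint M \<and>
     induced_edges E (\<Union>M) = (\<Union>C\<in>M. induced_edges E C)"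

definition t_induced_matching_number :: "'v::finite set set \<Rightarrow> nat \<Rightarrow> nat" where
  "t_induced_matching_number E t = Max {card M |M. t_induced_matching E t M}"

type_synonym ('v, 'k) mpoly = "('v \<Rightarrow>\<^sub>0 nat) \<Rightarrow>\<^sub>0 'k"

definition pvar :: "'v \<Rightarrow> ('v, 'k::field) mpoly" where
  "pvar v = Poly_Mapping.single (Poly_Mapping.single v 1) 1"

definition ideal_generated :: "('v, 'k::field) mpoly set \<Rightarrow> ('v, 'k) mpoly set" where
  "ideal_generated B = Modules.module.span (*) B"

definition connected_ideal :: "'v::finite set set \<Rightarrow> nat \<Rightarrow> ('v, 'k::field) mpoly set" where
  "connected_ideal E t = ideal_generated ((\<lambda>C. \<Prod>v\<in>C. pvar v) ` connected_sets E t)"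

definition homogeneous :: "int \<Rightarrow> ('v::finite, 'k::field) mpoly \<Rightarrow> bool" where
  "homogeneous e p \<longleftrightarrow>
     (\<forall>m\<in>Poly_Mapping.keys p. int (\<Sum>v\<in>UNIV. Poly_Mapping.lookup m v) = e)"

definition mat_image :: "'a::comm_ring_1 mat \<Rightarrow> 'a vec set" where
  "mat_image A = (\<lambda>v. A *\<^sub>v v) ` carrier_vec (dim_col A)"

text \<open>A graded free resolution of \<open>R/I\<close> by finitely generated free modules,
  \<open>\<dots> \<rightarrow> F\<^sub>2 \<rightarrow> F\<^sub>1 \<rightarrow> F\<^sub>0 = R \<rightarrow> R/I \<rightarrow> 0\<close>, where the last map is the canonical projection.
  The list \<open>d i\<close> consists of the degrees of a homogeneous basis of \<open>F\<^sub>i\<close>, so that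
  \<open>F\<^sub>i\<close> is the direct sum of the \<open>R(-j)\<close> for \<open>j\<close> in \<open>d i\<close>, and \<open>\<phi> i\<close> is the matrix of the
  degree-preserving map from \<open>F\<^sub>i\<^sub>+\<^sub>1\<close> to \<open>F\<^sub>i\<close>.\<close>

definition graded_free_resolution ::
    "('v::finite, 'k::field) mpoly set \<Rightarrow> (nat \<Rightarrow> int list) \<Rightarrow> (nat \<Rightarrow> ('v, 'k) mpoly mat) \<Rightarrow> bool"
  where
  "graded_free_resolution I d \<phi> \<longleftrightarrow>
     d 0 = [0] \<and>
     (\<forall>i. \<phi> i \<in> carrier_mat (length (d i)) (length (d (Suc i)))) \<and>
     (\<forall>i. \<forall>r < length (d i). \<forall>c < length (d (Suc i)).
        homogeneous (d (Suc i) ! c - d i ! r) (\<phi> i $$ (r, c))) \<and>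
     (\<lambda>v. v $ 0) ` mat_image (\<phi> 0) = I \<and>
     (\<forall>i. mat_image (\<phi> (Suc i)) = mat_kernel (\<phi> i))"

text \<open>Minimality: the image of \<open>F\<^sub>i\<^sub>+\<^sub>1\<close> is contained in \<open>\<mm> F\<^sub>i\<close>, with \<open>\<mm>\<close> the ideal generated
  by the variables.\<close>

definition minimal_graded_free_resolution ::
    "('v::finite, 'k::field) mpoly set \<Rightarrow> (nat \<Rightarrow> int list) \<Rightarrow> (nat \<Rightarrow> ('v, 'k) mpoly mat) \<Rightarrow> bool"
  where
  "minimal_graded_free_resolution I d \<phi> \<longleftrightarrow>
     graded_free_resolution I d \<phi> \<and>
     (\<forall>i. \<forall>r < length (d i). \<forall>c < length (d (Suc i)).
        \<phi> i $$ (r, c) \<in> ideal_generated (range pvar))"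

text \<open>The graded Betti number \<open>\<beta>\<^sub>i\<^sub>,\<^sub>j(R/I)\<close> of \<open>R/I\<close>, for a proper homogeneous ideal \<open>I\<close>: such an
  ideal has a minimal graded free resolution, which is unique up to isomorphism, so the choice
  does not matter.\<close>

definition graded_betti :: "('v::finite, 'k::field) mpoly set \<Rightarrow> nat \<Rightarrow> int \<Rightarrow> nat" where
  "graded_betti I i j =
     count_list ((SOME d. \<exists>\<phi>. minimal_graded_free_resolution I d \<phi>) i) j"

text \<open>The Castelnuovo-Mumford regularity of \<open>R/I\<close> (not of \<open>I\<close>), again for proper homogeneous
  \<open>I\<close>; the maximum is over a finite nonempty set by Hilbert's syzygy theorem.\<close>

definition reg_quotient :: "('v::finite, 'k::field) mpoly set \<Rightarrow> int" where
  "reg_quotient I = Max {j - int i |i j. graded_betti I i j \<noteq> 0}"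

end

theory Submission
  imports Defs "HOL-Library.Function_Algebras"
begin

text \<open>By a greedy argument along a perfect elimination ordering, the connected \<open>t\<close>-sets of a chordal
  graph can be met by \<open>\<nu>\<^sub>t\<close> cliques. For one clique \<open>Q\<close>, the connected sets meeting \<open>Q\<close> are the
  nonempty feasible sets of a greedoid, so those of size \<open>t\<close> generate an ideal with linear quotients,
  whose quotient ring has regularity at most \<open>t - 1\<close>. The multigraded tensor product of squarefree
  resolutions, with labels joined by union, resolves the quotient by the sum of the ideals, which
  bounds the regularity by \<open>(t - 1) \<nu>\<^sub>t\<close>. The bound is attained because a minimal squarefree
  resolution, restricted to the vertices of a maximum induced matching, resolves a complete
  intersection of \<open>\<nu>\<^sub>t\<close> monomials of degree \<open>t\<close>.\<close>

section \<open>Contractions of finite based complexes\<close>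

text \<open>Regularity is not subadditive under sums of arbitrary ideals; here squarefreeness makes
  it so. A squarefree monomial ideal is determined by its squarefree multidegrees, so exactness has
  to be checked only on the strands of subsets \<open>W\<close>. There the quotient ring is either 0
  or the ground ring, spanned by the class of the degree 0 generator \<open>e\<close>. Accordingly
  \<open>contraction\<close> asks for a homotopy \<open>h\<close> from the identity to a matrix
  \<open>P\<close> that is 0 or the projection onto \<open>e\<close>. With exactness given by matrix
  equations, tensor products, cones and cancellation are verified by algebra, without homology, and
  the homotopies later provide preimages of polynomial cycles. The inequality
  \<open>card (l x) \<le> g x + r\<close> for all generators expresses regularity at most
  \<open>r\<close>; it survives these constructions. Minimality serves to identify Betti numbers:
  since \<open>graded_betti\<close> rests on an arbitrary choice of minimal resolution, both bounds
  pass through the fact that a minimal resolution has, in each homological degree and each degree,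
  at most as many generators as any other resolution.\<close>

definition mprod :: "'b set \<Rightarrow> ('a \<Rightarrow> 'b \<Rightarrow> 'k::comm_ring_1) \<Rightarrow> ('b \<Rightarrow> 'c \<Rightarrow> 'k) \<Rightarrow> 'a \<Rightarrow> 'c \<Rightarrow> 'k" where
  "mprod B X Y = (\<lambda>x z. \<Sum>y\<in>B. X x y * Y y z)"

text \<open>Matrices are functions on whole types, so the identity is cut off at \<open>B\<close>;
  the unit laws below therefore ask for \<open>supported\<close>.\<close>

definition mid :: "'b set \<Rightarrow> 'b \<Rightarrow> 'b \<Rightarrow> 'k::comm_ring_1" where
  "mid B = (\<lambda>x y. if x = y \<and> x \<in> B then 1 else 0)"

definition munit :: "'a \<Rightarrow> 'b \<Rightarrow> 'a \<Rightarrow> 'b \<Rightarrow> 'k::comm_ring_1" where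
  "munit a b = (\<lambda>x y. if x = a \<and> y = b then 1 else 0)"

definition supported :: "'a set \<Rightarrow> 'b set \<Rightarrow> ('a \<Rightarrow> 'b \<Rightarrow> 'k::comm_ring_1) \<Rightarrow> bool" where
  "supported A B X \<longleftrightarrow> (\<forall>x y. X x y \<noteq> 0 \<longrightarrow> x \<in> A \<and> y \<in> B)"

lemma supportedD: "supported A B X \<Longrightarrow> x \<notin> A \<or> y \<notin> B \<Longrightarrow> X x y = 0"
  by (auto simp: supported_def)

lemma supported_mid [simp]: "supported B B (mid B)"
  by (auto simp: supported_def mid_def)

lemma mprod_nonzeroE:
  assumes "mprod B X Y x z \<noteq> 0" obtains y where "y \<in> B" "X x y \<noteq> 0" "Y y z \<noteq> 0"
proof -
  obtain y where "y \<in> B" "X x y * Y y z \<noteq> 0"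
    using assms unfolding mprod_def by (rule sum.not_neutral_contains_not_neutral)
  then show ?thesis using that mult_not_zero by blast
qed

lemma supported_mprod: "supported A B X \<Longrightarrow> supported B' C Y \<Longrightarrow> supported A C (mprod B'' X Y)"
  unfolding supported_def by (blast elim: mprod_nonzeroE)

lemma mprod_assoc: "mprod C (mprod B X Y) Z = mprod B X (mprod C Y Z)"
proof (intro ext)
  fix x z
  have "mprod C (mprod B X Y) Z x z = (\<Sum>y\<in>C. \<Sum>w\<in>B. X x w * Y w y * Z y z)"
    by (simp add: mprod_def sum_distrib_right)
  also have "\<dots> = (\<Sum>w\<in>B. \<Sum>y\<in>C. X x w * Y w y * Z y z)" by (rule sum.swap)
  finally show "mprod C (mprod B X Y) Z x z = mprod B X (mprod C Y Z) x z"
    by (simp add: mprod_def sum_distrib_left mult.assoc)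
qed

lemma mprod_add_left: "mprod B (X + Y) Z = mprod B X Z + mprod B Y Z"
  by (intro ext) (simp add: mprod_def distrib_right sum.distrib)

lemma mprod_add_right: "mprod B Z (X + Y) = mprod B Z X + mprod B Z Y"
  by (intro ext) (simp add: mprod_def distrib_left sum.distrib)

lemma mprod_diff_left: "mprod B (X - Y) Z = mprod B X Z - mprod B Y Z"
  by (intro ext) (simp add: mprod_def left_diff_distrib sum_subtractf)

lemma mprod_diff_right: "mprod B Z (X - Y) = mprod B Z X - mprod B Z Y"
  by (intro ext) (simp add: mprod_def right_diff_distrib sum_subtractf)

lemma mprod_minus_left: "mprod B (- X) Z = - mprod B X Z"
  by (intro ext) (simp add: mprod_def sum_negf)

lemma mprod_minus_right: "mprod B Z (- X) = - mprod B Z X"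
  by (intro ext) (simp add: mprod_def sum_negf)

lemma mprod_zero_left [simp]: "mprod B 0 Z = 0"
  by (intro ext) (simp add: mprod_def)

lemma mprod_zero_right [simp]: "mprod B Z 0 = 0"
  by (intro ext) (simp add: mprod_def)

lemmas mprod_algebra = mprod_add_left mprod_add_right mprod_diff_left mprod_diff_right mprod_minus_left mprod_minus_right

lemma mprod_mid_left:
  assumes "finite B" "supported B C X" shows "mprod B (mid B) X = X"
proof (intro ext)
  fix x z
  have "mprod B (mid B) X x z = (\<Sum>y\<in>B. if y = x then X x z else 0)"
    unfolding mprod_def mid_def by (intro sum.cong) auto
  then show "mprod B (mid B) X x z = X x z" using assms supportedD by fastforce
qed

lemma mprod_mid_right:
  assumes "finite B" "supported A B X" shows "mprod B X (mid B) = X"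
proof (intro ext)
  fix x z
  have "mprod B X (mid B) x z = (\<Sum>y\<in>B. if y = z then X x z else 0)"
    unfolding mprod_def mid_def by (intro sum.cong) auto
  then show "mprod B X (mid B) x z = X x z" using assms supportedD by fastforce
qed

lemma mprod_munit_left:
  assumes "finite B" "b \<in> B" shows "mprod B (munit a b) X = (\<lambda>x z. if x = a then X b z else 0)"
proof (intro ext)
  fix x z
  have "mprod B (munit a b) X x z = (\<Sum>y\<in>B. if y = b then (if x = a then X b z else 0) else 0)"
    unfolding mprod_def munit_def by (intro sum.cong) auto
  then show "mprod B (munit a b) X x z = (if x = a then X b z else 0)" using assms by simp
qed

lemma mprod_munit_right:
  assumes "finite B" "a \<in> B" shows "mprod B X (munit a b) = (\<lambda>x z. if z = b then X x a else 0)"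
proof (intro ext)
  fix x z
  have "mprod B X (munit a b) x z = (\<Sum>y\<in>B. if y = a then (if z = b then X x a else 0) else 0)"
    unfolding mprod_def munit_def by (intro sum.cong) auto
  then show "mprod B X (munit a b) x z = (if z = b then X x a else 0)" using assms by simp
qed

lemma mprod_munit_munit [simp]:
  assumes "finite B" "b \<in> B" shows "mprod B (munit a b) (munit b c) = munit a c"
  using assms by (intro ext) (simp add: mprod_munit_left, simp add: munit_def)

text \<open>Matrices act on the right of row vectors, so \<open>mprod B X Y\<close> is ``first \<open>X\<close>, then \<open>Y\<close>'', and
  \<open>D x y\<close> is the coefficient of \<open>y\<close> in the boundary of \<open>x\<close>.\<close>

definition contraction :: "'b set \<Rightarrow> ('b \<Rightarrow> nat) \<Rightarrow> ('b \<Rightarrow> 'b \<Rightarrow> 'k::comm_ring_1) \<Rightarrow> 'b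
    \<Rightarrow> ('b \<Rightarrow> 'b \<Rightarrow> 'k) \<Rightarrow> ('b \<Rightarrow> 'b \<Rightarrow> 'k) \<Rightarrow> bool" where
  "contraction B g D e P h \<longleftrightarrow> finite B \<and> e \<in> B \<and> (\<forall>x\<in>B. g x = 0 \<longleftrightarrow> x = e) \<and>
     (\<forall>x y. D x y \<noteq> 0 \<longrightarrow> x \<in> B \<and> y \<in> B \<and> g x = Suc (g y)) \<and>
     (\<forall>x y. h x y \<noteq> 0 \<longrightarrow> x \<in> B \<and> y \<in> B \<and> g y = Suc (g x)) \<and>
     mprod B D D = 0 \<and> mprod B D h + mprod B h D = mid B - P \<and>
     (P = 0 \<or> P = munit e e) \<and> mprod B P h = 0"

lemma contractionI:
  assumes "finite B" "e \<in> B" "\<And>x. x \<in> B \<Longrightarrow> g x = 0 \<longleftrightarrow> x = e"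
    "\<And>x y. D x y \<noteq> 0 \<Longrightarrow> x \<in> B \<and> y \<in> B \<and> g x = Suc (g y)"
    "\<And>x y. h x y \<noteq> 0 \<Longrightarrow> x \<in> B \<and> y \<in> B \<and> g y = Suc (g x)"
    "mprod B D D = 0" "mprod B D h + mprod B h D = mid B - P"
    "P = 0 \<or> P = munit e e" "mprod B P h = 0"
  shows "contraction B g D e P h"
  unfolding contraction_def
  by (intro conjI ballI allI impI assms(1-3,6-9)) (use assms(4,5) in blast)+

context
  fixes B :: "'b set" and g :: "'b \<Rightarrow> nat" and D :: "'b \<Rightarrow> 'b \<Rightarrow> 'k::comm_ring_1"
    and e :: 'b and P h :: "'b \<Rightarrow> 'b \<Rightarrow> 'k"
  assumes contraction: "contraction B g D e P h"
begin

lemma contraction_fin: "finite B" and contraction_e: "e \<in> B"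
  and contraction_DD: "mprod B D D = 0"
  and contraction_hom: "mprod B D h + mprod B h D = mid B - P"
  and contraction_P: "P = 0 \<or> P = munit e e"
  and contraction_Ph: "mprod B P h = 0"
  using contraction unfolding contraction_def by simp_all

lemma contraction_deg0: "x \<in> B \<Longrightarrow> g x = 0 \<longleftrightarrow> x = e"
  using contraction unfolding contraction_def by (elim conjE) (rule bspec)

lemma contraction_D: "D x y \<noteq> 0 \<Longrightarrow> x \<in> B \<and> y \<in> B \<and> g x = Suc (g y)"
  using contraction unfolding contraction_def by (elim conjE) blast

lemma contraction_h: "h x y \<noteq> 0 \<Longrightarrow> x \<in> B \<and> y \<in> B \<and> g y = Suc (g x)"
  using contraction unfolding contraction_def by (elim conjE) blast

lemma contraction_supp_D: "supported B B D" and contraction_supp_h: "supported B B h" and contraction_supp_P: "supported B B P"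
  using contraction_D contraction_h contraction_P contraction_e by (auto simp: supported_def munit_def split: if_splits)

lemma contraction_PD: "mprod B P D = 0"
proof -
  have "D e z = 0" for z using contraction_D[of e z] contraction_deg0[OF contraction_e] by auto
  then show ?thesis using contraction_P contraction_fin contraction_e by (auto simp: mprod_munit_left intro!: ext)
qed

lemma contraction_hP: "mprod B h P = 0"
proof -
  have "h z e = 0" for z using contraction_h[of z e] contraction_deg0[OF contraction_e] by auto
  then show ?thesis using contraction_P contraction_fin contraction_e by (auto simp: mprod_munit_right intro!: ext)
qed

lemma contraction_hD_eq: "mprod B h D = mid B - P - mprod B D h" and contraction_Dh_eq: "mprod B D h = mid B - P - mprod B h D"
  by (simp_all flip: contraction_hom)

text \<open>Both sides of \<open>D h D\<close> computed with the homotopy identity.\<close>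

lemma contraction_DP: "mprod B D P = 0"
proof -
  have "mprod B D (mprod B h D) = mprod B D (mid B - P - mprod B D h)"
    by (simp only: contraction_hD_eq)
  also have "\<dots> = D - mprod B D P"
    by (simp add: mprod_algebra mprod_assoc[symmetric] contraction_DD mprod_mid_right[OF contraction_fin contraction_supp_D])
  finally have 1: "mprod B D (mprod B h D) = D - mprod B D P" .
  have "mprod B (mprod B D h) D = mprod B (mid B - P - mprod B h D) D"
    by (simp only: contraction_Dh_eq)
  also have "\<dots> = D"
    by (simp add: mprod_algebra mprod_assoc contraction_DD contraction_PD mprod_mid_left[OF contraction_fin contraction_supp_D])
  finally show ?thesis using 1 by (simp add: mprod_assoc)
qed

end

section \<open>Tensor products of contractions\<close>

definition mkron :: "('a \<Rightarrow> 'b \<Rightarrow> 'k::comm_ring_1) \<Rightarrow> ('c \<Rightarrow> 'd \<Rightarrow> 'k) \<Rightarrow> 'a \<times> 'c \<Rightarrow> 'b \<times> 'd \<Rightarrow> 'k" where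
  "mkron X Y = (\<lambda>p q. X (fst p) (fst q) * Y (snd p) (snd q))"

lemma mprod_mkron: "mprod (B \<times> C) (mkron X Y) (mkron X' Y') = mkron (mprod B X X') (mprod C Y Y')"
proof (intro ext)
  fix p q
  have "mprod (B \<times> C) (mkron X Y) (mkron X' Y') p q =
      (\<Sum>y\<in>B. \<Sum>w\<in>C. (X (fst p) y * X' y (fst q)) * (Y (snd p) w * Y' w (snd q)))"
    by (simp add: mprod_def mkron_def sum.cartesian_product split_def ac_simps)
  then show "mprod (B \<times> C) (mkron X Y) (mkron X' Y') p q = mkron (mprod B X X') (mprod C Y Y') p q"
    by (simp add: mprod_def mkron_def sum_product)
qed

lemma mkron_add_left: "mkron (X + Y) Z = mkron X Z + mkron Y Z"
  and mkron_add_right: "mkron Z' (X' + Y') = mkron Z' X' + mkron Z' Y'"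
  and mkron_diff_left: "mkron (X - Y) Z = mkron X Z - mkron Y Z"
  and mkron_diff_right: "mkron Z' (X' - Y') = mkron Z' X' - mkron Z' Y'"
  and mkron_minus_left: "mkron (- X) Z = - mkron X Z"
  and mkron_zero_left [simp]: "mkron 0 Z = 0"
  and mkron_zero_right [simp]: "mkron Z' 0 = 0"
  by (auto intro!: ext simp: mkron_def algebra_simps)

lemma mkron_mid: "mkron (mid B) (mid C) = mid (B \<times> C)"
  by (auto intro!: ext simp: mkron_def mid_def)

lemma mkron_munit: "mkron (munit a b) (munit c d) = munit (a, c) (b, d)"
  by (auto intro!: ext simp: mkron_def munit_def)

text \<open>The diagonal matrix of Koszul signs. Differentials and homotopies change the degree by
  one and hence anticommute with it, which makes the tensor product differential square to
  zero.\<close>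

definition msign :: "'b set \<Rightarrow> ('b \<Rightarrow> nat) \<Rightarrow> 'b \<Rightarrow> 'b \<Rightarrow> 'k::comm_ring_1" where
  "msign B g = (\<lambda>x y. if x = y \<and> x \<in> B then (-1) ^ g x else 0)"

lemma mprod_msign_left:
  assumes "finite B" shows "mprod B (msign B g) X = (\<lambda>x z. if x \<in> B then (-1) ^ g x * X x z else 0)"
proof (intro ext)
  fix x z
  have "mprod B (msign B g) X x z = (\<Sum>y\<in>B. if y = x then (-1) ^ g x * X x z else 0)"
    unfolding mprod_def msign_def by (intro sum.cong) auto
  then show "mprod B (msign B g) X x z = (if x \<in> B then (-1) ^ g x * X x z else 0)" using assms by simp
qed

lemma mprod_msign_right:
  assumes "finite B" shows "mprod B X (msign B g) = (\<lambda>x z. if z \<in> B then (-1) ^ g z * X x z else 0)"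
proof (intro ext)
  fix x z
  have "mprod B X (msign B g) x z = (\<Sum>y\<in>B. if y = z then (-1) ^ g z * X x z else 0)"
    unfolding mprod_def msign_def by (intro sum.cong) auto
  then show "mprod B X (msign B g) x z = (if z \<in> B then (-1) ^ g z * X x z else 0)" using assms by simp
qed

lemma msign_msign: "finite B \<Longrightarrow> mprod B (msign B g) (msign B g) = mid B"
  by (intro ext) (simp add: mprod_msign_left, simp add: msign_def mid_def flip: power_add mult_2)

lemma msign_anticommute:
  assumes "finite B" "\<And>x y. X x y \<noteq> 0 \<Longrightarrow> x \<in> B \<and> y \<in> B \<and> (g x = Suc (g y) \<or> g y = Suc (g x))"
  shows "mprod B X (msign B g) + mprod B (msign B g) X = 0"
proof (intro ext)
  fix x z
  show "(mprod B X (msign B g) + mprod B (msign B g) X) x z = 0 x z"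
    using assms(2)[of x z] by (cases "X x z = 0") (auto simp: mprod_msign_left mprod_msign_right assms(1))
qed

text \<open>The new homotopy contracts the first factor by \<open>h\<close> and, on what
  \<open>P\<close> leaves of it, the second factor by \<open>h'\<close>.\<close>

lemma contraction_tensor:
  assumes "contraction B g D e P h" "contraction B' g' D' e' P' h'"
  shows "contraction (B \<times> B') (\<lambda>p. g (fst p) + g' (snd p))
    (mkron D (mid B') + mkron (msign B g) D') (e, e') (mkron P P') (mkron h (mid B') + mkron P h')"
proof -
  have cA: "contraction B g D e P h" by fact
  have cC: "contraction B' g' D' e' P' h'" by fact
  let ?S = "msign B g :: 'a \<Rightarrow> 'a \<Rightarrow> 'b"
  have S: "mprod B D ?S + mprod B ?S D = 0" "mprod B h ?S + mprod B ?S h = 0"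
    using contraction_D[OF cA] contraction_h[OF cA] by (intro msign_anticommute; blast intro: contraction_fin[OF cA])+
  have SP: "mprod B ?S P = P" "mprod B P ?S = P"
    using contraction_P[OF cA] contraction_e[OF cA] contraction_deg0[OF cA contraction_e[OF cA]]
    by (auto simp: mprod_msign_left mprod_msign_right contraction_fin[OF cA] munit_def intro!: ext)
  have id[simp]: "mprod B' (mid B') (mid B') = (mid B' :: 'c \<Rightarrow> 'c \<Rightarrow> 'b)" by (rule mprod_mid_left[OF contraction_fin[OF cC] supported_mid])
  have S': "mprod B ?S D = - mprod B D ?S" "mprod B ?S h = - mprod B h ?S"
    using S by (metis add.commute add_eq_0_iff)+
  note simps = mprod_algebra mprod_mkron contraction_DD[OF cA] contraction_DD[OF cC] mprod_mid_left[OF contraction_fin[OF cC] contraction_supp_D[OF cC]] mprod_mid_right[OF contraction_fin[OF cC] contraction_supp_D[OF cC]]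
    mprod_mid_left[OF contraction_fin[OF cC] contraction_supp_h[OF cC]] mprod_mid_right[OF contraction_fin[OF cC] contraction_supp_h[OF cC]] S' SP msign_msign[OF contraction_fin[OF cA]]
    contraction_DP[OF cA] contraction_PD[OF cA] contraction_hP[OF cA] contraction_Ph[OF cA] mkron_minus_left
  show ?thesis
  proof (rule contractionI)
    show "finite (B \<times> B')" "(e, e') \<in> B \<times> B'" using contraction_fin[OF cA] contraction_fin[OF cC] contraction_e[OF cA] contraction_e[OF cC] by auto
    show "(g (fst x) + g' (snd x) = 0) = (x = (e, e'))" if "x \<in> B \<times> B'" for x
      using that contraction_deg0[OF cA] contraction_deg0[OF cC] by (cases x) auto
    show "x \<in> B \<times> B' \<and> y \<in> B \<times> B' \<and> g (fst x) + g' (snd x) = Suc (g (fst y) + g' (snd y))"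
      if "(mkron D (mid B') + mkron ?S D') x y \<noteq> 0" for x y
    proof -
      have "mkron D (mid B') x y \<noteq> 0 \<or> mkron ?S D' x y \<noteq> 0" using that by auto
      then show ?thesis using contraction_D[OF cA, of "fst x" "fst y"] contraction_D[OF cC, of "snd x" "snd y"]
        by (cases x; cases y) (auto simp: mkron_def mid_def msign_def split: if_splits dest!: mult_not_zero)
    qed
    show "x \<in> B \<times> B' \<and> y \<in> B \<times> B' \<and> g (fst y) + g' (snd y) = Suc (g (fst x) + g' (snd x))"
      if "(mkron h (mid B') + mkron P h') x y \<noteq> 0" for x y
    proof -
      have "mkron h (mid B') x y \<noteq> 0 \<or> mkron P h' x y \<noteq> 0" using that by auto
      then show ?thesis using contraction_h[OF cA, of "fst x" "fst y"] contraction_h[OF cC, of "snd x" "snd y"] contraction_P[OF cA] contraction_e[OF cA]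
        by (cases x; cases y) (auto simp: mkron_def mid_def munit_def split: if_splits dest!: mult_not_zero)
    qed
    show "mprod (B \<times> B') (mkron D (mid B') + mkron ?S D') (mkron D (mid B') + mkron ?S D') = 0"
      by (simp add: simps)
    \<comment> \<open>In the two products the terms with \<open>mprod B D P\<close> and
      \<open>mprod B P D\<close> vanish, and the mixed terms with \<open>D'\<close> have opposite
      signs because \<open>h\<close> anticommutes with the Koszul signs.\<close>
    have 1: "mprod (B \<times> B') (mkron D (mid B') + mkron ?S D') (mkron h (mid B') + mkron P h') =
        mkron (mprod B D h) (mid B') - mkron (mprod B h ?S) D' + mkron P (mprod B' D' h')"
      by (simp add: simps)
    have 2: "mprod (B \<times> B') (mkron h (mid B') + mkron P h') (mkron D (mid B') + mkron ?S D') =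
        mkron (mprod B h D) (mid B') + mkron (mprod B h ?S) D' + mkron P (mprod B' h' D')"
      by (simp add: simps)
    have "mprod (B \<times> B') (mkron D (mid B') + mkron ?S D') (mkron h (mid B') + mkron P h') +
      mprod (B \<times> B') (mkron h (mid B') + mkron P h') (mkron D (mid B') + mkron ?S D') =
      mkron (mprod B D h + mprod B h D) (mid B') + mkron P (mprod B' D' h' + mprod B' h' D')"
      unfolding 1 2 mkron_add_left mkron_add_right by (intro ext) simp
    also have "\<dots> = mid (B \<times> B') - mkron P P'"
      by (simp add: contraction_hom[OF cA] contraction_hom[OF cC] mkron_diff_left mkron_diff_right mkron_mid)
    finally show "mprod (B \<times> B') (mkron D (mid B') + mkron ?S D') (mkron h (mid B') + mkron P h') +
      mprod (B \<times> B') (mkron h (mid B') + mkron P h') (mkron D (mid B') + mkron ?S D') =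
      mid (B \<times> B') - mkron P P'" .
    show "mkron P P' = 0 \<or> mkron P P' = munit (e, e') (e, e')"
      using contraction_P[OF cA] contraction_P[OF cC] by (auto simp: mkron_munit)
    show "mprod (B \<times> B') (mkron P P') (mkron h (mid B') + mkron P h') = 0"
      by (simp add: simps contraction_Ph[OF cC])
  qed
qed

text \<open>Here \<open>i\<close> and \<open>p\<close> are chain maps, and \<open>i\<close> followed
  by \<open>p\<close> is the identity; sandwiching \<open>h\<close> between them contracts the
  retract. This serves both the cancellation and the renaming of generators.\<close>

lemma contraction_transfer:
  assumes "contraction B g D e P h"
    and fin': "finite B'" and e': "e' \<in> B'" and deg0': "\<And>x. x \<in> B' \<Longrightarrow> g' x = 0 \<longleftrightarrow> x = e'"
    and D': "\<And>x y. D' x y \<noteq> 0 \<Longrightarrow> x \<in> B' \<and> y \<in> B' \<and> g' x = Suc (g' y)"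
    and i: "\<And>x y. i x y \<noteq> 0 \<Longrightarrow> x \<in> B' \<and> y \<in> B \<and> g y = g' x"
    and p: "\<And>x y. p x y \<noteq> 0 \<Longrightarrow> x \<in> B \<and> y \<in> B' \<and> g x = g' y"
    and ip: "mprod B i p = mid B'" and iD: "mprod B i D = mprod B' D' i" and Dp: "mprod B D p = mprod B' p D'"
    and ie: "i e' e = 1" and pe: "p e e' = 1"
    and P': "P' = (if P = 0 then 0 else munit e' e')"
  shows "contraction B' g' D' e' P' (mprod B i (mprod B h p))"
proof -
  have cA: "contraction B g D e P h" by fact
  have supp: "supported B' B i" "supported B B' p" "supported B' B' D'"
    using i p D' by (auto simp: supported_def)
  have DipD: "D' = mprod B i (mprod B D p)"
  proof -
    have "mprod B i (mprod B D p) = mprod B' (mprod B i p) D'" by (simp only: Dp mprod_assoc)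
    then show ?thesis by (simp add: ip mprod_mid_left[OF fin' supp(3)])
  qed
  \<comment> \<open>\<open>e\<close> and \<open>e'\<close> are the only generators of degree 0 on
    their sides, so the degree-preserving \<open>i\<close> can send \<open>e'\<close> only to a
    multiple of \<open>e\<close>.\<close>
  have ie': "i e' y = (if y = e then 1 else 0)" for y
    using i[of e' y] ie contraction_deg0[OF cA, of y] deg0'[OF e'] by (cases "i e' y = 0") auto
  have pe': "p e y = (if y = e' then 1 else 0)" for y
    using p[of e y] pe contraction_deg0[OF cA contraction_e[OF cA]] deg0'[of y] by (cases "p e y = 0") auto
  have ie2: "i x e = (if x = e' then 1 else 0)" for x
    using i[of x e] ie contraction_deg0[OF cA contraction_e[OF cA]] deg0'[of x] by (cases "i x e = 0") auto
  have iPp: "mprod B i (mprod B P p) = P'"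
  proof (cases "P = 0")
    case False
    then have "P = munit e e" using contraction_P[OF cA] by auto
    moreover have "mprod B (munit e e) p = munit e e'"
      by (intro ext) (simp add: mprod_munit_left contraction_fin[OF cA] contraction_e[OF cA] pe', simp add: munit_def)
    moreover have "mprod B i (munit e e') = munit e' e'"
      by (intro ext) (simp add: mprod_munit_right contraction_fin[OF cA] contraction_e[OF cA] ie2, simp add: munit_def)
    ultimately show ?thesis using False by (simp add: P')
  qed (simp add: P')
  show ?thesis
  proof (rule contractionI)
    show "mprod B' D' D' = 0"
    proof -
      have "mprod B' D' D' = mprod B' D' (mprod B i (mprod B D p))" by (simp only: DipD[symmetric])
      also have "\<dots> = mprod B (mprod B' D' i) (mprod B D p)" by (simp only: mprod_assoc)
      also have "\<dots> = mprod B i (mprod B (mprod B D D) p)" by (simp only: iD[symmetric] mprod_assoc)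
      finally show ?thesis by (simp add: contraction_DD[OF cA])
    qed
    have "mprod B' D' (mprod B i (mprod B h p)) = mprod B i (mprod B (mprod B D h) p)"
      by (simp only: mprod_assoc[symmetric] iD)
    moreover have "mprod B' (mprod B i (mprod B h p)) D' = mprod B i (mprod B (mprod B h D) p)"
      by (simp only: mprod_assoc Dp)
    ultimately have "mprod B' D' (mprod B i (mprod B h p)) + mprod B' (mprod B i (mprod B h p)) D' = mprod B i (mprod B (mid B - P) p)"
      by (simp add: contraction_hom[OF cA, symmetric] mprod_algebra)
    also have "\<dots> = mid B' - P'"
      by (simp add: mprod_algebra iPp ip mprod_mid_left[OF contraction_fin[OF cA] supp(2)])
    finally show "mprod B' D' (mprod B i (mprod B h p)) + mprod B' (mprod B i (mprod B h p)) D' = mid B' - P'" .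
    show "P' = 0 \<or> P' = munit e' e'" by (simp add: P')
    show "mprod B' P' (mprod B i (mprod B h p)) = 0"
    proof (cases "P = 0")
      case False
      then have "P = munit e e" using contraction_P[OF cA] by auto
      then have "mprod B (munit e e) h = 0" using contraction_Ph[OF cA] by simp
      then have "mprod B (munit e e) h e z = 0" for z by simp
      then have he: "h e z = 0" for z by (simp add: mprod_munit_left[OF contraction_fin[OF cA] contraction_e[OF cA]])
      have "mprod B i (mprod B h p) e' z = 0" for z
        by (simp add: mprod_def ie' he if_distrib sum.delta contraction_fin[OF cA] cong: if_cong)
      then show ?thesis using fin' e' by (auto simp: P' mprod_munit_left intro!: ext)
    qed (simp add: P')
    show "x \<in> B' \<and> y \<in> B' \<and> g' y = Suc (g' x)" if nz: "mprod B i (mprod B h p) x y \<noteq> 0" for x y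
    proof -
      obtain a b where "i x a \<noteq> 0" "h a b \<noteq> 0" "p b y \<noteq> 0"
        using nz by (elim mprod_nonzeroE)
      then show ?thesis using i[of x a] contraction_h[OF cA, of a b] p[of b y] by simp
    qed
  qed (use fin' e' deg0' D' in auto)
qed

section \<open>Mapping cones\<close>

definition mblock :: "('a \<Rightarrow> 'c \<Rightarrow> 'k) \<Rightarrow> ('a \<Rightarrow> 'd \<Rightarrow> 'k) \<Rightarrow> ('b \<Rightarrow> 'c \<Rightarrow> 'k) \<Rightarrow> ('b \<Rightarrow> 'd \<Rightarrow> 'k::comm_ring_1)
    \<Rightarrow> 'a + 'b \<Rightarrow> 'c + 'd \<Rightarrow> 'k" where
  "mblock X Y Z T = (\<lambda>p q. case p of
     Inl x \<Rightarrow> (case q of Inl y \<Rightarrow> X x y | Inr y \<Rightarrow> Y x y) |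
     Inr x \<Rightarrow> (case q of Inl y \<Rightarrow> Z x y | Inr y \<Rightarrow> T x y))"

lemma mblock_simps [simp]:
  "mblock X Y Z T (Inl x) (Inl y) = X x y" "mblock X Y Z T (Inl x) (Inr w) = Y x w"
  "mblock X Y Z T (Inr u) (Inl y) = Z u y" "mblock X Y Z T (Inr u) (Inr w) = T u w"
  by (simp_all add: mblock_def)

lemma mprod_mblock:
  assumes "finite B" "finite C"
  shows "mprod (B <+> C) (mblock X Y Z T) (mblock X' Y' Z' T') =
    mblock (mprod B X X' + mprod C Y Z') (mprod B X Y' + mprod C Y T') (mprod B Z X' + mprod C T Z') (mprod B Z Y' + mprod C T T')"
proof (intro ext)
  fix p q
  show "mprod (B <+> C) (mblock X Y Z T) (mblock X' Y' Z' T') p q =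
    mblock (mprod B X X' + mprod C Y Z') (mprod B X Y' + mprod C Y T') (mprod B Z X' + mprod C T Z') (mprod B Z Y' + mprod C T T') p q"
    by (cases p; cases q) (simp_all add: mprod_def sum.Plus assms)
qed

lemma mblock_eqI:
  assumes "\<And>x y. M (Inl x) (Inl y) = X x y" "\<And>x y. M (Inl x) (Inr y) = Y x y"
    "\<And>x y. M (Inr x) (Inl y) = Z x y" "\<And>x y. M (Inr x) (Inr y) = T x y"
  shows "M = mblock X Y Z T"
proof (intro ext)
  fix p q show "M p q = mblock X Y Z T p q" using assms by (cases p; cases q) auto
qed

lemma mblock_add: "mblock X Y Z T + mblock X' Y' Z' T' = mblock (X + X') (Y + Y') (Z + Z') (T + T')"
  by (rule mblock_eqI) simp_all

lemma mblock_mid: "mid (B <+> C) = mblock (mid B) 0 0 (mid C)"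
  by (rule mblock_eqI) (auto simp: mid_def)

lemma mblock_zero [simp]: "mblock 0 0 0 0 = 0"
  by (rule sym, rule mblock_eqI) simp_all

lemma arg_cong4: "a = a' \<Longrightarrow> b = b' \<Longrightarrow> c = c' \<Longrightarrow> d = d' \<Longrightarrow> f a b c d = f a' b' c' d'"
  by simp

text \<open>The chain map \<open>f\<close> induces an isomorphism on homology: either both complexes
  are exact, or it carries the class of \<open>e'\<close> to that of \<open>e\<close>. Hence the
  cone is exact, witnessed by an explicit block homotopy.\<close>

lemma contraction_cone:
  assumes "contraction B g D e P h" "contraction B' g' D' e' P' h'" "P = 0 \<longleftrightarrow> P' = 0"
    and f: "\<And>x y. f x y \<noteq> 0 \<Longrightarrow> x \<in> B' \<and> y \<in> B \<and> g' x = g y" and fe: "f e' e = 1"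
    and fD: "mprod B f D = mprod B' D' f"
  shows "\<exists>H. contraction (B <+> B') (case_sum g (\<lambda>x. Suc (g' x))) (mblock D 0 f (- D')) (Inl e) 0 H"
proof -
  have cA: "contraction B g D e P h" by fact
  have cC: "contraction B' g' D' e' P' h'" by fact
  have supp: "supported B' B f" using f by (auto simp: supported_def)
  \<comment> \<open>\<open>s\<close> inverts \<open>f\<close> on the homology classes, if there are
    any. The matrix \<open>a\<close> corrects the failure of \<open>f\<close> to commute with the
    homotopies, as \<open>aD\<close> shows below.\<close>
  define s where "s = (if P = 0 then 0 else munit e e' :: 'a \<Rightarrow> 'c \<Rightarrow> 'b)"
  define a where "a = mprod B' h' (mprod B f h)"
  have fe1: "f x e = (if x = e' then 1 else 0)" for x
    using f[of x e] fe contraction_deg0[OF cA contraction_e[OF cA]] contraction_deg0[OF cC, of x] by (cases "f x e = 0") auto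
  have fe2: "f e' x = (if x = e then 1 else 0)" for x
    using f[of e' x] fe contraction_deg0[OF cA, of x] contraction_deg0[OF cC contraction_e[OF cC]] by (cases "f e' x = 0") auto
  have uf: "mprod B' (munit e e') f = munit e e" "mprod B' (munit e' e') f = munit e' e"
    unfolding mprod_munit_left[OF contraction_fin[OF cC] contraction_e[OF cC]] fe2 by (auto intro!: ext simp: munit_def)
  have fu: "mprod B f (munit e e) = munit e' e" "mprod B f (munit e e') = munit e' e'"
    unfolding mprod_munit_right[OF contraction_fin[OF cA] contraction_e[OF cA]] fe1 by (auto intro!: ext simp: munit_def)
  have PP': "P = 0 \<and> P' = 0 \<and> s = 0 \<or> P = munit e e \<and> P' = munit e' e' \<and> s = munit e e'"
  proof (cases "P = 0")
    case True
    then show ?thesis using assms(3) by (simp add: s_def)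
  next
    case False
    then have "P' \<noteq> 0" using assms(3) by simp
    then show ?thesis using False contraction_P[OF cA] contraction_P[OF cC] by (simp add: s_def)
  qed
  have sf: "mprod B' s f = P" using PP' uf by auto
  have fs: "mprod B f s = P'" using PP' fu by auto
  have fP: "mprod B f P = mprod B' P' f" using PP' uf fu by auto
  have sD: "mprod B' s D' = 0"
  proof -
    have "mprod B' s (mprod B' P' D') = 0" by (simp add: contraction_PD[OF cC])
    moreover have "mprod B' s P' = s" using PP' by (auto simp: contraction_fin[OF cC] contraction_e[OF cC])
    ultimately show ?thesis by (simp add: mprod_assoc[symmetric])
  qed
  have Ds: "mprod B D s = 0"
  proof -
    have "mprod B (mprod B D P) s = 0" by (simp add: contraction_DP[OF cA])
    moreover have "mprod B P s = s" using PP' by (auto simp: contraction_fin[OF cA] contraction_e[OF cA])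
    ultimately show ?thesis by (simp add: mprod_assoc)
  qed
  have fDh: "mprod B f (mprod B D h) = mprod B' D' (mprod B f h)"
    by (simp only: mprod_assoc[symmetric] fD)
  have hfP: "mprod B' h' (mprod B f P) = 0"
    by (simp only: fP mprod_assoc[symmetric] contraction_hP[OF cC] mprod_zero_left)
  have Pfh: "mprod B' P' (mprod B f h) = 0"
    by (simp only: mprod_assoc[symmetric] fP[symmetric]) (simp only: mprod_assoc contraction_Ph[OF cA] mprod_zero_right)
  have fh: "supported B' B (mprod B f h)" by (rule supported_mprod[OF supp contraction_supp_h[OF cA]])
  have "mprod B a D = mprod B' h' (mprod B f (mprod B h D))" by (simp only: a_def mprod_assoc)
  also have "\<dots> = mprod B' h' f - mprod B' h' (mprod B' D' (mprod B f h))"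
    by (simp only: contraction_hD_eq[OF cA] mprod_diff_right mprod_mid_right[OF contraction_fin[OF cA] supp] fDh hfP diff_0_right)
  also have "mprod B' h' (mprod B' D' (mprod B f h)) = mprod B' (mprod B' h' D') (mprod B f h)"
    by (simp only: mprod_assoc)
  also have "\<dots> = mprod B f h - mprod B' D' a"
    by (simp only: contraction_hD_eq[OF cC] mprod_diff_left mprod_mid_left[OF contraction_fin[OF cC] fh] Pfh diff_0_right mprod_assoc a_def)
  finally have aD: "mprod B a D = mprod B' h' f + mprod B' D' a - mprod B f h"
    by (simp only: diff_diff_eq2)
  have degs: "\<And>x y. s x y \<noteq> 0 \<Longrightarrow> x = e \<and> y = e'" by (auto simp: s_def munit_def split: if_splits)
  have dega: "x \<in> B' \<and> y \<in> B \<and> g y = Suc (Suc (g' x))" if nz: "a x y \<noteq> 0" for x y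
  proof -
    obtain u w where "h' x u \<noteq> 0" "f u w \<noteq> 0" "h w y \<noteq> 0"
      using nz unfolding a_def by (elim mprod_nonzeroE)
    then show ?thesis using contraction_h[OF cC, of x u] contraction_h[OF cA, of w y] f[of u w] by simp
  qed
  have "contraction (B <+> B') (case_sum g (\<lambda>x. Suc (g' x))) (mblock D 0 f (- D')) (Inl e) 0 (mblock h s a (- h'))"
  proof (rule contractionI)
    show "finite (B <+> B')" "Inl e \<in> B <+> B'" using contraction_fin[OF cA] contraction_fin[OF cC] contraction_e[OF cA] by auto
    show "(case_sum g (\<lambda>x. Suc (g' x)) x = 0) = (x = Inl e)" if "x \<in> B <+> B'" for x
      using that contraction_deg0[OF cA] by auto
    show "x \<in> B <+> B' \<and> y \<in> B <+> B' \<and> case_sum g (\<lambda>x. Suc (g' x)) x = Suc (case_sum g (\<lambda>x. Suc (g' x)) y)"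
      if "mblock D 0 f (- D') x y \<noteq> 0" for x y
      using that by (cases x; cases y) (auto simp: mblock_def dest: contraction_D[OF cA] contraction_D[OF cC] f)
    show "x \<in> B <+> B' \<and> y \<in> B <+> B' \<and> case_sum g (\<lambda>x. Suc (g' x)) y = Suc (case_sum g (\<lambda>x. Suc (g' x)) x)"
      if "mblock h s a (- h') x y \<noteq> 0" for x y
      using that contraction_e[OF cA] contraction_e[OF cC] contraction_deg0[OF cA contraction_e[OF cA]] contraction_deg0[OF cC contraction_e[OF cC]]
      by (cases x; cases y) (auto simp: mblock_def dest: contraction_h[OF cA] contraction_h[OF cC] dega degs)
    show "mprod (B <+> B') (mblock D 0 f (- D')) (mblock D 0 f (- D')) = 0"
      by (simp add: mprod_mblock contraction_fin[OF cA] contraction_fin[OF cC] contraction_DD[OF cA] contraction_DD[OF cC] mprod_algebra fD)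
    show "mprod (B <+> B') (mblock D 0 f (- D')) (mblock h s a (- h')) +
      mprod (B <+> B') (mblock h s a (- h')) (mblock D 0 f (- D')) = mid (B <+> B') - 0"
    proof -
      have "mprod (B <+> B') (mblock D 0 f (- D')) (mblock h s a (- h')) +
          mprod (B <+> B') (mblock h s a (- h')) (mblock D 0 f (- D')) =
        mblock (mprod B D h + (mprod B h D + mprod B' s f)) (mprod B D s - mprod B' s D')
          (mprod B f h - mprod B' D' a + (mprod B a D - mprod B' h' f)) (mprod B f s + mprod B' D' h' + mprod B' h' D')"
        unfolding mprod_mblock[OF contraction_fin[OF cA] contraction_fin[OF cC]] mblock_add mprod_algebra
        by (rule arg_cong4[where f = mblock]) (simp_all add: mprod_minus_left mprod_minus_right)
      moreover have "mprod B D h + (mprod B h D + mprod B' s f) = mid B"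
        by (simp add: contraction_hD_eq[OF cA] sf)
      moreover have "mprod B f h - mprod B' D' a + (mprod B a D - mprod B' h' f) = 0"
        by (simp add: aD)
      moreover have "mprod B f s + mprod B' D' h' + mprod B' h' D' = mid B'"
        by (simp add: contraction_hD_eq[OF cC] fs)
      moreover have "mid (B <+> B') - 0 = mblock (mid B) 0 0 (mid B' :: 'c \<Rightarrow> 'c \<Rightarrow> 'b)"
        by (simp add: mblock_mid)
      ultimately show ?thesis by (simp only: sD Ds diff_0_right)
    qed
  qed auto
  then show ?thesis by blast
qed

section \<open>Squarefree resolutions\<close>

text \<open>An empty second summand is what the strand of a cone has in multidegrees where the
  second complex contributes no generators.\<close>

lemma contraction_Inl:
  assumes "contraction B g D e P h"
  shows "contraction (B <+> {}) (case_sum g g') (mblock D 0 0 0) (Inl e) (mblock P 0 0 0) (mblock h 0 0 0)"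
proof -
  have cA: "contraction B g D e P h" by fact
  have id: "mid (B <+> {}) = mblock (mid B) 0 0 0"
    by (rule mblock_eqI) (auto simp: mid_def)
  have diff: "mblock X 0 0 0 - mblock Y 0 0 0 = mblock (X - Y) 0 0 0" for X Y :: "'a \<Rightarrow> 'a \<Rightarrow> 'b"
    by (rule mblock_eqI) simp_all
  show ?thesis
  proof (rule contractionI)
    show "mblock P 0 0 0 = 0 \<or> mblock P 0 0 0 = munit (Inl e) (Inl e)"
      using contraction_P[OF cA]
    proof
      assume "P = munit e e"
      moreover have "mblock (munit e e) 0 0 0 = munit (Inl e) (Inl e)"
        by (rule sym, rule mblock_eqI) (auto simp: munit_def)
      ultimately show ?thesis by (intro disjI2) simp
    qed simp
    show "(case_sum g g' x = 0) = (x = Inl e)" if "x \<in> B <+> {}" for x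
      using that contraction_deg0[OF cA] by auto
    show "x \<in> B <+> {} \<and> y \<in> B <+> {} \<and> case_sum g g' x = Suc (case_sum g g' y)"
      if "mblock D 0 0 0 x y \<noteq> 0" for x y
      using that by (cases x; cases y) (auto simp: mblock_def dest: contraction_D[OF cA])
    show "x \<in> B <+> {} \<and> y \<in> B <+> {} \<and> case_sum g g' y = Suc (case_sum g g' x)"
      if "mblock h 0 0 0 x y \<noteq> 0" for x y
      using that by (cases x; cases y) (auto simp: mblock_def dest: contraction_h[OF cA])
  qed (use contraction_fin[OF cA] contraction_e[OF cA] in \<open>auto simp: mprod_mblock contraction_fin[OF cA] contraction_DD[OF cA] contraction_Ph[OF cA] mblock_add contraction_hom[OF cA] id diff\<close>)
qed

section \<open>Strands in squarefree multidegrees\<close>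

definition row_strand :: "('a \<Rightarrow> 'v set) \<Rightarrow> 'v set \<Rightarrow> ('a \<Rightarrow> 'b \<Rightarrow> 'k::comm_ring_1) \<Rightarrow> 'a \<Rightarrow> 'b \<Rightarrow> 'k" where
  "row_strand l W X = (\<lambda>x y. if l x \<subseteq> W then X x y else 0)"

definition decreasing :: "('a \<Rightarrow> 'v set) \<Rightarrow> ('b \<Rightarrow> 'v set) \<Rightarrow> ('a \<Rightarrow> 'b \<Rightarrow> 'k::comm_ring_1) \<Rightarrow> bool" where
  "decreasing l l' X \<longleftrightarrow> (\<forall>x y. X x y \<noteq> 0 \<longrightarrow> l' y \<subseteq> l x)"

text \<open>Only rows are cut down by \<open>row_strand\<close>: a decreasing matrix leads from
  labels inside \<open>W\<close> to labels inside \<open>W\<close>, so the columns take care of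
  themselves and no summand is lost.\<close>

lemma mprod_row_strand:
  assumes "finite B" "decreasing l l' X"
  shows "mprod {y \<in> B. l' y \<subseteq> W} (row_strand l W X) (row_strand l' W Y) = row_strand l W (mprod B X Y)"
proof (intro ext)
  fix x z
  have "(\<Sum>y\<in>{y \<in> B. l' y \<subseteq> W}. X x y * Y y z) = (\<Sum>y\<in>B. X x y * Y y z)" if "l x \<subseteq> W"
  proof (rule sum.mono_neutral_left)
    have "X x y = 0" if "\<not> l' y \<subseteq> W" for y
      using assms(2) \<open>l x \<subseteq> W\<close> that unfolding decreasing_def by blast
    then show "\<forall>y\<in>B - {y \<in> B. l' y \<subseteq> W}. X x y * Y y z = 0" by auto
  qed (use assms in auto)
  then show "mprod {y \<in> B. l' y \<subseteq> W} (row_strand l W X) (row_strand l' W Y) x z = row_strand l W (mprod B X Y) x z"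
    by (auto simp: mprod_def row_strand_def intro!: sum.cong)
qed

text \<open>A squarefree free resolution of \<open>R/I\<close>, where \<open>U\<close> is the family of supports of monomials
  in \<open>I\<close>: the generator \<open>x\<close> sits in homological degree \<open>g x\<close> and multidegree \<open>l x\<close>, and \<open>D\<close>
  consists of the scalar coefficients of the differential. Its strand in multidegree \<open>W\<close> is spanned
  by the generators with label in \<open>W\<close>, and exactness is witnessed by a contracting homotopy.\<close>

definition sqfree_res :: "'b set \<Rightarrow> ('b \<Rightarrow> nat) \<Rightarrow> ('b \<Rightarrow> 'v set) \<Rightarrow> ('b \<Rightarrow> 'b \<Rightarrow> 'k::comm_ring_1) \<Rightarrow> 'b
    \<Rightarrow> 'v set set \<Rightarrow> bool" where
  "sqfree_res B g l D e U \<longleftrightarrow> finite B \<and> decreasing l l D \<and> l e = {} \<and>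
     (\<forall>W. \<exists>h. contraction {x \<in> B. l x \<subseteq> W} g (row_strand l W D) e (if W \<in> U then 0 else munit e e) h)"

text \<open>For \<open>W = UNIV\<close> the strand is the whole complex, so the global facts can be
  read off a single contraction.\<close>

lemma lresD:
  assumes "sqfree_res B g l D e U"
  shows "finite B" "e \<in> B" "\<And>x. x \<in> B \<Longrightarrow> g x = 0 \<longleftrightarrow> x = e"
    "\<And>x y. D x y \<noteq> 0 \<Longrightarrow> x \<in> B \<and> y \<in> B \<and> g x = Suc (g y) \<and> l y \<subseteq> l x"
    "mprod B D D = 0" "decreasing l l D" "l e = {}"
proof -
  have row_strand: "row_strand l UNIV D = D" by (simp add: row_strand_def)
  obtain h where "contraction {x \<in> B. l x \<subseteq> UNIV} g (row_strand l UNIV D) e (if UNIV \<in> U then 0 else munit e e) h"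
    using assms unfolding sqfree_res_def by blast
  then have c: "contraction B g D e (if UNIV \<in> U then 0 else munit e e) h" by (simp add: row_strand)
  show "finite B" "e \<in> B" "\<And>x. x \<in> B \<Longrightarrow> g x = 0 \<longleftrightarrow> x = e" "mprod B D D = 0" "decreasing l l D" "l e = {}"
    using contraction_fin[OF c] contraction_e[OF c] contraction_deg0[OF c] contraction_DD[OF c] assms by (auto simp: sqfree_res_def)
  then show "\<And>x y. D x y \<noteq> 0 \<Longrightarrow> x \<in> B \<and> y \<in> B \<and> g x = Suc (g y) \<and> l y \<subseteq> l x"
    using contraction_D[OF c] unfolding decreasing_def by metis
qed

lemma lresE:
  assumes "sqfree_res B g l D e U"
  obtains h where "\<And>W. contraction {x \<in> B. l x \<subseteq> W} g (row_strand l W D) e (if W \<in> U then 0 else munit e e) (h W)"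
  using assms unfolding sqfree_res_def by metis

text \<open>A union of labels lies in \<open>W\<close> iff both labels do, so the strand in
  \<open>W\<close> is the tensor product of the two strands in \<open>W\<close> and is exact as soon
  as one of them is. Thus the product resolves the quotient by the sum of the ideals even if their
  generators share variables.\<close>

lemma sqfree_res_tensor:
  assumes "sqfree_res B g l D e U" "sqfree_res B' g' l' D' e' U'"
  shows "sqfree_res (B \<times> B') (\<lambda>p. g (fst p) + g' (snd p)) (\<lambda>p. l (fst p) \<union> l' (snd p))
    (mkron D (mid B') + mkron (msign B g) D') (e, e') (U \<union> U')"
proof -
  note F = lresD[OF assms(1)] and F' = lresD[OF assms(2)]
  obtain h where h: "\<And>W. contraction {x \<in> B. l x \<subseteq> W} g (row_strand l W D) e (if W \<in> U then 0 else munit e e) (h W)"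
    by (rule lresE[OF assms(1)]) auto
  obtain h' where h': "\<And>W. contraction {x \<in> B'. l' x \<subseteq> W} g' (row_strand l' W D') e' (if W \<in> U' then 0 else munit e' e') (h' W)"
    by (rule lresE[OF assms(2)]) auto
  let ?l = "\<lambda>p. l (fst p) \<union> l' (snd p)" and ?D = "mkron D (mid B') + mkron (msign B g) D'"
  show ?thesis
    unfolding sqfree_res_def
  proof (intro conjI allI)
    show "decreasing ?l ?l ?D"
      unfolding decreasing_def
    proof (intro allI impI)
      fix x y assume "?D x y \<noteq> 0"
      then have "mkron D (mid B') x y \<noteq> 0 \<or> mkron (msign B g) D' x y \<noteq> 0" by auto
      then show "?l y \<subseteq> ?l x"
        using F(4)[of "fst x" "fst y"] F'(4)[of "snd x" "snd y"]
        by (auto simp: mkron_def mid_def msign_def split: if_splits dest!: mult_not_zero)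
    qed
    fix W
    have 1: "{x \<in> B. l x \<subseteq> W} \<times> {x \<in> B'. l' x \<subseteq> W} = {x \<in> B \<times> B'. ?l x \<subseteq> W}" by auto
    have 2: "mkron (row_strand l W D) (mid {x \<in> B'. l' x \<subseteq> W}) + mkron (msign {x \<in> B. l x \<subseteq> W} g) (row_strand l' W D')
        = row_strand ?l W ?D"
      by (intro ext) (auto simp: mkron_def row_strand_def mid_def msign_def)
    have 3: "mkron (if W \<in> U then 0 else munit e e) (if W \<in> U' then 0 else munit e' e') =
       (if W \<in> U \<union> U' then 0 else munit (e, e') (e, e'))"
      by (auto simp: mkron_munit)
    show "\<exists>H. contraction {x \<in> B \<times> B'. ?l x \<subseteq> W} (\<lambda>p. g (fst p) + g' (snd p)) (row_strand ?l W ?D) (e, e')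
        (if W \<in> U \<union> U' then 0 else munit (e, e') (e, e')) H"
      using contraction_tensor[OF h[of W] h'[of W]] unfolding 1 2 3 by blast
  qed (use F F' in auto)
qed

lemma sqfree_res_transfer:
  assumes "sqfree_res B g l D e U" and fin': "finite B'" and e': "e' \<in> B'"
    and deg0': "\<And>x. x \<in> B' \<Longrightarrow> g' x = 0 \<longleftrightarrow> x = e'"
    and i: "\<And>x y. i x y \<noteq> 0 \<Longrightarrow> x \<in> B' \<and> y \<in> B \<and> g y = g' x \<and> l y \<subseteq> l' x"
    and p: "\<And>x y. p x y \<noteq> 0 \<Longrightarrow> x \<in> B \<and> y \<in> B' \<and> g x = g' y \<and> l' y \<subseteq> l x"
    and ip: "mprod B i p = mid B'" and D': "D' = mprod B i (mprod B D p)"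
    and iD: "mprod B i D = mprod B' D' i" and Dp: "mprod B D p = mprod B' p D'"
    and ie: "i e' e = 1" and pe: "p e e' = 1" and le: "l' e' = {}"
  shows "sqfree_res B' g' l' D' e' U"
proof -
  note F = lresD[OF assms(1)]
  have D'deg: "x \<in> B' \<and> y \<in> B' \<and> g' x = Suc (g' y) \<and> l' y \<subseteq> l' x" if nz: "D' x y \<noteq> 0" for x y
  proof -
    obtain a b where "i x a \<noteq> 0" "D a b \<noteq> 0" "p b y \<noteq> 0"
      using nz unfolding D' by (elim mprod_nonzeroE)
    then show ?thesis using i[of x a] p[of b y] F(4)[of a b] by auto
  qed
  have dec: "decreasing l' l i" "decreasing l l' p" "decreasing l' l' D'"
    using i p D'deg by (auto simp: decreasing_def)
  show ?thesis
    unfolding sqfree_res_def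
  proof (intro conjI allI)
    fix W
    obtain h where "contraction {x \<in> B. l x \<subseteq> W} g (row_strand l W D) e (if W \<in> U then 0 else munit e e) h"
      using assms(1) unfolding sqfree_res_def by blast
    note C = contraction_transfer[OF this, of "{x \<in> B'. l' x \<subseteq> W}" e' g' "row_strand l' W D'" "row_strand l' W i" "row_strand l W p"]
    have nz: "munit e e \<noteq> (0 :: 'a \<Rightarrow> 'a \<Rightarrow> 'c)"
      by (auto simp: munit_def fun_eq_iff intro!: exI[of _ e])
    have "contraction {x \<in> B'. l' x \<subseteq> W} g' (row_strand l' W D') e' (if W \<in> U then 0 else munit e' e')
     (mprod {x \<in> B. l x \<subseteq> W} (row_strand l' W i) (mprod {x \<in> B. l x \<subseteq> W} h (row_strand l W p)))"
    proof (rule C)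
      show "mprod {x \<in> B. l x \<subseteq> W} (row_strand l' W i) (row_strand l W p) = mid {x \<in> B'. l' x \<subseteq> W}"
        by (subst mprod_row_strand) (use F dec in \<open>auto simp: ip row_strand_def mid_def intro!: ext\<close>)
      show "mprod {x \<in> B. l x \<subseteq> W} (row_strand l' W i) (row_strand l W D) = mprod {x \<in> B'. l' x \<subseteq> W} (row_strand l' W D') (row_strand l' W i)"
        by (simp add: mprod_row_strand F(1) fin' dec iD)
      show "mprod {x \<in> B. l x \<subseteq> W} (row_strand l W D) (row_strand l W p) = mprod {x \<in> B'. l' x \<subseteq> W} (row_strand l W p) (row_strand l' W D')"
        by (simp add: mprod_row_strand F(1,6) fin' dec Dp)
    qed (use fin' e' deg0' i p D'deg ie pe le nz F in \<open>auto simp: row_strand_def split: if_splits\<close>, (use i p D'deg in blast)+)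
    then show "\<exists>h. contraction {x \<in> B'. l' x \<subseteq> W} g' (row_strand l' W D') e' (if W \<in> U then 0 else munit e' e') h"
      by blast
  qed (use fin' e' dec le in auto)
qed

text \<open>Gaussian elimination: a nonzero entry between equal labels is a unit in the polynomial
  differential, so its two generators can be split off as an exact summand.\<close>

lemma sqfree_res_cancel:
  fixes D :: "'b \<Rightarrow> 'b \<Rightarrow> 'k::field"
  assumes "sqfree_res B g l D e U" "{} \<notin> U" "D c r \<noteq> 0" "l c = l r"
  shows "\<exists>D' :: 'b \<Rightarrow> 'b \<Rightarrow> 'k. sqfree_res (B - {c, r}) g l D' e U"
proof -
  note F = lresD[OF assms(1)]
  let ?B = "B - {c, r}"
  have cr: "c \<in> B" "r \<in> B" "g c = Suc (g r)" "c \<noteq> r" "c \<noteq> e"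
    using F(4)[OF assms(3)] F(3)[OF F(2)] by auto
  have Dcc: "D x x = 0" for x using F(4)[of x x] by auto
  have Drc: "D r c = 0" using F(4)[of r c] cr by auto
  \<comment> \<open>A nonzero coefficient at \<open>e\<close> from a generator with empty label
    would put 1 into the ideal, against \<open>{} \<notin> U\<close>.\<close>
  have re: "r \<noteq> e"
  proof
    assume [simp]: "r = e"
    obtain h where "contraction {x \<in> B. l x \<subseteq> {}} g (row_strand l {} D) e (if {} \<in> U then 0 else munit e e) h"
      using assms(1) unfolding sqfree_res_def by blast
    then have cW: "contraction {x \<in> B. l x \<subseteq> {}} g (row_strand l {} D) e (munit e e) h"
      using assms(2) by simp
    have "mprod {x \<in> B. l x \<subseteq> {}} (row_strand l {} D) (munit e e) c e = D c e"
      unfolding mprod_munit_right[OF contraction_fin[OF cW] contraction_e[OF cW]] using assms(4) F(7) by (simp add: row_strand_def)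
    then show False using contraction_DP[OF cW] assms(3) by simp
  qed
  define a where "a = D c r"
  have a: "a \<noteq> 0" using assms(3) by (simp add: a_def)
  \<comment> \<open>\<open>i\<close> subtracts from \<open>x\<close> the multiple of
    \<open>c\<close> that removes \<open>r\<close> from the boundary; \<open>p\<close> kills
    \<open>c\<close> and sends \<open>r\<close> to the value that makes the image of the boundary of
    \<open>c\<close> zero. The map \<open>s\<close> from \<open>r\<close> to \<open>c / a\<close> is
    the homotopy between the identity and \<open>p\<close> followed by \<open>i\<close>.\<close>
  define i where "i = (\<lambda>x y. if x \<in> ?B then (if y = x then 1 else 0) - (if y = c then D x r / a else 0) else 0)"
  define p where "p = (\<lambda>x y. if y \<in> ?B then (if y = x then 1 else 0) - (if x = r then D c y / a else 0) else 0)"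
  define s where "s = (\<lambda>x y. if x = r \<and> y = c then 1 / a else 0)"
  have suppD: "supported B B D" using F(4) by (auto simp: supported_def)
  have mprod_i: "mprod B i X x z = (if x \<in> ?B then X x z - D x r / a * X c z else 0)" for X :: "'b \<Rightarrow> 'b \<Rightarrow> 'k" and x z
  proof (cases "x \<in> ?B")
    case True
    have "mprod B i X x z = (\<Sum>y\<in>B. (if y = x then X x z else 0) - (if y = c then D x r / a * X c z else 0))"
      unfolding mprod_def i_def using True by (intro sum.cong) (auto simp: algebra_simps)
    then show ?thesis using True cr F(1) by (simp add: sum_subtractf)
  qed (auto simp: mprod_def i_def)
  have mprod_p: "mprod B X p x z = (if z \<in> ?B then X x z - X x r * (D c z / a) else 0)" for X :: "'b \<Rightarrow> 'b \<Rightarrow> 'k" and x z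
  proof (cases "z \<in> ?B")
    case True
    have "mprod B X p x z = (\<Sum>y\<in>B. (if y = z then X x z else 0) - (if y = r then X x r * (D c z / a) else 0))"
      unfolding mprod_def p_def using True by (intro sum.cong) (auto simp: algebra_simps)
    then show ?thesis using True cr F(1) by (simp add: sum_subtractf)
  qed (auto simp: mprod_def p_def)
  have mprod_s: "mprod B s X = (\<lambda>x z. if x = r then X c z / a else 0)" for X :: "'b \<Rightarrow> 'b \<Rightarrow> 'k"
  proof (intro ext)
    fix x z
    have "mprod B s X x z = (\<Sum>y\<in>B. if y = c then (if x = r then X c z / a else 0) else 0)"
      unfolding mprod_def s_def by (intro sum.cong) auto
    then show "mprod B s X x z = (if x = r then X c z / a else 0)" using F(1) cr by simp
  qed
  have mprod_s': "mprod B X s = (\<lambda>x z. if z = c then X x r / a else 0)" for X :: "'b \<Rightarrow> 'b \<Rightarrow> 'k"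
  proof (intro ext)
    fix x z
    have "mprod B X s x z = (\<Sum>y\<in>B. if y = r then (if z = c then X x r / a else 0) else 0)"
      unfolding mprod_def s_def by (intro sum.cong) auto
    then show "mprod B X s x z = (if z = c then X x r / a else 0)" using F(1) cr by simp
  qed
  have ip: "mprod B i p = mid ?B"
    by (intro ext) (use cr in \<open>auto simp: mprod_i\<close>, use cr in \<open>auto simp: p_def mid_def\<close>)
  have DDcr: "(\<Sum>y\<in>?B. D c y * D y r) = 0"
  proof -
    have "(\<Sum>y\<in>B. D c y * D y r) = mprod B D D c r" by (simp add: mprod_def)
    moreover have "(\<Sum>y\<in>?B. D c y * D y r) = (\<Sum>y\<in>B. D c y * D y r)"
      using F(1) by (intro sum.mono_neutral_left) (auto simp: Dcc)
    ultimately show ?thesis by (simp add: F(5))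
  qed
  have pi: "mprod ?B p i = mid B - (mprod B D s + mprod B s D)"
  proof (intro ext)
    fix x z
    have pB: "mprod ?B p i x z = (if x \<in> ?B then i x z else 0) - (if x = r then (\<Sum>y\<in>?B. D c y / a * i y z) else 0)"
    proof -
      have "mprod ?B p i x z = (\<Sum>y\<in>?B. (if y = x then i x z else 0) - (if x = r then D c y / a * i y z else 0))"
        unfolding mprod_def p_def by (intro sum.cong) (auto simp: algebra_simps)
      then show ?thesis using F(1) by (simp add: sum_subtractf)
    qed
    have sum: "(\<Sum>y\<in>?B. D c y / a * i y z) = (if z \<in> ?B then D c z / a else 0)"
    proof -
      have "(\<Sum>y\<in>?B. D c y / a * i y z) =
         (\<Sum>y\<in>?B. (if y = z then D c z / a else 0) - (if z = c then D c y * D y r / (a * a) else 0))"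
        unfolding i_def by (intro sum.cong) (auto simp: algebra_simps)
      also have "\<dots> = (if z \<in> ?B then D c z / a else 0) - (if z = c then (\<Sum>y\<in>?B. D c y * D y r) / (a * a) else 0)"
        using F(1) by (simp add: sum_subtractf sum_divide_distrib)
      finally show ?thesis by (simp add: DDcr)
    qed
    have rhs: "(mid B - (mprod B D s + mprod B s D)) x z =
        mid B x z - ((if z = c then D x r / a else 0) + (if x = r then D c z / a else 0))"
      by (simp add: mprod_s mprod_s')
    let ?goal = "(if x \<in> ?B then i x z else 0) - (if x = r then if z \<in> ?B then D c z / a else 0 else 0) =
          mid B x z - ((if z = c then D x r / a else 0) + (if x = r then D c z / a else 0))"
    consider "x = c" | "x = r" | "x \<in> ?B" | "x \<notin> B" by blast
    then show "mprod ?B p i x z = (mid B - (mprod B D s + mprod B s D)) x z"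
      unfolding pB sum rhs
    proof cases
      case 1
      then show ?goal
        using cr a by (simp add: mid_def a_def)
    next
      case 2
      have "D c z = 0" if "z \<notin> B" using that supportedD[OF suppD] by blast
      then show ?goal
        using 2 cr a by (cases "z = r"; cases "z = c") (auto simp: mid_def a_def Dcc)
    next
      case 3
      then show ?goal
        by (simp add: mid_def i_def)
    next
      case 4
      then have "D x r = 0" using supportedD[OF suppD] by blast
      then show ?goal
        using 4 cr by (auto simp: mid_def)
    qed
  qed
  have iDs: "mprod B i (mprod B D s) = 0"
    by (intro ext) (use a in \<open>auto simp: mprod_i mprod_s'\<close>, auto simp: a_def)
  have sDp: "mprod B s (mprod B D p) = 0"
    by (intro ext) (use a in \<open>auto simp: mprod_s mprod_p\<close>, auto simp: a_def)
  have supp: "supported ?B B i" "supported B ?B p"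
    using cr by (auto simp: supported_def i_def p_def split: if_splits)
  have "sqfree_res ?B g l (mprod B i (mprod B D p)) e U"
  proof (rule sqfree_res_transfer[OF assms(1), where i = i and p = p])
    have "mprod ?B (mprod B i (mprod B D p)) i = mprod B i (mprod B D (mid B - (mprod B D s + mprod B s D)))"
      by (simp add: mprod_assoc pi)
    also have "\<dots> = mprod B i D - mprod B i (mprod B (mprod B D D) s) - mprod B (mprod B i (mprod B D s)) D"
      by (simp add: mprod_algebra mprod_assoc mprod_mid_right[OF F(1) suppD])
    finally show "mprod B i D = mprod ?B (mprod B i (mprod B D p)) i" by (simp add: F(5) iDs)
    have "mprod ?B p (mprod B i (mprod B D p)) = mprod B (mid B - (mprod B D s + mprod B s D)) (mprod B D p)"
      by (simp add: mprod_assoc[symmetric] pi)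
    also have "\<dots> = mprod B D p - mprod B D (mprod B s (mprod B D p)) - mprod B s (mprod B (mprod B D D) p)"
      by (simp add: mprod_algebra mprod_assoc[symmetric] mprod_mid_left[OF F(1) suppD])
    finally show "mprod B D p = mprod ?B p (mprod B i (mprod B D p))" by (simp add: F(5) sDp)
    show "x \<in> ?B \<and> y \<in> B \<and> g y = g x \<and> l y \<subseteq> l x" if "i x y \<noteq> 0" for x y
      using that cr F(4)[of x r] assms(4) by (auto simp: i_def split: if_splits)
    show "x \<in> B \<and> y \<in> ?B \<and> g x = g y \<and> l y \<subseteq> l x" if "p x y \<noteq> 0" for x y
      using that cr F(4)[of c y] assms(4) by (auto simp: p_def split: if_splits)
    show "i e e = 1" "p e e = 1" using cr re F(2) by (auto simp: i_def p_def)
  qed (use F cr re ip in auto)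
  then show ?thesis by (rule exI[of _ "mprod B i (mprod B D p)"])
qed

lemma munit_nonzero [simp]: "munit a b \<noteq> (0 :: 'a \<Rightarrow> 'b \<Rightarrow> 'k::comm_ring_1)"
proof
  assume "munit a b = (0 :: 'a \<Rightarrow> 'b \<Rightarrow> 'k)"
  then have "munit a b a b = (0 :: 'k)" by simp
  then show False by (simp add: munit_def)
qed

text \<open>The sets with \<open>W \<union> C \<in> U\<close> describe the colon ideal by the
  monomial of \<open>C\<close>, and the sets containing \<open>C\<close> describe the new generator.
  The complex is the mapping cone of a lift of multiplication by this monomial; joining
  \<open>C\<close> to the labels is the squarefree form of the multidegree shift.\<close>

lemma sqfree_res_cone:
  fixes D :: "'b \<Rightarrow> 'b \<Rightarrow> 'k::comm_ring_1" and D' :: "'c \<Rightarrow> 'c \<Rightarrow> 'k"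
  assumes "sqfree_res B g l D e U" "sqfree_res B' g' l' D' e' {W. W \<union> C \<in> U}"
  shows "\<exists>D'' :: 'b + 'c \<Rightarrow> 'b + 'c \<Rightarrow> 'k. sqfree_res (B <+> B') (case_sum g (\<lambda>x. Suc (g' x)))
    (case_sum l (\<lambda>x. l' x \<union> C)) D'' (Inl e) (U \<union> {W. C \<subseteq> W})"
proof -
  note F = lresD[OF assms(1)] and F' = lresD[OF assms(2)]
  obtain h where h: "\<And>W. contraction {x \<in> B. l x \<subseteq> W} g (row_strand l W D) e (if W \<in> U then 0 else munit e e) (h W)"
    by (rule lresE[OF assms(1)]) auto
  obtain h' where h': "\<And>W. contraction {x \<in> B'. l' x \<subseteq> W} g' (row_strand l' W D') e'
      (if W \<in> {W. W \<union> C \<in> U} then 0 else munit e' e') (h' W)"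
    by (rule lresE[OF assms(2)]) auto
  define L where "L x = l' x \<union> C" for x
  \<comment> \<open>The comparison map is built by recursion on the degree: \<open>x\<close> goes to
    the homotopy applied to the image of its boundary. The homotopy is that of the strand
    \<open>L x\<close>, so the labels stay inside \<open>L x\<close>.\<close>
  define fn where "fn = rec_nat (\<lambda>x z. if x = e' \<and> z = e then 1 else 0 :: 'k)
     (\<lambda>n fn x z. mprod B (mprod B' D' fn) (h (L x)) x z)"
  have fn_0: "fn 0 x z = (if x = e' \<and> z = e then 1 else 0)" for x z by (simp add: fn_def)
  have fn_Suc: "fn (Suc n) x z = mprod B (mprod B' D' (fn n)) (h (L x)) x z" for n x z by (simp add: fn_def)
  have fn: "x \<in> B' \<and> z \<in> B \<and> g' x = n \<and> g z = n \<and> l z \<subseteq> L x" if "fn n x z \<noteq> 0" for n x z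
    using that
  proof (induction n arbitrary: x z)
    case 0
    then show ?case using F F' by (auto simp: fn_0 split: if_splits)
  next
    case (Suc n)
    then have nz: "mprod B (mprod B' D' (fn n)) (h (L x)) x z \<noteq> 0" by (simp add: fn_Suc)
    obtain y w where "D' x y \<noteq> 0" "fn n y w \<noteq> 0" "h (L x) w z \<noteq> 0"
      using nz by (elim mprod_nonzeroE)
    then show ?case using F'(4)[of x y] Suc.IH[of y w] contraction_h[OF h, of "L x" w z]
      by (auto simp: L_def)
  qed
  define f where "f x z = fn (g' x) x z" for x z
  have f: "x \<in> B' \<and> z \<in> B \<and> g' x = g z \<and> l z \<subseteq> L x" if "f x z \<noteq> 0" for x z
    using fn that unfolding f_def by metis
  have f_Suc: "f x z = mprod B (mprod B' D' f) (h (L x)) x z" if "g' x = Suc n" for x z n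
  proof -
    have "D' x y * fn n y w = D' x y * f y w" for y w
      using F'(4)[of x y] that by (cases "D' x y = 0") (auto simp: f_def)
    then have "mprod B' D' (fn n) x w = mprod B' D' f x w" for w
      unfolding mprod_def by simp
    then show ?thesis by (simp add: f_def that fn_Suc mprod_def[of B])
  qed
  have dec: "decreasing L l f" using f by (auto simp: decreasing_def)
  have chain: "mprod B f D x z = mprod B' D' f x z" if "g' x = n" for x z n
    using that
  proof (induction n arbitrary: x z)
    case 0
    have "mprod B f D x z = 0"
    proof (rule ccontr)
      assume nz: "mprod B f D x z \<noteq> 0"
      obtain y where "f x y \<noteq> 0" "D y z \<noteq> 0" using nz by (elim mprod_nonzeroE)
      then show False using f[of x y] F(4)[of y z] 0 by auto
    qed
    moreover have "mprod B' D' f x z = 0"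
    proof (rule ccontr)
      assume nz: "mprod B' D' f x z \<noteq> 0"
      obtain y where "D' x y \<noteq> 0" using nz by (elim mprod_nonzeroE)
      then show False using F'(4)[of x y] 0 by auto
    qed
    ultimately show ?case by simp
  next
    case (Suc n)
    define W where "W = L x"
    define P where "P = (if W \<in> U then 0 else munit e e :: 'b \<Rightarrow> 'b \<Rightarrow> 'k)"
    have cA: "contraction {x \<in> B. l x \<subseteq> W} g (row_strand l W D) e P (h W)"
      unfolding P_def by (rule h)
    define u where "u = mprod B' D' f"
    have u: "v \<in> B \<and> l v \<subseteq> W" if nz: "u x v \<noteq> 0" for v
    proof -
      obtain y where "D' x y \<noteq> 0" "f y v \<noteq> 0" using nz unfolding u_def by (elim mprod_nonzeroE)
      then show ?thesis using F'(4)[of x y] f[of y v] by (auto simp: W_def L_def)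
    qed
    have suppu: "supported B' B u"
      unfolding u_def using F'(4) f by (intro supported_mprod[of B' B' _ B' B]) (auto simp: supported_def)
    have hW: "h W v w = 0" if "v \<notin> {x \<in> B. l x \<subseteq> W} \<or> w \<notin> {x \<in> B. l x \<subseteq> W}" for v w
      using contraction_h[OF cA, of v w] that by blast
    have row: "mprod B (h W) D v z = mid B v z - P v z - mprod B D (h W) v z" if "v \<in> B" "l v \<subseteq> W" for v
    proof -
      have "mprod B (h W) D v z = mprod {x \<in> B. l x \<subseteq> W} (h W) (row_strand l W D) v z"
        unfolding mprod_def row_strand_def using F(1) hW by (intro sum.mono_neutral_cong_right) auto
      moreover have "mprod B D (h W) v z = mprod {x \<in> B. l x \<subseteq> W} (row_strand l W D) (h W) v z"
        unfolding mprod_def row_strand_def using F(1) hW that by (intro sum.mono_neutral_cong_right) auto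
      ultimately show ?thesis using that by (simp add: contraction_hD_eq[OF cA] mid_def)
    qed
    \<comment> \<open>\<open>P\<close> is nonzero only if \<open>W\<close> is outside
      \<open>U\<close>. Then \<open>l' x\<close> is outside the colon ideal, and in its strand no
      boundary contains \<open>e'\<close>, the only generator that \<open>f\<close> can map to a
      multiple of \<open>e\<close>.\<close>
    have uP: "mprod B u P x z = 0"
    proof (rule ccontr)
      assume nz: "mprod B u P x z \<noteq> 0"
      obtain v where "u x v \<noteq> 0" "P v z \<noteq> 0" using nz by (elim mprod_nonzeroE)
      then have WU: "W \<notin> U" and ue: "u x e \<noteq> 0" by (auto simp: P_def munit_def split: if_splits)
      obtain y where y: "D' x y \<noteq> 0" "f y e \<noteq> 0" using ue unfolding u_def by (elim mprod_nonzeroE)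
      then have "y = e'" using f[of y e] F(3)[OF F(2)] F'(3)[of y] by auto
      have cC: "contraction {y \<in> B'. l' y \<subseteq> l' x} g' (row_strand l' (l' x) D') e' (munit e' e') (h' (l' x))"
        using h'[of "l' x"] WU by (simp add: W_def L_def)
      have "D' x e' = mprod {y \<in> B'. l' y \<subseteq> l' x} (row_strand l' (l' x) D') (munit e' e') x e'"
        unfolding mprod_munit_right[OF contraction_fin[OF cC] contraction_e[OF cC]] by (simp add: row_strand_def)
      then show False using y \<open>y = e'\<close> by (simp add: contraction_DP[OF cC])
    qed
    have uD: "mprod B u D x w = 0" for w
    proof -
      have "mprod B u D x w = mprod B' D' (mprod B f D) x w" by (simp add: u_def mprod_assoc)
      also have "\<dots> = (\<Sum>y\<in>B'. D' x y * mprod B' D' f y w)"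
      proof -
        have "D' x y * mprod B f D y w = D' x y * mprod B' D' f y w" for y
          using F'(4)[of x y] Suc by (cases "D' x y = 0") auto
        then show ?thesis by (simp add: mprod_def[of B' D'])
      qed
      also have "\<dots> = mprod B' (mprod B' D' D') f x w" by (simp add: mprod_assoc) (simp add: mprod_def[of B' D' "mprod B' D' f"])
      finally show ?thesis by (simp add: F'(5))
    qed
    have "mprod B f D x z = mprod B (mprod B u (h W)) D x z"
      using f_Suc[OF Suc.prems] by (simp add: mprod_def[of B _ D] u_def W_def)
    also have "\<dots> = mprod B u (mprod B (h W) D) x z" by (simp add: mprod_assoc)
    also have "\<dots> = mprod B u (mid B - P - mprod B D (h W)) x z"
    proof -
      have "u x v * mprod B (h W) D v z = u x v * (mid B - P - mprod B D (h W)) v z" for v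
        using row[of v] u[of v] by (cases "u x v = 0") auto
      then show ?thesis by (simp only: mprod_def[of B u])
    qed
    also have "\<dots> = u x z - mprod B (mprod B u D) (h W) x z"
      by (simp add: mprod_diff_right mprod_mid_right[OF F(1) suppu] uP mprod_assoc)
    also have "mprod B (mprod B u D) (h W) x z = 0"
      by (simp add: mprod_def[of B "mprod B u D"] uD)
    finally show ?case by (simp add: u_def)
  qed
  then have fD: "mprod B f D = mprod B' D' f" by (intro ext) blast
  have fe: "f e' e = 1" using F'(3)[OF F'(2)] by (simp add: f_def fn_0)
  let ?l = "case_sum l (\<lambda>x. l' x \<union> C)" and ?g = "case_sum g (\<lambda>x. Suc (g' x))" and ?D = "mblock D 0 f (- D')"
  have "sqfree_res (B <+> B') ?g ?l ?D (Inl e) (U \<union> {W. C \<subseteq> W})"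
    unfolding sqfree_res_def
  proof (intro conjI allI)
    show "decreasing ?l ?l ?D"
      unfolding decreasing_def
    proof (intro allI impI)
      fix x y assume "?D x y \<noteq> 0"
      then show "?l y \<subseteq> ?l x"
        by (cases x; cases y) (auto dest!: F(4) F'(4) f simp: L_def)
    qed
    fix W
    show "\<exists>H. contraction {x \<in> B <+> B'. ?l x \<subseteq> W} ?g (row_strand ?l W ?D) (Inl e)
       (if W \<in> U \<union> {W. C \<subseteq> W} then 0 else munit (Inl e) (Inl e)) H"
    proof (cases "C \<subseteq> W")
      \<comment> \<open>For \<open>C \<subseteq> W\<close>, membership in the colon ideal and in
        \<open>U\<close> agree, so both strands have the same homology and the cone is exact.
        Otherwise no generator of the second complex has its new label inside
        \<open>W\<close>.\<close>
      case True
      then have WC: "W \<union> C = W" by auto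
      have set: "{x \<in> B <+> B'. ?l x \<subseteq> W} = {x \<in> B. l x \<subseteq> W} <+> {x \<in> B'. l' x \<subseteq> W}"
        using True by auto
      have D: "row_strand ?l W ?D = mblock (row_strand l W D) 0 (row_strand L W f) (- row_strand l' W D')"
        by (rule mblock_eqI) (use True in \<open>auto simp: row_strand_def L_def\<close>)
      have rsL: "row_strand L W X = row_strand l' W X" for X :: "'c \<Rightarrow> 'b \<Rightarrow> 'k"
        using True by (auto simp: row_strand_def L_def intro!: ext)
      have fDW: "mprod {x \<in> B. l x \<subseteq> W} (row_strand L W f) (row_strand l W D) = row_strand L W (mprod B' D' f)"
        by (simp only: mprod_row_strand[OF F(1) dec] fD)
      have DfW: "mprod {x \<in> B'. l' x \<subseteq> W} (row_strand l' W D') (row_strand L W f) = row_strand L W (mprod B' D' f)"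
        by (simp only: rsL mprod_row_strand[OF F'(1,6)])
      have "\<exists>H. contraction ({x \<in> B. l x \<subseteq> W} <+> {x \<in> B'. l' x \<subseteq> W}) ?g
          (mblock (row_strand l W D) 0 (row_strand L W f) (- row_strand l' W D')) (Inl e) 0 H"
      proof (rule contraction_cone[OF h[of W] h'[of W]])
        show "mprod {x \<in> B. l x \<subseteq> W} (row_strand L W f) (row_strand l W D) = mprod {x \<in> B'. l' x \<subseteq> W} (row_strand l' W D') (row_strand L W f)"
          by (simp only: fDW DfW)
        show "x \<in> {x \<in> B'. l' x \<subseteq> W} \<and> y \<in> {x \<in> B. l x \<subseteq> W} \<and> g' x = g y" if "row_strand L W f x y \<noteq> 0" for x y
          using that f[of x y] by (auto simp: row_strand_def L_def split: if_splits)
        show "row_strand L W f e' e = 1" using True fe F'(7) by (simp add: row_strand_def L_def)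
      qed (simp add: WC)
      then show ?thesis using True unfolding set D by simp
    next
      case False
      have set: "{x \<in> B <+> B'. ?l x \<subseteq> W} = {x \<in> B. l x \<subseteq> W} <+> {}"
        using False by auto
      have D: "row_strand ?l W ?D = mblock (row_strand l W D) 0 0 0"
        by (rule mblock_eqI) (use False in \<open>auto simp: row_strand_def\<close>)
      have P: "(if W \<in> U \<union> {W. C \<subseteq> W} then 0 else munit (Inl e) (Inl e)) =
          mblock (if W \<in> U then 0 else munit e e) 0 0 (0 :: 'c \<Rightarrow> 'c \<Rightarrow> 'k)"
        by (rule mblock_eqI) (use False in \<open>auto simp: munit_def\<close>)
      show ?thesis
        unfolding set D P using contraction_Inl[OF h[of W], of "\<lambda>x. Suc (g' x)"] by blast
    qed
  qed (use F F' in auto)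
  then show ?thesis by (rule exI[of _ ?D])
qed

text \<open>The clause on nonzero entries lets minimality survive the renaming of
  generators.\<close>

lemma sqfree_res_reindex:
  fixes D :: "'b \<Rightarrow> 'b \<Rightarrow> 'k::comm_ring_1"
  assumes "sqfree_res B g l D e U" "inj_on f B"
  shows "\<exists>D' :: 'c \<Rightarrow> 'c \<Rightarrow> 'k. sqfree_res (f ` B) (g \<circ> inv_into B f) (l \<circ> inv_into B f) D' (f e) U \<and>
    (\<forall>x y. D' x y \<noteq> 0 \<longrightarrow> D (inv_into B f x) (inv_into B f y) \<noteq> 0)"
proof -
  note F = lresD[OF assms(1)]
  define i where "i = (\<lambda>x y. if y \<in> B \<and> x = f y then 1 else 0 :: 'k)"
  define p where "p = (\<lambda>x y. if x \<in> B \<and> y = f x then 1 else 0 :: 'k)"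
  note inj = inv_into_f_f[OF assms(2)] inj_on_eq_iff[OF assms(2)]
  have ip: "mprod B i p = mid (f ` B)"
  proof (intro ext)
    fix x z
    have "mprod B i p x z = (\<Sum>y\<in>B. if f y = x \<and> x = z then 1 else 0)"
      unfolding mprod_def i_def p_def by (intro sum.cong) auto
    also have "\<dots> = (\<Sum>y\<in>B. if y = inv_into B f x \<and> x \<in> f ` B \<and> x = z then 1 else 0)"
      using inj by (intro sum.cong) auto
    also have "\<dots> = mid (f ` B) x z"
      using F(1) inv_into_into[of x f B] by (cases "x \<in> f ` B \<and> x = z") (auto simp: mid_def)
    finally show "mprod B i p x z = mid (f ` B) x z" .
  qed
  have pi: "mprod (f ` B) p i = mid B"
  proof (intro ext)
    fix x z
    have "mprod (f ` B) p i x z = (\<Sum>y\<in>f ` B. if y = f x then (if x \<in> B \<and> x = z then 1 else 0) else 0)"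
      unfolding mprod_def i_def p_def using inj by (intro sum.cong) auto
    then show "mprod (f ` B) p i x z = mid B x z"
      using F(1) by (auto simp: mid_def)
  qed
  have supp: "supported B B D" using F(4) by (auto simp: supported_def)
  have "sqfree_res (f ` B) (g \<circ> inv_into B f) (l \<circ> inv_into B f) (mprod B i (mprod B D p)) (f e) U"
  proof (rule sqfree_res_transfer[OF assms(1), where i = i and p = p])
    show "mprod B i D = mprod (f ` B) (mprod B i (mprod B D p)) i"
      by (simp add: mprod_assoc pi mprod_mid_right[OF F(1) supp])
    show "mprod B D p = mprod (f ` B) p (mprod B i (mprod B D p))"
      by (simp add: mprod_assoc[symmetric] pi mprod_mid_left[OF F(1) supp])
  qed (use F ip inj in \<open>auto simp: i_def p_def split: if_splits\<close>)
  moreover have "D (inv_into B f x) (inv_into B f y) \<noteq> 0" if nz: "mprod B i (mprod B D p) x y \<noteq> 0" for x y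
  proof -
    obtain a b where "i x a \<noteq> 0" "D a b \<noteq> 0" "p b y \<noteq> 0" using nz by (elim mprod_nonzeroE)
    then show ?thesis using inj(1) by (auto simp: i_def p_def split: if_splits)
  qed
  ultimately show ?thesis by (intro exI[of _ "mprod B i (mprod B D p)"]) blast
qed

text \<open>Types cannot be quantified over, so the generators are numbered by \<open>nat\<close>;
  the \<open>itself\<close> argument names the coefficient ring.\<close>

definition has_sqfree_res :: "'k::comm_ring_1 itself \<Rightarrow> 'v set set \<Rightarrow> nat \<Rightarrow> bool" where
  "has_sqfree_res T U r \<longleftrightarrow> (\<exists>(B :: nat set) g l (D :: nat \<Rightarrow> nat \<Rightarrow> 'k) e.
     sqfree_res B g l D e U \<and> (\<forall>x\<in>B. card (l x) \<le> g x + r))"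

lemma has_sqfree_res_reindex:
  fixes D :: "'b \<Rightarrow> 'b \<Rightarrow> 'k::comm_ring_1"
  assumes "sqfree_res B g l D e U" "\<And>x. x \<in> B \<Longrightarrow> card (l x) \<le> g x + r"
  shows "has_sqfree_res TYPE('k) U r"
proof -
  obtain f :: "'b \<Rightarrow> nat" where f: "inj_on f B"
    using finite_imp_inj_to_nat_seg[OF lresD(1)[OF assms(1)]] by blast
  obtain D' :: "nat \<Rightarrow> nat \<Rightarrow> 'k" where "sqfree_res (f ` B) (g \<circ> inv_into B f) (l \<circ> inv_into B f) D' (f e) U"
    using sqfree_res_reindex[OF assms(1) f] by blast
  moreover have "\<forall>x\<in>f ` B. card ((l \<circ> inv_into B f) x) \<le> (g \<circ> inv_into B f) x + r"
    using assms(2) inv_into_into[of _ f B] by auto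
  ultimately show ?thesis unfolding has_sqfree_res_def by blast
qed

text \<open>The size of a union is at most the sum of the sizes, so the bounds add up. For ideals
  this is the Kalai-Meshulam inequality on the regularity of sums.\<close>

lemma has_sqfree_res_tensor:
  assumes "has_sqfree_res TYPE('k::comm_ring_1) U r" "has_sqfree_res TYPE('k) U' r'"
  shows "has_sqfree_res TYPE('k) (U \<union> U') (r + r')"
proof -
  obtain B :: "nat set" and g l and D :: "nat \<Rightarrow> nat \<Rightarrow> 'k" and e
    where 1: "sqfree_res B g l D e U" "\<forall>x\<in>B. card (l x) \<le> g x + r"
    using assms(1) unfolding has_sqfree_res_def by blast
  obtain B' :: "nat set" and g' l' and D' :: "nat \<Rightarrow> nat \<Rightarrow> 'k" and e'
    where 2: "sqfree_res B' g' l' D' e' U'" "\<forall>x\<in>B'. card (l' x) \<le> g' x + r'"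
    using assms(2) unfolding has_sqfree_res_def by blast
  show ?thesis
  proof (rule has_sqfree_res_reindex[OF sqfree_res_tensor[OF 1(1) 2(1)]])
    fix x assume "x \<in> B \<times> B'"
    then show "card (l (fst x) \<union> l' (snd x)) \<le> g (fst x) + g' (snd x) + (r + r')"
      using 1(2) 2(2) card_Un_le[of "l (fst x)" "l' (snd x)"] by fastforce
  qed
qed

text \<open>Generators of the second complex gain at most \<open>card C\<close> in label size and
  exactly one in homological degree, whence \<open>Suc r\<close> in the hypothesis.\<close>

lemma has_sqfree_res_cone:
  assumes "has_sqfree_res TYPE('k::comm_ring_1) U r" "has_sqfree_res TYPE('k) {W. W \<union> C \<in> U} s" "s + card C \<le> Suc r"
  shows "has_sqfree_res TYPE('k) (U \<union> {W. C \<subseteq> W}) r"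
proof -
  obtain B :: "nat set" and g l and D :: "nat \<Rightarrow> nat \<Rightarrow> 'k" and e
    where 1: "sqfree_res B g l D e U" "\<forall>x\<in>B. card (l x) \<le> g x + r"
    using assms(1) unfolding has_sqfree_res_def by blast
  obtain B' :: "nat set" and g' l' and D' :: "nat \<Rightarrow> nat \<Rightarrow> 'k" and e'
    where 2: "sqfree_res B' g' l' D' e' {W. W \<union> C \<in> U}" "\<forall>x\<in>B'. card (l' x) \<le> g' x + s"
    using assms(2) unfolding has_sqfree_res_def by blast
  obtain D'' :: "nat + nat \<Rightarrow> nat + nat \<Rightarrow> 'k" where "sqfree_res (B <+> B') (case_sum g (\<lambda>x. Suc (g' x)))
    (case_sum l (\<lambda>x. l' x \<union> C)) D'' (Inl e) (U \<union> {W. C \<subseteq> W})"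
    using sqfree_res_cone[OF 1(1) 2(1)] by blast
  then show ?thesis
  proof (rule has_sqfree_res_reindex)
    fix x assume "x \<in> B <+> B'"
    then show "card (case_sum l (\<lambda>x. l' x \<union> C) x) \<le> case_sum g (\<lambda>x. Suc (g' x)) x + r"
    proof (cases x)
      case (Inr y)
      then have "card (l' y) \<le> g' y + s" using 2(2) \<open>x \<in> B <+> B'\<close> by auto
      then show ?thesis using Inr card_Un_le[of "l' y" C] assms(3) by simp
    qed (use 1(2) in auto)
  qed
qed

lemma sqfree_res_zero:
  "sqfree_res {e} (\<lambda>_. 0) (\<lambda>_. {}) (0 :: 'b \<Rightarrow> 'b \<Rightarrow> 'k::comm_ring_1) e {}"
proof -
  have row_strand: "row_strand l W (0 :: 'b \<Rightarrow> 'b \<Rightarrow> 'k) = 0" for l :: "'b \<Rightarrow> 'v set" and W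
    by (auto simp: row_strand_def intro!: ext)
  have "contraction {e} (\<lambda>_. 0) 0 e (munit e e) (0 :: 'b \<Rightarrow> 'b \<Rightarrow> 'k)"
  proof (rule contractionI)
    show "mprod {e} 0 0 + mprod {e} 0 0 = mid {e} - (munit e e :: 'b \<Rightarrow> 'b \<Rightarrow> 'k)"
      by (auto simp: mid_def munit_def intro!: ext)
  qed auto
  then show ?thesis unfolding sqfree_res_def row_strand by (auto simp: decreasing_def)
qed

lemma has_sqfree_res_empty: "has_sqfree_res TYPE('k::comm_ring_1) {} r"
  by (rule has_sqfree_res_reindex[OF sqfree_res_zero]) auto

lemma has_sqfree_res_mono: "has_sqfree_res T U r \<Longrightarrow> r \<le> s \<Longrightarrow> has_sqfree_res T U s"
  unfolding has_sqfree_res_def by (meson add_left_mono le_trans)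

lemma has_sqfree_res_principal: "card C \<le> Suc r \<Longrightarrow> has_sqfree_res TYPE('k::comm_ring_1) {W. C \<subseteq> W} r"
proof -
  assume "card C \<le> Suc r"
  then have "has_sqfree_res TYPE('k) ({} \<union> {W. C \<subseteq> W}) r"
    by (intro has_sqfree_res_cone[where s = 0]) (simp_all add: has_sqfree_res_empty)
  then show ?thesis by simp
qed

text \<open>Tensoring one variable at a time builds the Koszul complex of \<open>S\<close>, in which
  label size and homological degree grow together.\<close>

lemma has_sqfree_res_variables:
  assumes "finite S" shows "has_sqfree_res TYPE('k::comm_ring_1) {W. W \<inter> S \<noteq> {}} 0"
  using assms
proof (induction S)
  case empty
  then show ?case by (simp add: has_sqfree_res_empty)
next
  case (insert v S)
  have "{W. W \<inter> insert v S \<noteq> {}} = {W. W \<inter> S \<noteq> {}} \<union> {W. {v} \<subseteq> W}" by auto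
  then show ?case
    using has_sqfree_res_tensor[OF insert.IH has_sqfree_res_principal[of "{v}" 0]] by simp
qed

section \<open>Minimal squarefree resolutions\<close>

definition minimal_sqfree_res :: "'b set \<Rightarrow> ('b \<Rightarrow> nat) \<Rightarrow> ('b \<Rightarrow> 'v set) \<Rightarrow> ('b \<Rightarrow> 'b \<Rightarrow> 'k::comm_ring_1) \<Rightarrow> 'b
    \<Rightarrow> 'v set set \<Rightarrow> bool" where
  "minimal_sqfree_res B g l D e U \<longleftrightarrow> sqfree_res B g l D e U \<and> (\<forall>x y. D x y \<noteq> 0 \<longrightarrow> l x \<noteq> l y)"

text \<open>Each cancellation removes two generators and leaves the labels and degrees of the others
  unchanged, so the process ends and the size bound survives. When it ends, nonzero entries join
  different labels, that is, the polynomial entries are multiples of nonconstant monomials.\<close>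

lemma minimal_sqfree_res_exists:
  assumes "has_sqfree_res TYPE('k::field) U r" "{} \<notin> U"
  shows "\<exists>(B :: nat set) g l (D :: nat \<Rightarrow> nat \<Rightarrow> 'k) e.
     minimal_sqfree_res B g l D e U \<and> (\<forall>x\<in>B. card (l x) \<le> g x + r)"
proof -
  have "\<exists>(B' :: nat set) (D' :: nat \<Rightarrow> nat \<Rightarrow> 'k). minimal_sqfree_res B' g l D' e U \<and> B' \<subseteq> B"
    if "sqfree_res B g l D e U" for B g l e and D :: "nat \<Rightarrow> nat \<Rightarrow> 'k"
    using that
  proof (induction "card B" arbitrary: B D rule: less_induct)
    case less
    show ?case
    proof (cases "minimal_sqfree_res B g l D e U")
      case False
      then obtain c r where cr: "D c r \<noteq> 0" "l c = l r"
        using less.prems by (auto simp: minimal_sqfree_res_def)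
      obtain D' :: "nat \<Rightarrow> nat \<Rightarrow> 'k" where D': "sqfree_res (B - {c, r}) g l D' e U"
        using sqfree_res_cancel[OF less.prems assms(2) cr] by blast
      have "c \<in> B" using lresD(4)[OF less.prems cr(1)] by simp
      then have "card (B - {c, r}) < card B"
        using lresD(1)[OF less.prems] by (intro psubset_card_mono) auto
      from less.hyps[OF this D'] show ?thesis by blast
    qed (use less.prems in blast)
  qed
  then show ?thesis using assms(1) unfolding has_sqfree_res_def by (meson subsetD)
qed

lemma minimal_sqfree_res_principal:
  assumes "C \<noteq> {}"
  shows "minimal_sqfree_res {False, True} (\<lambda>x. if x then 1 else 0) (\<lambda>x. if x then C else {})
    (\<lambda>x y. if x \<and> \<not> y then 1 else 0 :: 'k::comm_ring_1) False {W. C \<subseteq> W}"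
proof -
  let ?l = "\<lambda>x. if x then C else {}" and ?D = "\<lambda>x y. if x \<and> \<not> y then 1 else 0 :: 'k"
    and ?g = "\<lambda>x. if x then 1 else 0 :: nat"
  have "\<exists>h. contraction {x \<in> {False, True}. ?l x \<subseteq> W} ?g (row_strand ?l W ?D) False
      (if W \<in> {W. C \<subseteq> W} then 0 else munit False False) h" for W
  proof (cases "C \<subseteq> W")
    case True
    then have 1: "{x \<in> {False, True}. ?l x \<subseteq> W} = {False, True}" "row_strand ?l W ?D = ?D"
      using True by (auto simp: row_strand_def fun_eq_iff)
    have "contraction {False, True} ?g ?D False 0 (\<lambda>x y. if \<not> x \<and> y then 1 else 0)"
      by (rule contractionI) (auto simp: mprod_def mid_def intro!: ext split: if_splits)
    then show ?thesis using True unfolding 1 by auto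
  next
    case False
    then have 1: "{x \<in> {False, True}. ?l x \<subseteq> W} = {False}" "row_strand ?l W ?D = 0"
      using False by (auto simp: row_strand_def fun_eq_iff)
    have "contraction {False} ?g 0 False (munit False False) (0 :: bool \<Rightarrow> bool \<Rightarrow> 'k)"
      by (rule contractionI) (auto simp: mprod_def mid_def munit_def intro!: ext split: if_splits)
    then show ?thesis using False unfolding 1 by auto
  qed
  then show ?thesis
    using assms unfolding minimal_sqfree_res_def sqfree_res_def by (auto simp: decreasing_def)
qed

text \<open>The Koszul complex on the monomials with supports in \<open>M\<close>, as an iterated
  tensor product. It stays minimal because of disjointness: the label of a pair, intersected with
  \<open>C\<close> and with \<open>\<Union>M\<close>, gives back the labels of both
  components.\<close>

lemma minimal_sqfree_res_disjoint:
  assumes "finite M" "disjoint M" "{} \<notin> M"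
  shows "\<exists>(B :: nat set) g l (D :: nat \<Rightarrow> nat \<Rightarrow> 'k::comm_ring_1) e.
     minimal_sqfree_res B g l D e {W. \<exists>C\<in>M. C \<subseteq> W} \<and> (\<exists>x\<in>B. g x = card M \<and> l x = \<Union>M) \<and> (\<forall>x\<in>B. l x \<subseteq> \<Union>M)"
  using assms
proof (induction M)
  case empty
  have "minimal_sqfree_res {0 :: nat} (\<lambda>_. 0) (\<lambda>_. {}) (0 :: nat \<Rightarrow> nat \<Rightarrow> 'k) 0 {W. \<exists>C\<in>{}. C \<subseteq> W}"
    using sqfree_res_zero by (simp add: minimal_sqfree_res_def)
  then show ?case by fastforce
next
  case (insert C M)
  have "disjoint M" "{} \<notin> M" "C \<noteq> {}" using insert.prems by (auto simp: pairwise_insert)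
  then obtain B :: "nat set" and g l and D :: "nat \<Rightarrow> nat \<Rightarrow> 'k" and e x where
    IH: "minimal_sqfree_res B g l D e {W. \<exists>C\<in>M. C \<subseteq> W}" "x \<in> B" "g x = card M" "l x = \<Union>M" "\<forall>x\<in>B. l x \<subseteq> \<Union>M"
    using insert.IH by blast
  have "C \<inter> C' = {}" if "C' \<in> M" for C'
    using disjointD[OF insert.prems(1), of C C'] that insert.hyps by auto
  then have CM: "C \<inter> \<Union>M = {}" by blast
  define B' where "B' = {False, True}"
  define g' where "g' = (\<lambda>x. if x then 1 else 0 :: nat)"
  define l' where "l' = (\<lambda>x. if x then C else {})"
  define D' where "D' = (\<lambda>x y. if x \<and> \<not> y then 1 else 0 :: 'k)"
  have K: "minimal_sqfree_res B' g' l' D' False {W. C \<subseteq> W}"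
    unfolding B'_def g'_def l'_def D'_def by (rule minimal_sqfree_res_principal[OF \<open>C \<noteq> {}\<close>])
  have L: "sqfree_res B g l D e {W. \<exists>C\<in>M. C \<subseteq> W}" "sqfree_res B' g' l' D' False {W. C \<subseteq> W}"
    using IH K by (auto simp: minimal_sqfree_res_def)
  let ?B = "B \<times> B'" and ?l = "\<lambda>p. l (fst p) \<union> l' (snd p)" and ?g = "\<lambda>p. g (fst p) + g' (snd p)"
  let ?D = "mkron D (mid B') + mkron (msign B g) D'"
  have U: "{W. \<exists>C\<in>M. C \<subseteq> W} \<union> {W. C \<subseteq> W} = {W. \<exists>C\<in>insert C M. C \<subseteq> W}" by auto
  note T = sqfree_res_tensor[OF L, unfolded U]
  have min: "?l p \<noteq> ?l q" if "?D p q \<noteq> 0" for p q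
  proof -
    note pq = lresD(4)[OF T that]
    have sub: "l (fst p) \<subseteq> \<Union>M" "l (fst q) \<subseteq> \<Union>M" "l' (snd p) \<subseteq> C" "l' (snd q) \<subseteq> C"
      using pq IH(5) by (auto simp: l'_def)
    have "mkron D (mid B') p q \<noteq> 0 \<or> mkron (msign B g) D' p q \<noteq> 0" using that by auto
    then consider "D (fst p) (fst q) \<noteq> 0" | "D' (snd p) (snd q) \<noteq> 0"
      by (auto simp: mkron_def dest: mult_not_zero)
    then have "l (fst p) \<noteq> l (fst q) \<or> l' (snd p) \<noteq> l' (snd q)"
      by cases (use IH(1) K in \<open>auto simp: minimal_sqfree_res_def\<close>)
    moreover have "l (fst p) = ?l p \<inter> \<Union>M" "l (fst q) = ?l q \<inter> \<Union>M" "l' (snd p) = ?l p \<inter> C" "l' (snd q) = ?l q \<inter> C"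
      using sub CM by blast+
    ultimately show ?thesis by metis
  qed
  obtain f :: "nat \<times> bool \<Rightarrow> nat" where f: "inj_on f ?B"
    using finite_imp_inj_to_nat_seg[OF lresD(1)[OF T]] by blast
  let ?i = "inv_into ?B f"
  obtain D'' :: "nat \<Rightarrow> nat \<Rightarrow> 'k" where
    D'': "sqfree_res (f ` ?B) (?g \<circ> ?i) (?l \<circ> ?i) D'' (f (e, False)) {W. \<exists>C\<in>insert C M. C \<subseteq> W}"
    "\<forall>x y. D'' x y \<noteq> 0 \<longrightarrow> ?D (?i x) (?i y) \<noteq> 0"
    using sqfree_res_reindex[OF T f] by blast
  have "minimal_sqfree_res (f ` ?B) (?g \<circ> ?i) (?l \<circ> ?i) D'' (f (e, False)) {W. \<exists>C\<in>insert C M. C \<subseteq> W}"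
    unfolding minimal_sqfree_res_def using D'' min by fastforce
  moreover have "f (x, True) \<in> f ` ?B" "(?g \<circ> ?i) (f (x, True)) = card (insert C M)"
    "(?l \<circ> ?i) (f (x, True)) = \<Union>(insert C M)"
    using IH insert.hyps inv_into_f_f[OF f, of "(x, True)"] by (auto simp: B'_def g'_def l'_def)
  moreover have "\<forall>y\<in>f ` ?B. (?l \<circ> ?i) y \<subseteq> \<Union>(insert C M)"
  proof
    fix y assume "y \<in> f ` ?B"
    then have "fst (?i y) \<in> B" using inv_into_into[of y f ?B] by auto
    then have "l (fst (?i y)) \<subseteq> \<Union>M" using IH(5) by blast
    moreover have "l' (snd (?i y)) \<subseteq> C" by (simp add: l'_def)
    ultimately show "(?l \<circ> ?i) y \<subseteq> \<Union>(insert C M)" by (simp, blast)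
  qed
  ultimately show ?case by blast
qed

section \<open>Graded Betti numbers\<close>

text \<open>If \<open>R\<close> were smaller, padding both matrices with zeros to square ones would
  give a product equal to the identity. The product in the other order would then be the identity as
  well, although its last row is zero.\<close>

lemma card_le_of_left_inverse:
  fixes F :: "'r \<Rightarrow> 'c \<Rightarrow> 'k::field"
  assumes "finite A" "finite R"
    and GF: "\<And>c c'. c \<in> A \<Longrightarrow> c' \<in> A \<Longrightarrow> (\<Sum>r\<in>R. G c' r * F r c) = (if c' = c then 1 else 0)"
  shows "card A \<le> card R"
proof (rule ccontr)
  assume "\<not> ?thesis"
  then have less: "card R < card A" by simp
  let ?n = "card A" and ?m = "card R"
  obtain a where a: "bij_betw a {0..<?n} A" using ex_bij_betw_nat_finite[OF assms(1)] by blast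
  obtain r where r: "bij_betw r {0..<?m} R" using ex_bij_betw_nat_finite[OF assms(2)] by blast
  define G' where "G' = mat ?n ?n (\<lambda>(i, j). if j < ?m then G (a i) (r j) else 0)"
  define F' where "F' = mat ?n ?n (\<lambda>(j, k). if j < ?m then F (r j) (a k) else 0)"
  have carr: "G' \<in> carrier_mat ?n ?n" "F' \<in> carrier_mat ?n ?n" by (auto simp: G'_def F'_def)
  have "G' * F' = 1\<^sub>m ?n"
  proof (rule eq_matI)
    fix i k assume ik: "i < dim_row (1\<^sub>m ?n :: 'k mat)" "k < dim_col (1\<^sub>m ?n :: 'k mat)"
    have "(G' * F') $$ (i, k) = (\<Sum>j\<in>{0..<?n}. if j < ?m then G (a i) (r j) * F (r j) (a k) else 0)"
      using ik by (auto simp: G'_def F'_def scalar_prod_def intro!: sum.cong)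
    also have "\<dots> = (\<Sum>j\<in>{0..<?m}. G (a i) (r j) * F (r j) (a k))"
      using less by (intro sum.mono_neutral_cong_right) auto
    also have "\<dots> = (\<Sum>x\<in>R. G (a i) x * F x (a k))"
      using sum.reindex_bij_betw[OF r, of "\<lambda>x. G (a i) x * F x (a k)"] by simp
    also have "\<dots> = (if a i = a k then 1 else 0)"
      using a ik by (intro GF) (auto simp: bij_betw_def)
    also have "\<dots> = 1\<^sub>m ?n $$ (i, k)"
      using a ik inj_onD[of a "{0..<?n}" i k] by (auto simp: bij_betw_def)
    finally show "(G' * F') $$ (i, k) = 1\<^sub>m ?n $$ (i, k)" .
  qed (use carr in auto)
  then have FG: "F' * G' = 1\<^sub>m ?n" using mat_mult_left_right_inverse[OF carr] by blast
  have "(F' * G') $$ (?n - 1, ?n - 1) = 0"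
    using less by (auto simp: F'_def G'_def scalar_prod_def intro!: sum.neutral)
  moreover have "(F' * G') $$ (?n - 1, ?n - 1) = 1"
    using less by (simp add: FG)
  ultimately show False by simp
qed

section \<open>Homogeneous parts and constant terms\<close>

abbreviation mdeg :: "('v::finite \<Rightarrow>\<^sub>0 nat) \<Rightarrow> int" where
  "mdeg m \<equiv> int (\<Sum>v\<in>UNIV. Poly_Mapping.lookup m v)"

lemma mdeg_add: "mdeg (a + b) = mdeg a + mdeg b"
  by (simp add: lookup_add sum.distrib)

definition homogeneous_part :: "int \<Rightarrow> ('v::finite, 'k::field) mpoly \<Rightarrow> ('v, 'k) mpoly" where
  "homogeneous_part e p = Abs_poly_mapping (\<lambda>m. Poly_Mapping.lookup p m when mdeg m = e)"

lemma lookup_homogeneous_part: "Poly_Mapping.lookup (homogeneous_part e p) m = (Poly_Mapping.lookup p m when mdeg m = e)"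
proof -
  have "finite {m. (Poly_Mapping.lookup p m when mdeg m = e) \<noteq> 0}"
    by (rule finite_subset[of _ "{m. Poly_Mapping.lookup p m \<noteq> 0}"]) (auto simp: when_def)
  then show ?thesis by (simp add: homogeneous_part_def Abs_poly_mapping_inverse)
qed

lemma homogeneous_part_add: "homogeneous_part e (p + q) = homogeneous_part e p + homogeneous_part e q"
  by (rule poly_mapping_eqI) (simp add: lookup_homogeneous_part lookup_add when_add_distrib)

lemma homogeneous_part_zero [simp]: "homogeneous_part e 0 = 0"
  by (rule poly_mapping_eqI) (simp add: lookup_homogeneous_part)

lemma homogeneous_part_sum: "homogeneous_part e (\<Sum>i\<in>S. f i) = (\<Sum>i\<in>S. homogeneous_part e (f i))"
  by (induction S rule: infinite_finite_induct) (auto simp: homogeneous_part_add)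

lemma homogeneous_homogeneous_part: "homogeneous e (homogeneous_part e p)"
  by (auto simp: homogeneous_def in_keys_iff lookup_homogeneous_part)

lemma homogeneous_part_homogeneous: "homogeneous e p \<Longrightarrow> homogeneous_part e p = p"
  by (rule poly_mapping_eqI) (auto simp: homogeneous_def in_keys_iff lookup_homogeneous_part when_def)

lemma homogeneous_part_eq_0: "(\<And>m. m \<in> Poly_Mapping.keys p \<Longrightarrow> mdeg m \<noteq> e) \<Longrightarrow> homogeneous_part e p = 0"
  by (rule poly_mapping_eqI) (auto simp: in_keys_iff lookup_homogeneous_part when_def)

lemma homogeneous_mult: "homogeneous a p \<Longrightarrow> homogeneous b q \<Longrightarrow> homogeneous (a + b) (p * q)"
  unfolding homogeneous_def using keys_mult[of p q] mdeg_add by fastforce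

lemma homogeneous_sum: "(\<And>i. i \<in> S \<Longrightarrow> homogeneous e (f i)) \<Longrightarrow> homogeneous e (\<Sum>i\<in>S. f i)"
  unfolding homogeneous_def using keys_sum[of f S] by blast

text \<open>Once the part of degree \<open>e - a\<close> is taken out of \<open>p\<close>, the
  product of \<open>q\<close> with the rest has no term of degree \<open>e\<close>.\<close>

lemma homogeneous_part_mult:
  assumes "homogeneous a q" shows "homogeneous_part e (q * p) = q * homogeneous_part (e - a) p"
proof -
  let ?h = "homogeneous_part (e - a) p" and ?r = "p - homogeneous_part (e - a) p"
  have "homogeneous_part e (q * p) = homogeneous_part e (q * ?h) + homogeneous_part e (q * ?r)"
    by (simp add: homogeneous_part_add[symmetric] distrib_left[symmetric])
  also have "homogeneous_part e (q * ?h) = q * ?h"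
    using homogeneous_mult[OF assms homogeneous_homogeneous_part, of "e - a" p] by (simp add: homogeneous_part_homogeneous)
  also have "homogeneous_part e (q * ?r) = 0"
  proof (rule homogeneous_part_eq_0)
    fix m assume "m \<in> Poly_Mapping.keys (q * ?r)"
    then obtain x y where xy: "m = x + y" "x \<in> Poly_Mapping.keys q" "y \<in> Poly_Mapping.keys ?r"
      using keys_mult by blast
    then have "mdeg y \<noteq> e - a" by (auto simp: in_keys_iff lookup_minus lookup_homogeneous_part when_def split: if_splits)
    then show "mdeg m \<noteq> e" using xy assms by (auto simp: mdeg_add homogeneous_def simp del: of_nat_sum)
  qed
  finally show ?thesis by simp
qed

text \<open>Exponents are natural numbers, so a product of monomials is 1 only if both factors are.
  Taking constant terms thus plays the role of reduction modulo the ideal of the variables.\<close>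

lemma lookup_mult_0:
  fixes p q :: "('v, 'k::field) mpoly"
  shows "Poly_Mapping.lookup (p * q) 0 = Poly_Mapping.lookup p 0 * Poly_Mapping.lookup q 0"
proof -
  let ?c = "\<lambda>p::('v, 'k) mpoly. Poly_Mapping.single 0 (Poly_Mapping.lookup p 0) :: ('v, 'k) mpoly"
  have 0: "Poly_Mapping.lookup (a * b) 0 = 0"
    if "0 \<notin> Poly_Mapping.keys a \<or> 0 \<notin> Poly_Mapping.keys b" for a b :: "('v, 'k) mpoly"
  proof (rule ccontr)
    assume "Poly_Mapping.lookup (a * b) 0 \<noteq> 0"
    then have "0 \<in> Poly_Mapping.keys (a * b)" by (simp add: in_keys_iff)
    then obtain x y where xy: "x + y = 0" "x \<in> Poly_Mapping.keys a" "y \<in> Poly_Mapping.keys b"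
      using keys_mult[of a b] by force
    from xy(1) have "Poly_Mapping.lookup (x + y) v = 0" for v by simp
    then have "x = 0" "y = 0" by (auto intro!: poly_mapping_eqI simp: lookup_add)
    with xy that show False by blast
  qed
  have "p * q = ?c p * ?c q + (p - ?c p) * q + ?c p * (q - ?c q)" by (simp add: algebra_simps)
  also have "Poly_Mapping.lookup \<dots> 0 = Poly_Mapping.lookup (?c p * ?c q) 0"
    by (subst lookup_add)+ (simp add: 0 in_keys_iff lookup_minus)
  finally show ?thesis by (simp add: mult_single)
qed

lemma module_mult: "Modules.module ((*) :: 'a::comm_ring_1 \<Rightarrow> 'a \<Rightarrow> 'a)"
  by unfold_locales (auto simp: algebra_simps)

lemma lookup_0_maximal_ideal:
  assumes "p \<in> ideal_generated (range pvar)" shows "Poly_Mapping.lookup p 0 = 0"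
  using assms unfolding ideal_generated_def
proof (induction rule: Modules.module.span_induct_alt[OF module_mult, consumes 1])
  case (2 c x y)
  then have "Poly_Mapping.lookup x 0 = 0"
  proof -
    have "Poly_Mapping.single v (1 :: nat) \<noteq> 0" for v :: 'a
      by (metis lookup_single_eq lookup_zero one_neq_zero)
    then show ?thesis using 2 by (auto simp: pvar_def lookup_single when_def)
  qed
  then show ?case using 2 by (simp add: lookup_add lookup_mult_0)
qed simp

section \<open>Comparison of graded free resolutions\<close>

lemma mat_lift:
  assumes "A \<in> carrier_mat n k" "\<phi> \<in> carrier_mat n m" "\<And>c. c < k \<Longrightarrow> col A c \<in> mat_image \<phi>"
  obtains X where "X \<in> carrier_mat m k" "\<phi> * X = A"
proof -
  have "\<forall>c. \<exists>x. c < k \<longrightarrow> x \<in> carrier_vec m \<and> \<phi> *\<^sub>v x = col A c"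
    using assms(2,3) by (fastforce simp: mat_image_def)
  then obtain x where x: "\<And>c. c < k \<Longrightarrow> x c \<in> carrier_vec m" "\<And>c. c < k \<Longrightarrow> \<phi> *\<^sub>v x c = col A c"
    by metis
  define X where "X = mat_of_cols m (map x [0..<k])"
  have X: "X \<in> carrier_mat m k"
    unfolding X_def using mat_of_cols_carrier(1)[of m "map x [0..<k]"] by simp
  have col: "col X c = x c" if "c < k" for c
    unfolding X_def using that x by (subst col_mat_of_cols) auto
  have "\<phi> * X = A"
  proof (rule eq_matI)
    fix r c assume rc: "r < dim_row A" "c < dim_col A"
    then have "(\<phi> * X) $$ (r, c) = (\<phi> *\<^sub>v x c) $ r" using assms X col by simp
    then show "(\<phi> * X) $$ (r, c) = A $$ (r, c)" using rc x assms by simp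
  qed (use assms X in auto)
  with X show ?thesis using that by blast
qed

definition homogeneous_mat :: "int list \<Rightarrow> int list \<Rightarrow> ('v::finite, 'k::field) mpoly mat \<Rightarrow> bool" where
  "homogeneous_mat a b A \<longleftrightarrow> A \<in> carrier_mat (length a) (length b) \<and>
     (\<forall>r<length a. \<forall>c<length b. homogeneous (b ! c - a ! r) (A $$ (r, c)))"

text \<open>Any lift can be replaced, entry by entry, by its homogeneous parts of the right degrees,
  because multiplication by the homogeneous \<open>\<phi>\<close> carries parts to parts.\<close>

lemma mat_lift_homogeneous:
  assumes A: "homogeneous_mat a c A" and \<phi>: "homogeneous_mat a b \<phi>"
    and im: "\<And>j. j < length c \<Longrightarrow> col A j \<in> mat_image \<phi>"
  obtains X where "homogeneous_mat b c X" "\<phi> * X = A"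
proof -
  obtain X where X: "X \<in> carrier_mat (length b) (length c)" "\<phi> * X = A"
    using mat_lift[of A "length a" "length c" \<phi> "length b"] A \<phi> im by (auto simp: homogeneous_mat_def)
  define Y where "Y = mat (length b) (length c) (\<lambda>(r, j). homogeneous_part (c ! j - b ! r) (X $$ (r, j)))"
  have Y: "homogeneous_mat b c Y" by (auto simp: Y_def homogeneous_mat_def homogeneous_homogeneous_part)
  have "\<phi> * Y = A"
  proof (rule eq_matI)
    fix r j assume "r < dim_row A" "j < dim_col A"
    then have rj: "r < length a" "j < length c" using A by (auto simp: homogeneous_mat_def)
    have "(\<phi> * Y) $$ (r, j) = (\<Sum>k = 0..<length b. \<phi> $$ (r, k) * homogeneous_part (c ! j - b ! k) (X $$ (k, j)))"
      using rj X \<phi> by (auto simp: Y_def scalar_prod_def homogeneous_mat_def intro!: sum.cong)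
    also have "\<dots> = (\<Sum>k = 0..<length b. homogeneous_part (c ! j - a ! r) (\<phi> $$ (r, k) * X $$ (k, j)))"
    proof (rule sum.cong)
      fix k assume "k \<in> {0..<length b}"
      then have "homogeneous (b ! k - a ! r) (\<phi> $$ (r, k))" using rj \<phi> by (auto simp: homogeneous_mat_def)
      from homogeneous_part_mult[OF this, of "c ! j - a ! r" "X $$ (k, j)"]
      show "\<phi> $$ (r, k) * homogeneous_part (c ! j - b ! k) (X $$ (k, j)) = homogeneous_part (c ! j - a ! r) (\<phi> $$ (r, k) * X $$ (k, j))"
        by simp
    qed simp
    also have "\<dots> = homogeneous_part (c ! j - a ! r) ((\<phi> * X) $$ (r, j))"
      using rj X(1) \<phi> by (auto simp: homogeneous_part_sum scalar_prod_def homogeneous_mat_def intro!: sum.cong)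
    also have "\<dots> = A $$ (r, j)"
      using A rj X(2) by (simp add: homogeneous_mat_def homogeneous_part_homogeneous)
    finally show "(\<phi> * Y) $$ (r, j) = A $$ (r, j)" .
  qed (use A \<phi> in \<open>auto simp: Y_def homogeneous_mat_def\<close>)
  with Y show ?thesis using that by blast
qed

lemma homogeneous_mat_mult:
  assumes "homogeneous_mat a b A" "homogeneous_mat b c C" shows "homogeneous_mat a c (A * C)"
  unfolding homogeneous_mat_def
proof (intro conjI allI impI)
  show "A * C \<in> carrier_mat (length a) (length c)" using assms by (auto simp: homogeneous_mat_def)
  fix r j assume rj: "r < length a" "j < length c"
  have "(A * C) $$ (r, j) = (\<Sum>k = 0..<length b. A $$ (r, k) * C $$ (k, j))"
    using rj assms by (auto simp: scalar_prod_def homogeneous_mat_def intro!: sum.cong)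
  moreover have "homogeneous (c ! j - a ! r) (A $$ (r, k) * C $$ (k, j))" if "k < length b" for k
    using homogeneous_mult[of "b ! k - a ! r" "A $$ (r, k)" "c ! j - b ! k" "C $$ (k, j)"] rj that assms
    by (auto simp: homogeneous_mat_def)
  ultimately show "homogeneous (c ! j - a ! r) ((A * C) $$ (r, j))"
    by (auto intro!: homogeneous_sum)
qed

lemma col_in_mat_image: "A \<in> carrier_mat n k \<Longrightarrow> j < k \<Longrightarrow> col A j \<in> mat_image A"
  unfolding mat_image_def
  by (intro image_eqI[of _ _ "unit_vec k j"]) (auto intro!: eq_vecI simp: scalar_prod_right_unit)

context
  fixes I :: "('v::finite, 'k::field) mpoly set" and d :: "nat \<Rightarrow> int list" and \<phi>
  assumes res: "graded_free_resolution I d \<phi>"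
begin

lemma resolution_homogeneous: "homogeneous_mat (d i) (d (Suc i)) (\<phi> i)"
  using res by (simp add: graded_free_resolution_def homogeneous_mat_def)

lemma resolution_carrier: "\<phi> i \<in> carrier_mat (length (d i)) (length (d (Suc i)))"
  using resolution_homogeneous by (simp add: homogeneous_mat_def)

lemma resolution_degree_0: "d 0 = [0]"
  using res by (simp add: graded_free_resolution_def)

lemma resolution_exact: "mat_image (\<phi> (Suc i)) = mat_kernel (\<phi> i)"
  using res by (simp add: graded_free_resolution_def)

lemma resolution_image: "(\<lambda>v. v $ 0) ` mat_image (\<phi> 0) = I"
  using res by (simp add: graded_free_resolution_def)

lemma resolution_col:
  assumes A: "A \<in> carrier_mat (length (d (Suc i))) k" and "\<phi> i * A = 0\<^sub>m (length (d i)) k" "j < k"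
  shows "col A j \<in> mat_image (\<phi> (Suc i))"
proof -
  have "\<phi> i *\<^sub>v col A j = col (\<phi> i * A) j"
    using A assms(3) by (metis col_mult2 resolution_carrier)
  then show ?thesis
    unfolding resolution_exact mat_kernel_def using assms resolution_carrier[of i] by auto
qed

lemma resolution_complex: "\<phi> i * \<phi> (Suc i) = 0\<^sub>m (length (d i)) (length (d (Suc (Suc i))))"
proof (rule eq_matI)
  fix r c assume "r < dim_row (0\<^sub>m (length (d i)) (length (d (Suc (Suc i)))) :: ('v, 'k) mpoly mat)"
    "c < dim_col (0\<^sub>m (length (d i)) (length (d (Suc (Suc i)))) :: ('v, 'k) mpoly mat)"
  then have rc: "r < length (d i)" "c < length (d (Suc (Suc i)))" by auto
  have "col (\<phi> (Suc i)) c \<in> mat_kernel (\<phi> i)"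
    using col_in_mat_image[OF resolution_carrier rc(2)] by (simp add: resolution_exact)
  then have "\<phi> i *\<^sub>v col (\<phi> (Suc i)) c = 0\<^sub>v (dim_row (\<phi> i))" by (simp add: mat_kernel_def)
  then have "(\<phi> i *\<^sub>v col (\<phi> (Suc i)) c) $ r = 0" using rc resolution_carrier[of i] by auto
  then show "(\<phi> i * \<phi> (Suc i)) $$ (r, c) = 0\<^sub>m (length (d i)) (length (d (Suc (Suc i)))) $$ (r, c)"
    using rc resolution_carrier[of i] resolution_carrier[of "Suc i"] by auto
qed (use resolution_carrier[of i] resolution_carrier[of "Suc i"] in auto)

end

lemma resolution_chain_map:
  fixes I :: "('v::finite, 'k::field) mpoly set"
  assumes R: "graded_free_resolution I d \<phi>" and R': "graded_free_resolution I d' \<phi>'"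
  obtains f where "\<And>i. homogeneous_mat (d' i) (d i) (f i)" "\<And>i. \<phi>' i * f (Suc i) = f i * \<phi> i"
    "f 0 = 1\<^sub>m 1"
proof -
  \<comment> \<open>The invariant says that the next lift exists: the columns of
    \<open>f * \<phi> i\<close> lie in the image of \<open>\<phi>' i\<close>. In degree 0 this holds
    because both resolutions have the same ideal as image and vectors of length one are determined
    by their entry.\<close>
  define P where "P = (\<lambda>i f. homogeneous_mat (d' i) (d i) f \<and>
    (\<forall>c<length (d (Suc i)). col (f * \<phi> i) c \<in> mat_image (\<phi>' i)) \<and> (i = 0 \<longrightarrow> f = 1\<^sub>m 1))"
  have "\<exists>f. P 0 f"
  proof
    note c = resolution_carrier[OF R, of 0, unfolded resolution_degree_0[OF R], simplified]
    note c' = resolution_carrier[OF R', of 0, unfolded resolution_degree_0[OF R'], simplified]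
    have "col (1\<^sub>m 1 * \<phi> 0) j \<in> mat_image (\<phi>' 0)" if j: "j < length (d (Suc 0))" for j
    proof -
      have "col (\<phi> 0) j $ 0 \<in> (\<lambda>v. v $ 0) ` mat_image (\<phi>' 0)"
        using col_in_mat_image[OF c j] resolution_image[OF R] resolution_image[OF R'] by blast
      then obtain w where w: "w \<in> mat_image (\<phi>' 0)" "w $ 0 = col (\<phi> 0) j $ 0" by auto
      then have "w = col (\<phi> 0) j" using c c' by (intro eq_vecI) (auto simp: mat_image_def)
      then show ?thesis using w c by simp
    qed
    then show "P 0 (1\<^sub>m 1)"
      by (auto simp: P_def homogeneous_mat_def resolution_degree_0[OF R] resolution_degree_0[OF R'] homogeneous_def)
  qed
  moreover have "\<exists>f'. P (Suc i) f' \<and> \<phi>' i * f' = f * \<phi> i" if f: "P i f" for i f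
  proof -
    have hf: "homogeneous_mat (d' i) (d i) f" using f by (simp add: P_def)
    note homs = resolution_homogeneous[OF R, of i] resolution_homogeneous[OF R', of i]
      resolution_homogeneous[OF R, of "Suc i"]
    obtain f' where f': "homogeneous_mat (d' (Suc i)) (d (Suc i)) f'" "\<phi>' i * f' = f * \<phi> i"
      using mat_lift_homogeneous[OF homogeneous_mat_mult[OF hf homs(1)] homs(2)] f by (auto simp: P_def)
    note carr = homs f' hf
    have "\<phi>' i * (f' * \<phi> (Suc i)) = (\<phi>' i * f') * \<phi> (Suc i)"
      using carr by (intro assoc_mult_mat[symmetric]) (auto simp: homogeneous_mat_def)
    also have "\<dots> = f * (\<phi> i * \<phi> (Suc i))"
      unfolding f'(2) using carr by (intro assoc_mult_mat) (auto simp: homogeneous_mat_def)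
    also have "\<dots> = 0\<^sub>m (length (d' i)) (length (d (Suc (Suc i))))"
      using hf by (auto simp: resolution_complex[OF R] homogeneous_mat_def)
    finally have 0: "\<phi>' i * (f' * \<phi> (Suc i)) = 0\<^sub>m (length (d' i)) (length (d (Suc (Suc i))))" .
    have "f' * \<phi> (Suc i) \<in> carrier_mat (length (d' (Suc i))) (length (d (Suc (Suc i))))"
      using f'(1) homs(3) by (auto simp: homogeneous_mat_def)
    from resolution_col[OF R' this 0] have "P (Suc i) f'"
      using f'(1) unfolding P_def by blast
    then show ?thesis using f' by blast
  qed
  ultimately obtain f where "\<forall>i. P i (f i) \<and> \<phi>' i * f (Suc i) = f i * \<phi> i"
    using dependent_nat_choice[of P "\<lambda>i f f'. \<phi>' i * f' = f * \<phi> i"] by blast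
  then show ?thesis using that by (auto simp: P_def)
qed

text \<open>The columns of \<open>u - 1 - s \<phi>\<close> in the next degree are cycles, hence
  boundaries, and a preimage is the next \<open>s\<close>. So an endomorphism of a resolution that
  lifts the identity of the quotient is homotopic to the identity.\<close>

lemma resolution_homotopy:
  fixes I :: "('v::finite, 'k::field) mpoly set"
  assumes R: "graded_free_resolution I d \<phi>"
    and u: "\<And>i. u i \<in> carrier_mat (length (d i)) (length (d i))" "\<And>i. \<phi> i * u (Suc i) = u i * \<phi> i" "u 0 = 1\<^sub>m 1"
  obtains s where "\<And>i. s i \<in> carrier_mat (length (d (Suc i))) (length (d i))"
    "\<And>i. u (Suc i) = 1\<^sub>m (length (d (Suc i))) + (\<phi> (Suc i) * s (Suc i) + s i * \<phi> i)"
proof -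
  let ?n = "\<lambda>i. length (d i)"
  \<comment> \<open>\<open>P\<close> is the homotopy identity in degree \<open>i\<close> multiplied
    on the right by \<open>\<phi> i\<close>, which is what the next step consumes. In degree 0 it
    holds for \<open>s = 0\<close>, because \<open>u 0\<close> is the identity.\<close>
  define P where "P = (\<lambda>i s. s \<in> carrier_mat (?n (Suc i)) (?n i) \<and> \<phi> i * (s * \<phi> i) = (u i - 1\<^sub>m (?n i)) * \<phi> i)"
  note c = resolution_carrier[OF R]
  have "P 0 (0\<^sub>m (?n (Suc 0)) (?n 0))"
  proof -
    have "(u 0 - 1\<^sub>m (?n 0)) = (0\<^sub>m (?n 0) (?n 0) :: ('v, 'k) mpoly mat)"
      using u(3) resolution_degree_0[OF R] by (auto intro!: eq_matI)
    then show ?thesis using c[of 0] by (simp add: P_def)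
  qed
  moreover have "\<exists>s'. P (Suc i) s' \<and> u (Suc i) = 1\<^sub>m (?n (Suc i)) + (\<phi> (Suc i) * s' + s * \<phi> i)"
    if s: "P i s" for i s
  proof -
    define A where "A = u (Suc i) - 1\<^sub>m (?n (Suc i)) - s * \<phi> i"
    have sc: "s \<in> carrier_mat (?n (Suc i)) (?n i)" and s1: "\<phi> i * (s * \<phi> i) = (u i - 1\<^sub>m (?n i)) * \<phi> i"
      using s by (auto simp: P_def)
    have sp: "s * \<phi> i \<in> carrier_mat (?n (Suc i)) (?n (Suc i))" using sc c[of i] by auto
    have A: "A \<in> carrier_mat (?n (Suc i)) (?n (Suc i))" unfolding A_def using sp by (rule minus_carrier_mat)
    have "\<phi> i * A = \<phi> i * (u (Suc i) - 1\<^sub>m (?n (Suc i))) - \<phi> i * (s * \<phi> i)"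
      unfolding A_def using u(1)[of "Suc i"] sp by (intro mult_minus_distrib_mat[OF c]) auto
    also have "\<phi> i * (u (Suc i) - 1\<^sub>m (?n (Suc i))) = \<phi> i * u (Suc i) - \<phi> i * 1\<^sub>m (?n (Suc i))"
      using u(1)[of "Suc i"] by (intro mult_minus_distrib_mat[OF c]) auto
    also have "\<dots> = (u i - 1\<^sub>m (?n i)) * \<phi> i"
      using minus_mult_distrib_mat[OF u(1)[of i] one_carrier_mat c[of i]] u(2)[of i] c[of i] by simp
    finally have "\<phi> i * A = 0\<^sub>m (?n i) (?n (Suc i))"
      using s1 c[of i] u(1)[of i] by auto
    then obtain s' where s': "s' \<in> carrier_mat (?n (Suc (Suc i))) (?n (Suc i))" "\<phi> (Suc i) * s' = A"
      using mat_lift[OF A c[of "Suc i"]] resolution_col[OF R A] by metis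
    have "\<phi> (Suc i) * (s' * \<phi> (Suc i)) = A * \<phi> (Suc i)"
      using s' c[of "Suc i"] by (metis assoc_mult_mat)
    also have "\<dots> = (u (Suc i) - 1\<^sub>m (?n (Suc i))) * \<phi> (Suc i) - (s * \<phi> i) * \<phi> (Suc i)"
      unfolding A_def using u(1)[of "Suc i"] sp by (intro minus_mult_distrib_mat[OF _ _ c]) auto
    also have "(s * \<phi> i) * \<phi> (Suc i) = 0\<^sub>m (?n (Suc i)) (?n (Suc (Suc i)))"
      using sc c[of i] c[of "Suc i"] by (simp add: assoc_mult_mat[OF sc c c] resolution_complex[OF R])
    finally have "P (Suc i) s'"
      using s' c[of "Suc i"] u(1)[of "Suc i"] unfolding P_def
      by (auto intro!: eq_matI)
    moreover have "u (Suc i) = 1\<^sub>m (?n (Suc i)) + (\<phi> (Suc i) * s' + s * \<phi> i)"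
      unfolding s'(2) A_def using u(1)[of "Suc i"] sc c[of i] by (auto intro!: eq_matI)
    ultimately show ?thesis by blast
  qed
  ultimately obtain s where "\<forall>i. P i (s i) \<and> u (Suc i) = 1\<^sub>m (?n (Suc i)) + (\<phi> (Suc i) * s (Suc i) + s i * \<phi> i)"
    using dependent_nat_choice[of P "\<lambda>i s s'. u (Suc i) = 1\<^sub>m (?n (Suc i)) + (\<phi> (Suc i) * s' + s * \<phi> i)"] by blast
  then show ?thesis using that by (auto simp: P_def)
qed

lemma lookup_mult_mat_0:
  fixes A C :: "('v::finite, 'k::field) mpoly mat"
  assumes "A \<in> carrier_mat n m" "C \<in> carrier_mat m k" "r < n" "j < k"
  shows "Poly_Mapping.lookup ((A * C) $$ (r, j)) 0 =
    (\<Sum>i<m. Poly_Mapping.lookup (A $$ (r, i)) 0 * Poly_Mapping.lookup (C $$ (i, j)) 0)"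
proof -
  have "(A * C) $$ (r, j) = (\<Sum>i<m. A $$ (r, i) * C $$ (i, j))"
    using assms by (auto simp: scalar_prod_def atLeast0LessThan intro!: sum.cong)
  then show ?thesis by (simp add: lookup_sum lookup_mult_0)
qed

text \<open>Going to the other resolution and back is homotopic to the identity, and the entries of
  the minimal differential have no constant term. So the composite is the identity on constant
  terms, and the constant terms of \<open>f i\<close> in degree \<open>j\<close> form a matrix with
  a left inverse.\<close>

theorem minimal_resolution_count_le:
  fixes I :: "('v::finite, 'k::field) mpoly set"
  assumes M: "minimal_graded_free_resolution I d \<phi>" and R': "graded_free_resolution I d' \<phi>'"
  shows "count_list (d i) j \<le> count_list (d' i) j"
proof -
  have R: "graded_free_resolution I d \<phi>" using M by (simp add: minimal_graded_free_resolution_def)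
  have min: "Poly_Mapping.lookup (\<phi> i $$ (r, c)) 0 = 0" if "r < length (d i)" "c < length (d (Suc i))" for i r c
    using M that by (auto simp: minimal_graded_free_resolution_def intro: lookup_0_maximal_ideal)
  obtain f where f: "\<And>i. homogeneous_mat (d' i) (d i) (f i)" "\<And>i. \<phi>' i * f (Suc i) = f i * \<phi> i" "f 0 = 1\<^sub>m 1"
    using resolution_chain_map[OF R R'] by metis
  obtain g where g: "\<And>i. homogeneous_mat (d i) (d' i) (g i)" "\<And>i. \<phi> i * g (Suc i) = g i * \<phi>' i" "g 0 = 1\<^sub>m 1"
    using resolution_chain_map[OF R' R] by metis
  note c = resolution_carrier[OF R] and c' = resolution_carrier[OF R']
  have fc: "f i \<in> carrier_mat (length (d' i)) (length (d i))"
    and gc: "g i \<in> carrier_mat (length (d i)) (length (d' i))" for i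
    using f g by (auto simp: homogeneous_mat_def)
  define u where "u i = g i * f i" for i
  have uc: "u i \<in> carrier_mat (length (d i)) (length (d i))" for i
    using fc[of i] gc[of i] by (auto simp: u_def)
  have "\<phi> i * u (Suc i) = u i * \<phi> i" for i
  proof -
    have "\<phi> i * (g (Suc i) * f (Suc i)) = (\<phi> i * g (Suc i)) * f (Suc i)"
      by (rule assoc_mult_mat[OF c gc fc, symmetric])
    also have "\<dots> = g i * (\<phi>' i * f (Suc i))"
      unfolding g(2) by (rule assoc_mult_mat[OF gc c' fc])
    also have "\<dots> = (g i * f i) * \<phi> i"
      unfolding f(2) by (rule assoc_mult_mat[OF gc fc c, symmetric])
    finally show ?thesis by (simp only: u_def)
  qed
  moreover have "u 0 = 1\<^sub>m 1" by (simp add: u_def f(3) g(3))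
  ultimately obtain s where s: "\<And>i. s i \<in> carrier_mat (length (d (Suc i))) (length (d i))"
    "\<And>i. u (Suc i) = 1\<^sub>m (length (d (Suc i))) + (\<phi> (Suc i) * s (Suc i) + s i * \<phi> i)"
    using resolution_homotopy[OF R uc] by blast
  have u0: "Poly_Mapping.lookup (u i $$ (a, b)) 0 = (if a = b then 1 else 0)"
    if ab: "a < length (d i)" "b < length (d i)" for i a b
  proof (cases i)
    case 0
    then show ?thesis using ab \<open>u 0 = 1\<^sub>m 1\<close> resolution_degree_0[OF R] by simp
  next
    case (Suc n)
    have "u i $$ (a, b) = (if a = b then 1 else 0) + ((\<phi> (Suc n) * s (Suc n)) $$ (a, b) + (s n * \<phi> n) $$ (a, b))"
      unfolding Suc s(2)[of n] using ab Suc carrier_matD[OF s(1)[of n]] carrier_matD[OF s(1)[of "Suc n"]]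
        carrier_matD[OF c[of n]] carrier_matD[OF c[of "Suc n"]] by simp
    moreover have "Poly_Mapping.lookup ((\<phi> (Suc n) * s (Suc n)) $$ (a, b)) 0 = 0"
      using ab Suc min by (subst lookup_mult_mat_0[OF c s(1)]) (auto intro!: sum.neutral)
    moreover have "Poly_Mapping.lookup ((s n * \<phi> n) $$ (a, b)) 0 = 0"
      using ab Suc min by (subst lookup_mult_mat_0[OF s(1) c]) (auto intro!: sum.neutral)
    ultimately show ?thesis by (simp add: lookup_add)
  qed
  let ?A = "{k. k < length (d i) \<and> d i ! k = j}" and ?R = "{r. r < length (d' i) \<and> d' i ! r = j}"
  let ?G = "\<lambda>a r. Poly_Mapping.lookup (g i $$ (a, r)) 0" and ?F = "\<lambda>r b. Poly_Mapping.lookup (f i $$ (r, b)) 0"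
  have "card ?A \<le> card ?R"
  proof (rule card_le_of_left_inverse)
    fix b a assume ab: "b \<in> ?A" "a \<in> ?A"
    \<comment> \<open>A homogeneous entry with nonzero constant term has degree 0. Constant terms
      therefore connect only generators of equal degree, which restricts the sum to
      \<open>?R\<close>.\<close>
    have F0: "?F r b = 0" if "r < length (d' i)" "d' i ! r \<noteq> j" for r
    proof (rule ccontr)
      assume "?F r b \<noteq> 0"
      then have "0 \<in> Poly_Mapping.keys (f i $$ (r, b))" by (simp add: in_keys_iff)
      moreover have "homogeneous (d i ! b - d' i ! r) (f i $$ (r, b))"
        using f(1)[of i] ab that by (auto simp: homogeneous_mat_def)
      ultimately show False using that ab by (auto simp: homogeneous_def)
    qed
    have "(\<Sum>r\<in>?R. ?G a r * ?F r b) = (\<Sum>r<length (d' i). ?G a r * ?F r b)"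
      using F0 by (intro sum.mono_neutral_left) auto
    also have "\<dots> = Poly_Mapping.lookup (u i $$ (a, b)) 0"
      unfolding u_def using ab by (subst lookup_mult_mat_0[OF gc fc]) auto
    also have "\<dots> = (if a = b then 1 else 0)" using ab by (simp add: u0)
    finally show "(\<Sum>r\<in>?R. ?G a r * ?F r b) = (if a = b then 1 else 0)" .
  qed auto
  moreover have "count_list xs j = card {k. k < length xs \<and> xs ! k = j}" for xs :: "int list"
    by (simp add: count_list_eq_length_filter length_filter_conv_card eq_commute)
  ultimately show ?thesis by simp
qed

section \<open>Squarefree monomials and monomial ideals\<close>

definition ind_exp :: "'v::finite set \<Rightarrow> 'v \<Rightarrow>\<^sub>0 nat" where
  "ind_exp S = (\<Sum>v\<in>S. Poly_Mapping.single v 1)"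

lemma lookup_ind_exp: "Poly_Mapping.lookup (ind_exp S) v = (if v \<in> S then 1 else 0)"
  by (simp add: ind_exp_def lookup_sum lookup_single when_def)

lemma keys_ind_exp [simp]: "Poly_Mapping.keys (ind_exp S) = S"
  by (auto simp: in_keys_iff lookup_ind_exp split: if_splits)

lemma sum_lookup_ind_exp: "(\<Sum>v\<in>UNIV. Poly_Mapping.lookup (ind_exp S) v) = card S"
  by (simp add: lookup_ind_exp sum.If_cases)

lemma ind_exp_Diff: "S \<subseteq> T \<Longrightarrow> ind_exp (T - S) + ind_exp S = ind_exp T"
  by (rule poly_mapping_eqI) (auto simp: lookup_add lookup_ind_exp)

lemma keys_add_nat: "Poly_Mapping.keys (a + b) = Poly_Mapping.keys a \<union> Poly_Mapping.keys (b :: 'v \<Rightarrow>\<^sub>0 nat)"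
  by (auto simp: in_keys_iff lookup_add)

lemma add_diff_ind_exp:
  assumes "S \<subseteq> Poly_Mapping.keys a" shows "a - ind_exp S + ind_exp S = a"
  by (rule poly_mapping_eqI) (use assms in \<open>auto simp: lookup_add lookup_minus lookup_ind_exp in_keys_iff\<close>)

lemma prod_pvar: "(\<Prod>v\<in>C. pvar v) = (Poly_Mapping.single (ind_exp C) 1 :: ('v::finite, 'k::field) mpoly)"
proof (induction C rule: finite_induct[OF finite])
  case 1
  then show ?case by (simp add: ind_exp_def)
next
  case (2 v C)
  then show ?case by (simp add: pvar_def mult_single ind_exp_def)
qed

lemma poly_mapping_eq_sum_single:
  "p = (\<Sum>m\<in>Poly_Mapping.keys p. Poly_Mapping.single m (Poly_Mapping.lookup p m))"
proof (rule poly_mapping_eqI)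
  fix n
  show "Poly_Mapping.lookup p n =
      Poly_Mapping.lookup (\<Sum>m\<in>Poly_Mapping.keys p. Poly_Mapping.single m (Poly_Mapping.lookup p m)) n"
    by (simp add: lookup_sum lookup_single when_def in_keys_iff)
qed

lemma lookup_single_times:
  fixes p :: "('v::finite, 'k::field) mpoly"
  shows "Poly_Mapping.lookup (Poly_Mapping.single (ind_exp S) c * p) n =
    (if S \<subseteq> Poly_Mapping.keys n then c * Poly_Mapping.lookup p (n - ind_exp S) else 0)"
proof -
  have single: "Poly_Mapping.lookup (Poly_Mapping.single (ind_exp S) c * Poly_Mapping.single m a) n =
      (if S \<subseteq> Poly_Mapping.keys n then c * Poly_Mapping.lookup (Poly_Mapping.single m a) (n - ind_exp S) else 0)" for m a
  proof -
    have "ind_exp S + m = n \<longleftrightarrow> S \<subseteq> Poly_Mapping.keys n \<and> m = n - ind_exp S"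
    proof
      assume "ind_exp S + m = n"
      then show "S \<subseteq> Poly_Mapping.keys n \<and> m = n - ind_exp S" by (auto simp: keys_add_nat)
    next
      assume "S \<subseteq> Poly_Mapping.keys n \<and> m = n - ind_exp S"
      then show "ind_exp S + m = n" using add_diff_ind_exp[of S n] by (simp add: add.commute)
    qed
    then show ?thesis by (auto simp: mult_single lookup_single when_def)
  qed
  have "Poly_Mapping.single (ind_exp S) c * p =
      (\<Sum>m\<in>Poly_Mapping.keys p. Poly_Mapping.single (ind_exp S) c * Poly_Mapping.single m (Poly_Mapping.lookup p m))"
    by (subst poly_mapping_eq_sum_single[of p]) (simp add: sum_distrib_left)
  also have "Poly_Mapping.lookup \<dots> n = (if S \<subseteq> Poly_Mapping.keys n
      then c * Poly_Mapping.lookup (\<Sum>m\<in>Poly_Mapping.keys p. Poly_Mapping.single m (Poly_Mapping.lookup p m)) (n - ind_exp S) else 0)"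
    by (simp add: lookup_sum single sum_distrib_left)
  finally show ?thesis by (simp flip: poly_mapping_eq_sum_single)
qed

text \<open>Whether a monomial lies in a squarefree monomial ideal depends on its support alone, so
  a family of sets encodes the ideal.\<close>

definition mono_ideal :: "'v set set \<Rightarrow> ('v::finite, 'k::field) mpoly set" where
  "mono_ideal U = {p. \<forall>m\<in>Poly_Mapping.keys p. Poly_Mapping.keys m \<in> U}"

lemma ideal_generated_monomials:
  "ideal_generated ((\<lambda>C. \<Prod>v\<in>C. pvar v) ` F) =
     (mono_ideal {W. \<exists>C\<in>F. C \<subseteq> W} :: ('v::finite, 'k::field) mpoly set)"
proof (intro equalityI subsetI)
  fix p :: "('v, 'k) mpoly"
  assume "p \<in> ideal_generated ((\<lambda>C. \<Prod>v\<in>C. pvar v) ` F)"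
  then show "p \<in> mono_ideal {W. \<exists>C\<in>F. C \<subseteq> W}"
    unfolding ideal_generated_def
  proof (induction rule: Modules.module.span_induct_alt[OF module_mult, consumes 1])
    case 1
    then show ?case by (simp add: mono_ideal_def)
  next
    case (2 c x y)
    obtain C where C: "C \<in> F" "x = Poly_Mapping.single (ind_exp C) 1" using 2(1) by (auto simp: prod_pvar)
    have "\<exists>C\<in>F. C \<subseteq> Poly_Mapping.keys m" if m: "m \<in> Poly_Mapping.keys (c * x + y)" for m
    proof (cases "m \<in> Poly_Mapping.keys y")
      case True
      then show ?thesis using 2(2) by (simp add: mono_ideal_def)
    next
      case False
      then have "Poly_Mapping.lookup (x * c) m \<noteq> 0"
        using m by (simp add: in_keys_iff lookup_add mult.commute)
      then have "C \<subseteq> Poly_Mapping.keys m" by (simp add: C(2) lookup_single_times split: if_splits)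
      then show ?thesis using C(1) by blast
    qed
    then show ?case by (simp add: mono_ideal_def)
  qed
next
  fix p :: "('v, 'k) mpoly"
  let ?G = "(\<lambda>C. \<Prod>v\<in>C. pvar v) ` F :: ('v, 'k) mpoly set"
  assume p: "p \<in> mono_ideal {W. \<exists>C\<in>F. C \<subseteq> W}"
  have "Poly_Mapping.single m (Poly_Mapping.lookup p m) \<in> Modules.module.span (*) ?G"
    if m: "m \<in> Poly_Mapping.keys p" for m
  proof -
    obtain C where C: "C \<in> F" "C \<subseteq> Poly_Mapping.keys m" using p m by (auto simp: mono_ideal_def)
    have "Poly_Mapping.single m (Poly_Mapping.lookup p m) =
        Poly_Mapping.single (m - ind_exp C) (Poly_Mapping.lookup p m) * (\<Prod>v\<in>C. pvar v)"
      using add_diff_ind_exp[OF C(2)] by (simp add: prod_pvar mult_single)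
    then show ?thesis
      using C(1) Modules.module.span_scale[OF module_mult Modules.module.span_base[OF module_mult]]
      by (metis (no_types, lifting) imageI)
  qed
  then have "(\<Sum>m\<in>Poly_Mapping.keys p. Poly_Mapping.single m (Poly_Mapping.lookup p m)) \<in> Modules.module.span (*) ?G"
    by (intro Modules.module.span_sum[OF module_mult])
  also have "(\<Sum>m\<in>Poly_Mapping.keys p. Poly_Mapping.single m (Poly_Mapping.lookup p m)) = p"
    by (rule poly_mapping_eq_sum_single[symmetric])
  finally show "p \<in> ideal_generated ?G" by (simp add: ideal_generated_def)
qed

section \<open>The graded free resolution of a squarefree resolution\<close>

context
  fixes B :: "nat set" and g :: "nat \<Rightarrow> nat" and l :: "nat \<Rightarrow> 'v::finite set"
    and D :: "nat \<Rightarrow> nat \<Rightarrow> 'k::field" and e :: nat and U :: "'v set set"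
  assumes res: "sqfree_res B g l D e U"
begin

definition generators :: "nat \<Rightarrow> nat set" where
  "generators i = {x \<in> B. g x = i}"

definition generator_list :: "nat \<Rightarrow> nat list" where
  "generator_list i = sorted_list_of_set (generators i)"

definition generator_degrees :: "nat \<Rightarrow> int list" where
  "generator_degrees i = map (\<lambda>x. int (card (l x))) (generator_list i)"

text \<open>Polynomial matrices act on column vectors, while \<open>D\<close> acts on row vectors,
  so \<open>y\<close> and \<open>x\<close> change places. The monomial makes the entry
  multihomogeneous.\<close>

definition differential_entry :: "nat \<Rightarrow> nat \<Rightarrow> ('v, 'k) mpoly" where
  "differential_entry y x = Poly_Mapping.single (ind_exp (l x - l y)) (D x y)"

definition differential :: "nat \<Rightarrow> ('v, 'k) mpoly mat" where
  "differential i = mat (length (generator_list i)) (length (generator_list (Suc i))) (\<lambda>(r, c). differential_entry (generator_list i ! r) (generator_list (Suc i) ! c))"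

lemma finite_generators: "finite (generators i)"
  using lresD(1)[OF res] by (simp add: generators_def)

lemma set_generator_list: "set (generator_list i) = generators i" and distinct_generator_list: "distinct (generator_list i)"
  using finite_generators by (simp_all add: generator_list_def)

lemma bij_generator_list: "bij_betw ((!) (generator_list i)) {0..<length (generator_list i)} (generators i)"
  using bij_betw_nth[OF distinct_generator_list refl set_generator_list[symmetric]] by (simp add: atLeast0LessThan)

definition of_vec :: "nat \<Rightarrow> ('v, 'k) mpoly vec \<Rightarrow> nat \<Rightarrow> ('v, 'k) mpoly" where
  "of_vec i v x = (if x \<in> generators i then v $ inv_into {0..<length (generator_list i)} ((!) (generator_list i)) x else 0)"

definition to_vec :: "nat \<Rightarrow> (nat \<Rightarrow> ('v, 'k) mpoly) \<Rightarrow> ('v, 'k) mpoly vec" where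
  "to_vec i f = vec (length (generator_list i)) (\<lambda>r. f (generator_list i ! r))"

lemma to_vec_carrier [simp]: "to_vec i f \<in> carrier_vec (length (generator_list i))"
  by (simp add: to_vec_def)

lemma of_vec_nth: "r < length (generator_list i) \<Longrightarrow> of_vec i v (generator_list i ! r) = v $ r"
  using bij_generator_list[of i] unfolding of_vec_def
  by (subst inv_into_f_f) (auto simp: bij_betw_def)

lemma to_vec_of_vec: "v \<in> carrier_vec (length (generator_list i)) \<Longrightarrow> to_vec i (of_vec i v) = v"
  by (rule eq_vecI) (auto simp: to_vec_def of_vec_nth)

lemma to_vec_eqI:
  assumes "\<And>x. x \<in> generators i \<Longrightarrow> f x = f' x" shows "to_vec i f = to_vec i f'"
  using assms set_generator_list[of i] nth_mem by (fastforce simp: to_vec_def intro!: eq_vecI)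

lemma to_vec_eqD:
  assumes "to_vec i f = to_vec i f'" "x \<in> generators i" shows "f x = f' x"
proof -
  obtain r where r: "r < length (generator_list i)" "x = generator_list i ! r"
    using assms(2) set_generator_list[of i] by (metis in_set_conv_nth)
  have "to_vec i f $ r = to_vec i f' $ r" using assms(1) by simp
  then show ?thesis using r by (simp add: to_vec_def)
qed

definition apply_differential :: "(nat \<Rightarrow> ('v, 'k) mpoly) \<Rightarrow> nat \<Rightarrow> nat \<Rightarrow> ('v, 'k) mpoly" where
  "apply_differential f i y = (\<Sum>x\<in>generators (Suc i). differential_entry y x * f x)"

lemma differential_to_vec: "differential i *\<^sub>v to_vec (Suc i) f = to_vec i (apply_differential f i)"
proof (rule eq_vecI)
  fix r assume "r < dim_vec (to_vec i (apply_differential f i))"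
  then have r: "r < length (generator_list i)" by (simp add: to_vec_def)
  have "(differential i *\<^sub>v to_vec (Suc i) f) $ r =
      (\<Sum>c = 0..<length (generator_list (Suc i)). differential_entry (generator_list i ! r) (generator_list (Suc i) ! c) * f (generator_list (Suc i) ! c))"
    using r by (auto simp: differential_def to_vec_def scalar_prod_def intro!: sum.cong)
  also have "\<dots> = apply_differential f i (generator_list i ! r)"
    unfolding apply_differential_def by (rule sum.reindex_bij_betw[OF bij_generator_list])
  finally show "(differential i *\<^sub>v to_vec (Suc i) f) $ r = to_vec i (apply_differential f i) $ r"
    using r by (simp add: to_vec_def)
qed (simp add: to_vec_def differential_def)

text \<open>The strand of a polynomial vector \<open>f\<close> in multidegree \<open>a\<close>: the generator \<open>x\<close> has
  multidegree \<open>l x\<close>.\<close>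

definition strand :: "(nat \<Rightarrow> ('v, 'k) mpoly) \<Rightarrow> nat \<Rightarrow> ('v \<Rightarrow>\<^sub>0 nat) \<Rightarrow> nat \<Rightarrow> 'k" where
  "strand f i a x = (if x \<in> generators i \<and> l x \<subseteq> Poly_Mapping.keys a
     then Poly_Mapping.lookup (f x) (a - ind_exp (l x)) else 0)"

text \<open>The monomial in \<open>differential_entry\<close> shifts the exponent from
  \<open>a - ind_exp (l y)\<close> to \<open>a - ind_exp (l x)\<close>, so in every multidegree
  \<open>a\<close> the polynomial differential acts as the scalar matrix \<open>D\<close>.\<close>

lemma strand_apply_differential:
  "strand (apply_differential f i) i a y = (if y \<in> generators i then \<Sum>x\<in>B. strand f (Suc i) a x * D x y else 0)"
proof (cases "y \<in> generators i \<and> l y \<subseteq> Poly_Mapping.keys a")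
  case True
  have 1: "Poly_Mapping.lookup (differential_entry y x * f x) (a - ind_exp (l y)) = strand f (Suc i) a x * D x y"
    if x: "x \<in> generators (Suc i)" for x
  proof (cases "D x y = 0")
    case False
    then have sub: "l y \<subseteq> l x" using lresD(4)[OF res] by blast
    have keys: "Poly_Mapping.keys (a - ind_exp (l y)) \<supseteq> l x - l y \<longleftrightarrow> l x \<subseteq> Poly_Mapping.keys a"
      using True by (fastforce simp: in_keys_iff lookup_minus lookup_ind_exp)
    have "a - ind_exp (l y) - ind_exp (l x - l y) = a - ind_exp (l x)"
      using ind_exp_Diff[OF sub] by (simp add: diff_diff_add add.commute)
    then show ?thesis
      using keys x by (auto simp: differential_entry_def lookup_single_times strand_def)
  qed (simp add: differential_entry_def)
  have "strand (apply_differential f i) i a y = (\<Sum>x\<in>generators (Suc i). strand f (Suc i) a x * D x y)"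
    using True 1 by (simp add: strand_def[of "apply_differential f i"] apply_differential_def lookup_sum)
  also have "\<dots> = (\<Sum>x\<in>B. strand f (Suc i) a x * D x y)"
    using lresD(1)[OF res] by (intro sum.mono_neutral_left) (auto simp: generators_def strand_def)
  finally show ?thesis using True by simp
next
  case False
  have "strand f (Suc i) a x * D x y = 0" if "\<not> l y \<subseteq> Poly_Mapping.keys a" for x
    using lresD(4)[OF res, of x y] that by (auto simp: strand_def)
  then show ?thesis using False by (auto simp: strand_def)
qed

lemma strand_eqD:
  assumes "\<And>a. strand f i a = strand f' i a" "x \<in> generators i" shows "f x = f' x"
proof (rule poly_mapping_eqI)
  fix m
  have "strand f i (m + ind_exp (l x)) x = strand f' i (m + ind_exp (l x)) x" by (simp add: assms)
  then show "Poly_Mapping.lookup (f x) m = Poly_Mapping.lookup (f' x) m"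
    using assms(2) by (simp add: strand_def keys_add_nat)
qed

definition hom_at :: "'v set \<Rightarrow> nat \<Rightarrow> nat \<Rightarrow> 'k" where
  "hom_at = (SOME h. \<forall>W. contraction {x \<in> B. l x \<subseteq> W} g (row_strand l W D) e (if W \<in> U then 0 else munit e e) (h W))"

lemma hom_at: "contraction {x \<in> B. l x \<subseteq> W} g (row_strand l W D) e (if W \<in> U then 0 else munit e e) (hom_at W)"
proof -
  have "\<exists>h. \<forall>W. contraction {x \<in> B. l x \<subseteq> W} g (row_strand l W D) e (if W \<in> U then 0 else munit e e) (h W)"
    using lresE[OF res] by metis
  from someI_ex[OF this] show ?thesis unfolding hom_at_def by blast
qed

text \<open>The coefficient at \<open>n\<close> on the generator \<open>y\<close> belongs to the
  multidegree \<open>a = n + ind_exp (l y)\<close>. There the homotopy of the strand of the support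
  of \<open>a\<close> is applied to the strand of \<open>f\<close>.\<close>

definition lift_coeff :: "(nat \<Rightarrow> ('v, 'k) mpoly) \<Rightarrow> nat \<Rightarrow> nat \<Rightarrow> ('v \<Rightarrow>\<^sub>0 nat) \<Rightarrow> 'k" where
  "lift_coeff f i y n = (\<Sum>x\<in>B. strand f i (n + ind_exp (l y)) x * hom_at (Poly_Mapping.keys (n + ind_exp (l y))) x y)"

definition lift_cycle :: "(nat \<Rightarrow> ('v, 'k) mpoly) \<Rightarrow> nat \<Rightarrow> nat \<Rightarrow> ('v, 'k) mpoly" where
  "lift_cycle f i y = Abs_poly_mapping (lift_coeff f i y)"

text \<open>The strands of \<open>f\<close> vanish except in the finitely many multidegrees of terms
  of some \<open>f x\<close>, so \<open>lift_coeff\<close> has finite support and is the coefficient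
  function of a polynomial.\<close>

lemma lookup_lift: "Poly_Mapping.lookup (lift_cycle f i y) n = lift_coeff f i y n"
proof -
  have "{n. lift_coeff f i y n \<noteq> 0} \<subseteq>
      (\<Union>x\<in>generators i. (\<lambda>m. m + ind_exp (l x) - ind_exp (l y)) ` Poly_Mapping.keys (f x))"
  proof
    fix n assume "n \<in> {n. lift_coeff f i y n \<noteq> 0}"
    then have "(\<Sum>x\<in>B. strand f i (n + ind_exp (l y)) x * hom_at (Poly_Mapping.keys (n + ind_exp (l y))) x y) \<noteq> 0"
      by (simp add: lift_coeff_def)
    then obtain x where x: "strand f i (n + ind_exp (l y)) x \<noteq> 0"
      by (metis (no_types, lifting) mult_zero_left sum.neutral)
    then have lx: "x \<in> generators i" "l x \<subseteq> Poly_Mapping.keys (n + ind_exp (l y))"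
      and m: "n + ind_exp (l y) - ind_exp (l x) \<in> Poly_Mapping.keys (f x)"
      by (auto simp: strand_def in_keys_iff split: if_splits)
    have "n = n + ind_exp (l y) - ind_exp (l x) + ind_exp (l x) - ind_exp (l y)"
      using add_diff_ind_exp[OF lx(2)] by simp
    then show "n \<in> (\<Union>x\<in>generators i. (\<lambda>m. m + ind_exp (l x) - ind_exp (l y)) ` Poly_Mapping.keys (f x))"
      using lx(1) m by blast
  qed
  then have "finite {n. lift_coeff f i y n \<noteq> 0}"
    by (rule finite_subset) (simp add: finite_generators)
  then show ?thesis by (simp add: lift_cycle_def Abs_poly_mapping_inverse)
qed

lemma strand_lift:
  "strand (lift_cycle f i) (Suc i) a y = (\<Sum>x\<in>B. strand f i a x * hom_at (Poly_Mapping.keys a) x y)"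
proof (cases "y \<in> generators (Suc i) \<and> l y \<subseteq> Poly_Mapping.keys a")
  case True
  then show ?thesis
    by (simp add: strand_def[of "lift_cycle f i"] lookup_lift lift_coeff_def add_diff_ind_exp)
next
  case False
  note c = hom_at[of "Poly_Mapping.keys a"]
  have "strand f i a x * hom_at (Poly_Mapping.keys a) x y = 0" for x
  proof (rule ccontr)
    assume nz: "strand f i a x * hom_at (Poly_Mapping.keys a) x y \<noteq> 0"
    then have "x \<in> generators i" by (auto simp: strand_def split: if_splits)
    moreover have "y \<in> {x \<in> B. l x \<subseteq> Poly_Mapping.keys a} \<and> g y = Suc (g x)" using nz contraction_h[OF c, of x y] by auto
    ultimately show False using False by (auto simp: generators_def)
  qed
  moreover have "strand (lift_cycle f i) (Suc i) a y = 0" using False by (auto simp: strand_def)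
  ultimately show ?thesis by simp
qed

text \<open>Applied to a cycle, the homotopy identity leaves besides the cycle itself only a term
  with \<open>P\<close>. It vanishes if the strand has no coefficient at \<open>e\<close>, or if the
  multidegree belongs to the ideal, where \<open>P = 0\<close>.\<close>

lemma strand_differential_lift:
  assumes cycle: "\<And>y. (\<Sum>x\<in>B. strand f i a x * D x y) = 0"
    and aug: "strand f i a e = 0 \<or> Poly_Mapping.keys a \<in> U"
  shows "strand (apply_differential (lift_cycle f i) i) i a = strand f i a"
proof
  fix z
  let ?W = "Poly_Mapping.keys a" and ?c = "strand f i a"
  define P where "P = (if ?W \<in> U then 0 else munit e e :: nat \<Rightarrow> nat \<Rightarrow> 'k)"
  have c: "contraction {x \<in> B. l x \<subseteq> ?W} g (row_strand l ?W D) e P (hom_at ?W)"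
    unfolding P_def by (rule hom_at)
  let ?B = "{x \<in> B. l x \<subseteq> ?W}"
  have supp: "?c x = 0" if "x \<notin> ?B" for x using that by (auto simp: strand_def generators_def)
  have restr: "(\<Sum>x\<in>B. ?c x * X x) = (\<Sum>x\<in>?B. ?c x * X x)" for X
    using lresD(1)[OF res] supp by (intro sum.mono_neutral_right) auto
  \<comment> \<open>The strand is viewed as a matrix with a single row, so that the rules for
    \<open>mprod\<close> apply.\<close>
  let ?r = "\<lambda>_ :: unit. ?c"
  have suppr: "supported UNIV ?B ?r" using supp by (auto simp: supported_def)
  have rD: "mprod ?B ?r (row_strand l ?W D) u y = 0" for u y
  proof -
    have "mprod ?B ?r (row_strand l ?W D) u y = (\<Sum>x\<in>?B. ?c x * D x y)" by (auto simp: mprod_def row_strand_def intro!: sum.cong)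
    also have "\<dots> = 0" using cycle[of y] by (simp add: restr)
    finally show ?thesis .
  qed
  have lift_eq: "strand (lift_cycle f i) (Suc i) a y = mprod ?B ?r (hom_at ?W) () y" for y
    by (simp add: strand_lift mprod_def restr)
  have "(\<Sum>y\<in>B. strand (lift_cycle f i) (Suc i) a y * D y z) = (\<Sum>y\<in>?B. mprod ?B ?r (hom_at ?W) () y * row_strand l ?W D y z)"
    unfolding lift_eq
  proof (rule sum.mono_neutral_cong_right)
    show "\<forall>y\<in>B - ?B. mprod ?B ?r (hom_at ?W) () y * D y z = 0"
    proof
      fix y assume "y \<in> B - ?B"
      then have "hom_at ?W x y = 0" for x using contraction_h[OF c, of x y] by blast
      then show "mprod ?B ?r (hom_at ?W) () y * D y z = 0" by (simp add: mprod_def)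
    qed
  qed (use lresD(1)[OF res] in \<open>auto simp: row_strand_def\<close>)
  also have "\<dots> = mprod ?B ?r (mprod ?B (hom_at ?W) (row_strand l ?W D)) () z"
    by (simp add: mprod_def[of ?B "mprod ?B ?r (hom_at ?W)"] mprod_assoc[symmetric])
  also have "\<dots> = mprod ?B ?r (mid ?B) () z - mprod ?B ?r P () z - mprod ?B (mprod ?B ?r (row_strand l ?W D)) (hom_at ?W) () z"
    by (simp add: contraction_hD_eq[OF c] mprod_diff_right mprod_assoc)
  also have "mprod ?B ?r (mid ?B) = ?r" by (rule mprod_mid_right[OF contraction_fin[OF c] suppr])
  also have "mprod ?B ?r P () z = 0"
    using aug mprod_munit_right[OF contraction_fin[OF c] contraction_e[OF c], of ?r e] by (auto simp: P_def)
  finally have *: "(\<Sum>y\<in>B. strand (lift_cycle f i) (Suc i) a y * D y z) = ?c z"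
    using rD by (simp add: mprod_def[of ?B "\<lambda>a b. 0"])
  have "?c z = 0" if "z \<notin> generators i" using that by (simp add: strand_def)
  then show "strand (apply_differential (lift_cycle f i) i) i a z = strand f i a z"
    unfolding strand_apply_differential * by simp
qed

lemma differential_squared: "to_vec i (apply_differential (apply_differential f (Suc i)) i) = 0\<^sub>v (length (generator_list i))"
proof -
  have "apply_differential (apply_differential f (Suc i)) i x = (\<lambda>_. 0) x" if "x \<in> generators i" for x
  proof (rule strand_eqD[OF _ that], rule ext)
    fix a z
    have "(\<Sum>y\<in>B. strand (apply_differential f (Suc i)) (Suc i) a y * D y z) =
        (\<Sum>y\<in>B. (\<Sum>x\<in>B. strand f (Suc (Suc i)) a x * D x y) * D y z)" if "z \<in> generators i"
    proof (rule sum.cong)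
      fix y assume "y \<in> B"
      have "D y z = 0" if "y \<notin> generators (Suc i)"
        using lresD(4)[OF res, of y z] that \<open>z \<in> generators i\<close> by (auto simp: generators_def)
      then show "strand (apply_differential f (Suc i)) (Suc i) a y * D y z =
          (\<Sum>x\<in>B. strand f (Suc (Suc i)) a x * D x y) * D y z"
        by (auto simp: strand_apply_differential)
    qed simp
    also have "\<dots> = mprod B (mprod B (\<lambda>_ :: unit. strand f (Suc (Suc i)) a) D) D () z" by (simp add: mprod_def)
    also have "\<dots> = 0" by (simp add: mprod_assoc lresD(5)[OF res])
    finally show "strand (apply_differential (apply_differential f (Suc i)) i) i a z = strand (\<lambda>_. 0) i a z"
      by (auto simp: strand_apply_differential) (simp add: strand_def)
  qed
  then have "to_vec i (apply_differential (apply_differential f (Suc i)) i) = to_vec i (\<lambda>_. 0)" by (rule to_vec_eqI)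
  then show ?thesis by (auto simp: to_vec_def)
qed

lemma mat_image_differential: "mat_image (differential i) = range (\<lambda>f. to_vec i (apply_differential f i))"
proof (intro equalityI subsetI)
  have col: "dim_col (differential i) = length (generator_list (Suc i))" by (simp add: differential_def)
  fix v assume "v \<in> mat_image (differential i)"
  then obtain w where w: "w \<in> carrier_vec (length (generator_list (Suc i)))" "v = differential i *\<^sub>v w"
    by (auto simp: mat_image_def col)
  have "v = to_vec i (apply_differential (of_vec (Suc i) w) i)"
    unfolding differential_to_vec[symmetric] to_vec_of_vec[OF w(1)] by (rule w(2))
  then show "v \<in> range (\<lambda>f. to_vec i (apply_differential f i))" by blast
next
  have col: "dim_col (differential i) = length (generator_list (Suc i))" by (simp add: differential_def)
  fix v assume "v \<in> range (\<lambda>f. to_vec i (apply_differential f i))"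
  then obtain f where "v = differential i *\<^sub>v to_vec (Suc i) f" by (auto simp: differential_to_vec)
  then show "v \<in> mat_image (differential i)" unfolding mat_image_def col by (rule image_eqI) simp
qed

lemma generator_list_0: "generator_list 0 = [e]" and generators_0: "generators 0 = {e}"
proof -
  show "generators 0 = {e}" using lresD(2,3)[OF res] by (auto simp: generators_def)
  then show "generator_list 0 = [e]" by (simp add: generator_list_def)
qed

text \<open>In positive homological degree \<open>e\<close> is not among the generators, so the
  augmentation condition holds trivially and the homotopies lift every cycle.\<close>

lemma differential_exact: "mat_image (differential (Suc i)) = mat_kernel (differential i)"
proof (intro equalityI subsetI)
  fix v assume "v \<in> mat_image (differential (Suc i))"
  then obtain f where f: "v = to_vec (Suc i) (apply_differential f (Suc i))" by (auto simp: mat_image_differential)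
  then show "v \<in> mat_kernel (differential i)"
    by (simp add: mat_kernel_def differential_to_vec differential_squared) (simp add: differential_def)
next
  fix v assume "v \<in> mat_kernel (differential i)"
  then have v: "v \<in> carrier_vec (length (generator_list (Suc i)))" "differential i *\<^sub>v v = 0\<^sub>v (length (generator_list i))"
    by (auto simp: mat_kernel_def differential_def)
  define f where "f = of_vec (Suc i) v"
  have vf: "v = to_vec (Suc i) f" using to_vec_of_vec[OF v(1)] by (simp add: f_def)
  have "to_vec i (apply_differential f i) = to_vec i (\<lambda>_. 0)"
    using v(2) unfolding vf differential_to_vec by (auto simp: to_vec_def)
  then have zero: "apply_differential f i y = 0" if "y \<in> generators i" for y using to_vec_eqD that by blast
  have "strand (apply_differential (lift_cycle f (Suc i)) (Suc i)) (Suc i) a = strand f (Suc i) a" for a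
  proof (rule strand_differential_lift)
    fix y
    show "(\<Sum>x\<in>B. strand f (Suc i) a x * D x y) = 0"
    proof (cases "y \<in> generators i")
      case True
      then have "(\<Sum>x\<in>B. strand f (Suc i) a x * D x y) = strand (apply_differential f i) i a y"
        by (simp add: strand_apply_differential)
      also have "\<dots> = 0" using zero[OF True] by (simp add: strand_def)
      finally show ?thesis .
    next
      case False
      have "strand f (Suc i) a x * D x y = 0" for x
        using lresD(4)[OF res, of x y] False by (auto simp: strand_def generators_def)
      then show ?thesis by simp
    qed
    have "g e = 0" using lresD(3)[OF res lresD(2)[OF res]] by simp
    then have "e \<notin> generators (Suc i)" by (simp add: generators_def)
    then show "strand f (Suc i) a e = 0 \<or> Poly_Mapping.keys a \<in> U" by (simp add: strand_def)
  qed
  then have "apply_differential (lift_cycle f (Suc i)) (Suc i) x = f x" if "x \<in> generators (Suc i)" for x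
    using that by (rule strand_eqD)
  then have "to_vec (Suc i) (apply_differential (lift_cycle f (Suc i)) (Suc i)) = v"
    unfolding vf by (rule to_vec_eqI)
  then show "v \<in> mat_image (differential (Suc i))" unfolding mat_image_differential by blast
qed

text \<open>In a strand outside \<open>U\<close> no boundary contains \<open>e\<close>, so no
  monomial with such a support occurs in the image; in a strand inside \<open>U\<close> the homotopy
  lifts every multiple of \<open>e\<close>.\<close>

lemma differential_augmentation: "(\<lambda>v. v $ 0) ` mat_image (differential 0) = mono_ideal U"
proof -
  have le: "l e = {}" by (rule lresD(7)[OF res])
  have str: "strand f 0 a e = Poly_Mapping.lookup (f e) a" for f a
    by (simp add: strand_def generators_0 le ind_exp_def)
  have De: "D e y = 0" for y using lresD(4)[OF res, of e y] lresD(3)[OF res lresD(2)[OF res]] by auto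
  have "(\<lambda>v. v $ 0) ` mat_image (differential 0) = range (\<lambda>f. apply_differential f 0 e)"
    by (auto simp: mat_image_differential to_vec_def generator_list_0 image_image)
  also have "\<dots> = mono_ideal U"
  proof (intro equalityI subsetI)
    fix p assume "p \<in> range (\<lambda>f. apply_differential f 0 e)"
    then obtain f where p: "p = apply_differential f 0 e" by auto
    show "p \<in> mono_ideal U"
      unfolding mono_ideal_def
    proof (intro CollectI ballI, rule ccontr)
      fix a assume a: "a \<in> Poly_Mapping.keys p" "Poly_Mapping.keys a \<notin> U"
      have c: "contraction {x \<in> B. l x \<subseteq> Poly_Mapping.keys a} g (row_strand l (Poly_Mapping.keys a) D) e (munit e e) (hom_at (Poly_Mapping.keys a))"
        using hom_at[of "Poly_Mapping.keys a"] a(2) by simp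
      have D0: "D x e = 0" if "l x \<subseteq> Poly_Mapping.keys a" for x
      proof -
        have "mprod {x \<in> B. l x \<subseteq> Poly_Mapping.keys a} (row_strand l (Poly_Mapping.keys a) D) (munit e e) x e = D x e"
          unfolding mprod_munit_right[OF contraction_fin[OF c] contraction_e[OF c]] using that by (simp add: row_strand_def)
        then show ?thesis by (simp add: contraction_DP[OF c])
      qed
      have "Poly_Mapping.lookup p a = (\<Sum>x\<in>B. strand f (Suc 0) a x * D x e)"
        unfolding p str[symmetric] by (simp add: strand_apply_differential generators_0)
      also have "\<dots> = 0" using D0 by (intro sum.neutral) (auto simp: strand_def)
      finally show False using a(1) by (simp add: in_keys_iff)
    qed
  next
    fix p :: "('v, 'k) mpoly" assume p: "p \<in> mono_ideal U"
    \<comment> \<open>\<open>e\<close> is the only generator of degree 0, so the constant function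
      stands for the vector with the single entry \<open>p\<close>.\<close>
    let ?f = "\<lambda>_ :: nat. p"
    have "strand (apply_differential (lift_cycle ?f 0) 0) 0 a = strand ?f 0 a" for a
    proof (rule strand_differential_lift)
      fix y
      show "(\<Sum>x\<in>B. strand ?f 0 a x * D x y) = 0"
        by (intro sum.neutral) (auto simp: strand_def generators_0 De)
      show "strand ?f 0 a e = 0 \<or> Poly_Mapping.keys a \<in> U"
        using p by (auto simp: str mono_ideal_def in_keys_iff)
    qed
    then have "apply_differential (lift_cycle ?f 0) 0 e = p"
      using strand_eqD[of "apply_differential (lift_cycle ?f 0) 0" 0 ?f e] by (simp add: generators_0)
    then show "p \<in> range (\<lambda>f. apply_differential f 0 e)" by (intro range_eqI[where x = "lift_cycle ?f 0"]) simp
  qed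
  finally show ?thesis .
qed

lemma graded_free_resolution_sqfree_res:
  "graded_free_resolution (mono_ideal U :: ('v, 'k) mpoly set) generator_degrees differential"
  unfolding graded_free_resolution_def
proof (intro conjI allI impI)
  show "generator_degrees 0 = [0]" by (simp add: generator_degrees_def generator_list_0 lresD(7)[OF res])
  fix i
  show "differential i \<in> carrier_mat (length (generator_degrees i)) (length (generator_degrees (Suc i)))"
    by (simp add: differential_def generator_degrees_def)
  show "mat_image (differential (Suc i)) = mat_kernel (differential i)" by (rule differential_exact)
  fix r c assume rc: "r < length (generator_degrees i)" "c < length (generator_degrees (Suc i))"
  let ?x = "generator_list (Suc i) ! c" and ?y = "generator_list i ! r"
  have entry: "differential i $$ (r, c) = differential_entry ?y ?x" using rc by (simp add: differential_def generator_degrees_def)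
  show "homogeneous (generator_degrees (Suc i) ! c - generator_degrees i ! r) (differential i $$ (r, c))"
  proof (cases "D ?x ?y = 0")
    case False
    then have "l ?y \<subseteq> l ?x" using lresD(4)[OF res] by blast
    then have "int (card (l ?x - l ?y)) = int (card (l ?x)) - int (card (l ?y))"
      by (simp add: card_Diff_subset card_mono of_nat_diff)
    moreover have "(\<Sum>v\<in>UNIV. Poly_Mapping.lookup (ind_exp (l ?x - l ?y)) v) = card (l ?x - l ?y)"
      by (rule sum_lookup_ind_exp)
    ultimately show ?thesis
      using rc False unfolding entry by (simp add: homogeneous_def differential_entry_def generator_degrees_def)
  qed (simp add: entry differential_entry_def homogeneous_def)
qed (rule differential_augmentation)

lemma single_ind_exp_in_maximal_ideal:
  assumes "S \<noteq> {}"
  shows "Poly_Mapping.single (ind_exp S) c \<in> ideal_generated (range pvar :: ('v, 'k) mpoly set)"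
proof -
  obtain v where v: "v \<in> S" using assms by auto
  have "ind_exp S = ind_exp (S - {v}) + Poly_Mapping.single v 1"
    using ind_exp_Diff[of "{v}" S] v by (simp add: ind_exp_def)
  then have "Poly_Mapping.single (ind_exp S) c = Poly_Mapping.single (ind_exp (S - {v})) c * (pvar v :: ('v, 'k) mpoly)"
    by (simp add: pvar_def mult_single)
  then show ?thesis
    unfolding ideal_generated_def
    by (simp add: Modules.module.span_scale[OF module_mult] Modules.module.span_base[OF module_mult])
qed

lemma minimal_graded_free_resolution_sqfree_res:
  assumes "\<And>x y. D x y \<noteq> 0 \<Longrightarrow> l x \<noteq> l y"
  shows "minimal_graded_free_resolution (mono_ideal U :: ('v, 'k) mpoly set) generator_degrees differential"
  unfolding minimal_graded_free_resolution_def
proof (intro conjI allI impI)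
  fix i r c assume rc: "r < length (generator_degrees i)" "c < length (generator_degrees (Suc i))"
  let ?x = "generator_list (Suc i) ! c" and ?y = "generator_list i ! r"
  have entry: "differential i $$ (r, c) = differential_entry ?y ?x" using rc by (simp add: differential_def generator_degrees_def)
  show "differential i $$ (r, c) \<in> ideal_generated (range pvar)"
  proof (cases "D ?x ?y = 0")
    case True
    then show ?thesis
      unfolding entry ideal_generated_def by (simp add: differential_entry_def Modules.module.span_zero[OF module_mult])
  next
    case False
    then have "l ?x - l ?y \<noteq> {}" using assms lresD(4)[OF res] by blast
    then show ?thesis unfolding entry differential_entry_def by (rule single_ind_exp_in_maximal_ideal)
  qed
qed (rule graded_free_resolution_sqfree_res)

lemma count_generator_degrees: "count_list (generator_degrees i) j = card {x \<in> B. g x = i \<and> int (card (l x)) = j}"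
proof -
  have "count_list (map f xs) j = card {x \<in> set xs. f x = j}" if "distinct xs" for f :: "nat \<Rightarrow> int" and xs
    using that
  proof (induction xs)
    case (Cons a xs)
    have "{x \<in> set (a # xs). f x = j} = (if f a = j then insert a {x \<in> set xs. f x = j} else {x \<in> set xs. f x = j})"
      by auto
    then show ?case using Cons by auto
  qed simp
  from this[OF distinct_generator_list] have "count_list (generator_degrees i) j = card {x \<in> generators i. int (card (l x)) = j}"
    unfolding generator_degrees_def set_generator_list by blast
  moreover have "{x \<in> generators i. int (card (l x)) = j} = {x \<in> B. g x = i \<and> int (card (l x)) = j}"
    by (auto simp: generators_def)
  ultimately show ?thesis by simp
qed

end

section \<open>Greedoids and linear quotients\<close>

text \<open>Linear quotients of the squarefree monomial ideal generated by the sets in a list; the last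
  generator comes first in the list.\<close>

primrec linear_quotients :: "'v set list \<Rightarrow> bool" where
  "linear_quotients [] \<longleftrightarrow> True" |
  "linear_quotients (C # Bs) \<longleftrightarrow>
     (\<forall>A\<in>set Bs. \<exists>A'\<in>set Bs. \<exists>v\<in>A. A' - C = {v}) \<and> linear_quotients Bs"

text \<open>The condition says that the colon ideal of the generators in the tail by
  \<open>C\<close> is generated by the variables in \<open>?S\<close>. These have a resolution with
  bound 0, so attaching \<open>C\<close> by a cone needs only
  \<open>card C \<le> Suc r\<close>.\<close>

lemma has_sqfree_res_linear_quotients:
  fixes Bs :: "'v::finite set list"
  assumes "linear_quotients Bs" "\<And>C. C \<in> set Bs \<Longrightarrow> card C \<le> Suc r"
  shows "has_sqfree_res TYPE('k::comm_ring_1) {W. \<exists>C\<in>set Bs. C \<subseteq> W} r"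
  using assms
proof (induction Bs)
  case Nil
  then show ?case by (simp add: has_sqfree_res_empty)
next
  case (Cons C Bs)
  let ?S = "{v. \<exists>A'\<in>set Bs. A' - C = {v}}" and ?U = "{W. \<exists>A\<in>set Bs. A \<subseteq> W}"
  have "{W. W \<union> C \<in> ?U} = {W. W \<inter> ?S \<noteq> {}}"
  proof (intro equalityI subsetI CollectI)
    fix W assume "W \<in> {W. W \<union> C \<in> ?U}"
    then obtain A where A: "A \<in> set Bs" "A \<subseteq> W \<union> C" by auto
    then obtain A' v where "A' \<in> set Bs" "v \<in> A" "A' - C = {v}" using Cons.prems(1) by fastforce
    then show "W \<inter> ?S \<noteq> {}" using A by blast
  next
    fix W assume "W \<in> {W. W \<inter> ?S \<noteq> {}}"
    then obtain v A' where A': "v \<in> W" "A' \<in> set Bs" "A' - C = {v}" by auto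
    then have "A' \<subseteq> W \<union> C" by auto
    then show "\<exists>A\<in>set Bs. A \<subseteq> W \<union> C" using A'(2) by auto
  qed
  then have "has_sqfree_res TYPE('k) {W. W \<union> C \<in> ?U} 0" using has_sqfree_res_variables[of ?S] by simp
  moreover have "has_sqfree_res TYPE('k) ?U r" using Cons by simp
  moreover have "0 + card C \<le> Suc r" using Cons.prems(2) by simp
  ultimately have "has_sqfree_res TYPE('k) (?U \<union> {W. C \<subseteq> W}) r" by (intro has_sqfree_res_cone)
  moreover have "?U \<union> {W. C \<subseteq> W} = {W. \<exists>A\<in>set (C # Bs). A \<subseteq> W}" by auto
  ultimately show ?case by simp
qed

text \<open>The tail of a list comes first, so members of \<open>As\<close> have to be linked to
  those of \<open>Bs\<close>, and not conversely.\<close>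

lemma linear_quotients_append:
  assumes "linear_quotients As" "linear_quotients Bs"
    "\<And>C A. C \<in> set As \<Longrightarrow> A \<in> set Bs \<Longrightarrow> \<exists>A'\<in>set Bs. \<exists>v\<in>A. A' - C = {v}"
  shows "linear_quotients (As @ Bs)"
  using assms
proof (induction As)
  case (Cons C As)
  have "\<exists>A'\<in>set (As @ Bs). \<exists>v\<in>A. A' - C = {v}" if "A \<in> set (As @ Bs)" for A
  proof (cases "A \<in> set As")
    case True
    then have "\<exists>A'\<in>set As. \<exists>v\<in>A. A' - C = {v}" using Cons.prems(1) by simp
    then obtain A' v where "A' \<in> set As" "v \<in> A" "A' - C = {v}" by (elim bexE)
    then show ?thesis by (intro bexI[of _ A'] bexI[of _ v]) simp_all
  next
    case False
    then have "\<exists>A'\<in>set Bs. \<exists>v\<in>A. A' - C = {v}" using that by (intro Cons.prems(3)) auto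
    then obtain A' v where "A' \<in> set Bs" "v \<in> A" "A' - C = {v}" by (elim bexE)
    then show ?thesis by (intro bexI[of _ A'] bexI[of _ v]) simp_all
  qed
  then show ?case using Cons by simp
qed simp

lemma linear_quotients_insert:
  assumes "linear_quotients Bs" "\<And>C. C \<in> set Bs \<Longrightarrow> v \<notin> C"
  shows "linear_quotients (map (insert v) Bs)"
  using assms
proof (induction Bs)
  case (Cons C Bs)
  have "\<exists>A'\<in>set (map (insert v) Bs). \<exists>w\<in>A. A' - insert v C = {w}"
    if "A \<in> set (map (insert v) Bs)" for A
  proof -
    obtain A0 where A0: "A0 \<in> set Bs" "A = insert v A0"
      using \<open>A \<in> set (map (insert v) Bs)\<close> by auto
    then have "\<exists>A1\<in>set Bs. \<exists>w\<in>A0. A1 - C = {w}" using Cons.prems(1) by simp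
    then obtain A1 w where A1: "A1 \<in> set Bs" "w \<in> A0" "A1 - C = {w}" by (elim bexE)
    have "insert v A1 - insert v C = {w}" using A1 Cons.prems(2)[of A1] by auto
    then show ?thesis using A0 A1 by (intro bexI[of _ "insert v A1"] bexI[of _ w]) simp_all
  qed
  then show ?case using Cons by simp
qed simp

text \<open>Accessibility follows from the exchange property applied to the empty set.\<close>

definition greedoid :: "'v set set \<Rightarrow> bool" where
  "greedoid F \<longleftrightarrow> {} \<in> F \<and> (\<forall>A\<in>F. \<forall>C\<in>F. card A < card C \<longrightarrow> (\<exists>x\<in>C - A. insert x A \<in> F))"

lemma greedoid_augment:
  fixes F :: "'v::finite set set"
  assumes "greedoid F" "A \<in> F" "C \<in> F" "card A \<le> card C"
  shows "\<exists>A'\<in>F. A \<subseteq> A' \<and> A' \<subseteq> A \<union> C \<and> card A' = card C"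
  using assms(2,4)
proof (induction "card C - card A" arbitrary: A)
  case 0
  then show ?case by (intro bexI[of _ A]) auto
next
  case (Suc n)
  have "card A < card C" using Suc.hyps(2) by simp
  then have "\<exists>x\<in>C - A. insert x A \<in> F" using assms(1,3) Suc.prems(1) unfolding greedoid_def by simp
  then obtain x where x: "x \<in> C - A" "insert x A \<in> F" by (elim bexE)
  have "\<exists>A'\<in>F. insert x A \<subseteq> A' \<and> A' \<subseteq> insert x A \<union> C \<and> card A' = card C"
    using Suc x by (intro Suc.hyps(1)) auto
  then show ?case using x by blast
qed

text \<open>Bases containing a feasible element \<open>v\<close> come first; any other basis is linked to them by
  augmenting \<open>{v}\<close> from it.\<close>

lemma greedoid_linear_quotients:
  fixes F :: "'v::finite set set"
  assumes "greedoid F"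
  shows "\<exists>Bs. set Bs = {A \<in> F. card A = t} \<and> linear_quotients Bs"
  using assms
proof (induction "card (\<Union>F)" arbitrary: F t rule: less_induct)
  case less
  show ?case
  proof (cases "t = 0")
    case True
    then have "set [{}] = {A \<in> F. card A = t}" using less.prems by (auto simp: greedoid_def)
    then show ?thesis by (intro exI[of _ "[{}]"]) simp
  next
    case t: False
    show ?thesis
    proof (cases "\<exists>v. {v} \<in> F")
      case False
      have "card A \<noteq> t" if "A \<in> F" for A
      proof
        assume "card A = t"
        then have "card {} < card A" using t by simp
        then have "\<exists>x\<in>A - {}. insert x {} \<in> F"
          using less.prems that unfolding greedoid_def by blast
        then show False using False by auto
      qed
      then show ?thesis by (intro exI[of _ "[]"]) auto
    next
      case True
      then obtain v where v: "{v} \<in> F" by blast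
      \<comment> \<open>\<open>F1\<close> is the contraction of the greedoid at \<open>v\<close> and
        \<open>F2\<close> its deletion. The element \<open>v\<close> is in neither union, which
        gives the decrease for the induction.\<close>
      define F1 where "F1 = {A. v \<notin> A \<and> insert v A \<in> F}"
      define F2 where "F2 = {A \<in> F. v \<notin> A}"
      have "greedoid F1"
        unfolding greedoid_def
      proof (intro conjI ballI impI)
        show "{} \<in> F1" using v by (simp add: F1_def)
        fix A C assume AC: "A \<in> F1" "C \<in> F1" "card A < card C"
        then have "card (insert v A) < card (insert v C)" "insert v A \<in> F" "insert v C \<in> F"
          by (auto simp: F1_def)
        then obtain x where "x \<in> insert v C - insert v A" "insert x (insert v A) \<in> F"
          using less.prems unfolding greedoid_def by blast
        then show "\<exists>x\<in>C - A. insert x A \<in> F1"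
          using AC by (intro bexI[of _ x]) (auto simp: F1_def insert_commute)
      qed
      moreover have "greedoid F2"
        unfolding greedoid_def
      proof (intro conjI ballI impI)
        show "{} \<in> F2" using less.prems by (simp add: F2_def greedoid_def)
        fix A C assume AC: "A \<in> F2" "C \<in> F2" "card A < card C"
        then obtain x where "x \<in> C - A" "insert x A \<in> F"
          using less.prems unfolding greedoid_def F2_def by blast
        then show "\<exists>x\<in>C - A. insert x A \<in> F2"
          using AC by (intro bexI[of _ x]) (auto simp: F2_def)
      qed
      moreover have "\<Union>F1 \<subset> \<Union>F" "\<Union>F2 \<subset> \<Union>F"
        using v by (auto simp: F1_def F2_def)
      then have "card (\<Union>F1) < card (\<Union>F)" "card (\<Union>F2) < card (\<Union>F)"
        by (auto intro: psubset_card_mono)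
      ultimately obtain Bs1 Bs2 where
        Bs1: "set Bs1 = {A \<in> F1. card A = t - 1}" "linear_quotients Bs1" and
        Bs2: "set Bs2 = {A \<in> F2. card A = t}" "linear_quotients Bs2"
        using less.hyps[of F1 "t - 1"] less.hyps[of F2 t] by blast
      let ?Bs1 = "map (insert v) Bs1"
      have set1: "set ?Bs1 = {A \<in> F. card A = t \<and> v \<in> A}"
      proof (intro equalityI subsetI)
        fix A assume "A \<in> {A \<in> F. card A = t \<and> v \<in> A}"
        then have "A - {v} \<in> set Bs1" "A = insert v (A - {v})" unfolding Bs1(1) by (auto simp: F1_def insert_absorb)
        then show "A \<in> set ?Bs1" unfolding set_map by (intro image_eqI[of A "insert v" "A - {v}"])
      next
        fix A assume "A \<in> set ?Bs1"
        then obtain A0 where A0: "A0 \<in> F1" "card A0 = t - 1" "A = insert v A0"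
          using Bs1(1) by auto
        then show "A \<in> {A \<in> F. card A = t \<and> v \<in> A}" using t by (simp add: F1_def)
      qed
      have "linear_quotients (Bs2 @ ?Bs1)"
      proof (rule linear_quotients_append)
        show "linear_quotients ?Bs1" using Bs1 by (intro linear_quotients_insert) (auto simp: F1_def)
        fix C A assume C: "C \<in> set Bs2" and A: "A \<in> set ?Bs1"
        then have C': "C \<in> F" "card C = t" "v \<notin> C" by (auto simp: Bs2(1) F2_def)
        then obtain A' where "A' \<in> F" "{v} \<subseteq> A'" "A' \<subseteq> {v} \<union> C" "card A' = t"
          using greedoid_augment[OF less.prems v C'(1)] t by auto
        then have "A' \<in> set ?Bs1" "A' - C = {v}" using C'(3) unfolding set1 by auto
        then show "\<exists>A'\<in>set ?Bs1. \<exists>v\<in>A. A' - C = {v}" using A by auto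
      qed (rule Bs2(2))
      moreover have "set (Bs2 @ ?Bs1) = {A \<in> F. card A = t}"
        unfolding set_append set1 Bs2(1) by (auto simp: F2_def)
      ultimately show ?thesis by blast
    qed
  qed
qed

lemma has_sqfree_res_greedoid:
  fixes F :: "'v::finite set set"
  assumes "greedoid F"
  shows "has_sqfree_res TYPE('k::comm_ring_1) {W. \<exists>A\<in>F. card A = Suc r \<and> A \<subseteq> W} r"
proof -
  obtain Bs where Bs: "set Bs = {A \<in> F. card A = Suc r}" "linear_quotients Bs"
    using greedoid_linear_quotients[OF assms] by blast
  have "{W. \<exists>A\<in>F. card A = Suc r \<and> A \<subseteq> W} = {W. \<exists>C\<in>set Bs. C \<subseteq> W}" using Bs(1) by auto
  then show ?thesis using has_sqfree_res_linear_quotients[OF Bs(2), of r] Bs(1) by simp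
qed

section \<open>Chordal graphs\<close>

text \<open>A set without outgoing edges is closed under reachability, and the set of reachable
  vertices has no outgoing edge. The cut form yields crossing edges later without any paths.\<close>

lemma induced_connected_iff_cut:
  "induced_connected E W \<longleftrightarrow> W \<noteq> {} \<and>
     (\<forall>S. S \<subseteq> W \<longrightarrow> S \<noteq> {} \<longrightarrow> S \<noteq> W \<longrightarrow> (\<exists>a\<in>S. \<exists>b\<in>W - S. {a, b} \<in> E))"
  (is "_ \<longleftrightarrow> W \<noteq> {} \<and> ?cut")
proof (cases "W = {}")
  case False
  let ?R = "{(a, b). {a, b} \<in> induced_edges E W}"
  have "?cut" if conn: "\<forall>u\<in>W. \<forall>v\<in>W. (u, v) \<in> ?R\<^sup>*"
  proof (intro allI impI, rule ccontr)
    fix S assume S: "S \<subseteq> W" "S \<noteq> {}" "S \<noteq> W" and no: "\<not> (\<exists>a\<in>S. \<exists>b\<in>W - S. {a, b} \<in> E)"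
    obtain a b where ab: "a \<in> S" "b \<in> W - S" using S by auto
    have "(a, b) \<in> ?R\<^sup>*" using conn ab S by auto
    then have "b \<in> S"
    proof induction
      case (step y z)
      then show ?case using no by (auto simp: induced_edges_def)
    qed (rule ab(1))
    then show False using ab by simp
  qed
  moreover have "\<forall>u\<in>W. \<forall>v\<in>W. (u, v) \<in> ?R\<^sup>*" if cut: ?cut
  proof (intro ballI, rule ccontr)
    fix u v assume uv: "u \<in> W" "v \<in> W" "(u, v) \<notin> ?R\<^sup>*"
    let ?S = "{x \<in> W. (u, x) \<in> ?R\<^sup>*}"
    have "\<exists>a\<in>?S. \<exists>b\<in>W - ?S. {a, b} \<in> E"
      by (rule cut[rule_format]) (use uv in auto)
    then obtain a b where ab: "a \<in> ?S" "b \<in> W - ?S" "{a, b} \<in> E" by blast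
    then have "(a, b) \<in> ?R" by (auto simp: induced_edges_def)
    then have "(u, b) \<in> ?R\<^sup>*" using ab(1) by (auto intro: rtrancl_into_rtrancl)
    then show False using ab by auto
  qed
  ultimately show ?thesis using False unfolding induced_connected_def by blast
qed (simp add: induced_connected_def)

lemma induced_connected_cutE:
  assumes "induced_connected E W" "x \<in> W" "x \<in> S" "y \<in> W" "y \<notin> S"
  obtains a b where "a \<in> W" "a \<in> S" "b \<in> W" "b \<notin> S" "{a, b} \<in> E"
proof -
  have "\<exists>a\<in>W \<inter> S. \<exists>b\<in>W - (W \<inter> S). {a, b} \<in> E"
    using assms unfolding induced_connected_iff_cut by (elim conjE allE[of _ "W \<inter> S"]) auto
  then show ?thesis using that by auto
qed

lemma induced_connected_singleton: "induced_connected E {x}"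
  by (auto simp: induced_connected_def)

lemma induced_connected_Un:
  assumes A: "induced_connected E A" and B: "induced_connected E B"
    and touch: "A \<inter> B \<noteq> {} \<or> (\<exists>a\<in>A. \<exists>b\<in>B. {a, b} \<in> E)"
  shows "induced_connected E (A \<union> B)"
  unfolding induced_connected_iff_cut
proof (intro conjI allI impI)
  show "A \<union> B \<noteq> {}" using A by (auto simp: induced_connected_def)
  fix S assume S: "S \<subseteq> A \<union> B" "S \<noteq> {}" "S \<noteq> A \<union> B"
  show "\<exists>a\<in>S. \<exists>b\<in>A \<union> B - S. {a, b} \<in> E"
  proof (cases "(\<exists>x\<in>A. \<exists>y\<in>A. x \<in> S \<and> y \<notin> S) \<or> (\<exists>x\<in>B. \<exists>y\<in>B. x \<in> S \<and> y \<notin> S)")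
    case True
    then show ?thesis
    proof
      assume "\<exists>x\<in>A. \<exists>y\<in>A. x \<in> S \<and> y \<notin> S"
      then obtain x y where "x \<in> A" "x \<in> S" "y \<in> A" "y \<notin> S" by blast
      with A obtain a b where "a \<in> A" "a \<in> S" "b \<in> A" "b \<notin> S" "{a, b} \<in> E"
        by (rule induced_connected_cutE)
      then show ?thesis by blast
    next
      assume "\<exists>x\<in>B. \<exists>y\<in>B. x \<in> S \<and> y \<notin> S"
      then obtain x y where "x \<in> B" "x \<in> S" "y \<in> B" "y \<notin> S" by blast
      with B obtain a b where "a \<in> B" "a \<in> S" "b \<in> B" "b \<notin> S" "{a, b} \<in> E"
        by (rule induced_connected_cutE)
      then show ?thesis by blast
    qed
  next
    case False
    then have dis: "(A \<subseteq> S \<and> B \<inter> S = {}) \<or> (B \<subseteq> S \<and> A \<inter> S = {})" using S by blast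
    then have "A \<inter> B = {}" by blast
    then obtain a b where "a \<in> A" "b \<in> B" "{a, b} \<in> E" using touch by blast
    then show ?thesis using dis by (metis DiffI IntI UnI1 UnI2 empty_iff insert_commute subsetD)
  qed
qed

lemma induced_connected_insert:
  assumes "induced_connected E A" "a \<in> A" "{a, x} \<in> E" shows "induced_connected E (insert x A)"
  using induced_connected_Un[OF assms(1) induced_connected_singleton, of x] assms(2,3) by auto

lemma finite_type_max_card:
  fixes P :: "'v::finite set \<Rightarrow> bool"
  assumes "P A0" shows "\<exists>A. P A \<and> (\<forall>A'. P A' \<longrightarrow> card A' \<le> card A)"
proof -
  have "\<forall>A. P A \<longrightarrow> card A < Suc (card (UNIV :: 'v set))" by (auto simp: less_Suc_eq_le intro: card_mono)
  then show ?thesis by (rule ex_has_greatest_nat[of P A0 card, OF assms])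
qed

section \<open>Simplicial vertices and elimination orderings\<close>

definition clique :: "'v set set \<Rightarrow> 'v set \<Rightarrow> bool" where
  "clique E Q \<longleftrightarrow> (\<forall>a\<in>Q. \<forall>b\<in>Q. a \<noteq> b \<longrightarrow> {a, b} \<in> E)"

text \<open>A shortest walk from \<open>s\<close> to \<open>s'\<close> through \<open>A\<close> does
  it: a chord or a repeated vertex would allow a shortcut.\<close>

lemma chordless_path:
  assumes A: "induced_connected E A" and "a \<in> A" "{s, a} \<in> E" "a' \<in> A" "{a', s'} \<in> E"
  obtains p where "p \<noteq> []" "hd p = s" "last p = s'" "set p \<subseteq> insert s (insert s' A)"
    "successively (\<lambda>u v. {u, v} \<in> E) p" "distinct p"
    "\<And>i j. i < j \<Longrightarrow> j < length p \<Longrightarrow> {p ! i, p ! j} \<in> E \<Longrightarrow> j = Suc i"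
proof -
  let ?walk = "\<lambda>p. p \<noteq> [] \<and> hd p = s \<and> last p = s' \<and> set p \<subseteq> insert s (insert s' A) \<and>
    successively (\<lambda>u v. {u, v} \<in> E) p"
  have "\<exists>q. q \<noteq> [] \<and> hd q = a \<and> last q = x \<and> set q \<subseteq> A \<and> successively (\<lambda>u v. {u, v} \<in> E) q"
    if "(a, x) \<in> {(a, b). {a, b} \<in> induced_edges E A}\<^sup>*" for x
    using that
  proof induction
    case base
    then show ?case using assms by (intro exI[of _ "[a]"]) auto
  next
    case (step y z)
    then obtain q where "q \<noteq> []" "hd q = a" "last q = y" "set q \<subseteq> A" "successively (\<lambda>u v. {u, v} \<in> E) q"
      by blast
    then show ?case using step
      by (intro exI[of _ "q @ [z]"]) (auto simp: successively_append_iff induced_edges_def)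
  qed
  moreover have "(a, a') \<in> {(a, b). {a, b} \<in> induced_edges E A}\<^sup>*"
    using A assms by (auto simp: induced_connected_def)
  ultimately obtain q where q: "q \<noteq> []" "hd q = a" "last q = a'" "set q \<subseteq> A" "successively (\<lambda>u v. {u, v} \<in> E) q"
    by blast
  have walk: "?walk (s # q @ [s'])"
    using q assms by (auto simp: successively_append_iff successively_Cons)
  obtain p where "?walk p \<and> (\<forall>q. ?walk q \<longrightarrow> length p \<le> length q)"
    using ex_has_least_nat[of ?walk, OF walk, of length] by (rule exE)
  then have p: "?walk p" and min: "\<And>q. ?walk q \<Longrightarrow> length p \<le> length q" by simp_all
  have adj: "{p ! i, p ! Suc i} \<in> E" if "Suc i < length p" for i
    using p that by (auto simp: successively_conv_nth)
  have sub: "successively (\<lambda>u v. {u, v} \<in> E) (take i p)" "successively (\<lambda>u v. {u, v} \<in> E) (drop i p)" for i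
    using p by (metis append_take_drop_id successively_append_iff)+
  have chord: "j = Suc i" if ij: "i < j" "j < length p" "{p ! i, p ! j} \<in> E" for i j
  proof (rule ccontr)
    assume "j \<noteq> Suc i"
    let ?q = "take (Suc i) p @ drop j p"
    have "last (take (Suc i) p) = p ! i" using ij by (simp add: take_Suc_conv_app_nth)
    then have "successively (\<lambda>u v. {u, v} \<in> E) ?q"
      using sub ij by (auto simp: successively_append_iff hd_drop_conv_nth)
    moreover have "set ?q \<subseteq> set p" by (auto dest: in_set_takeD in_set_dropD)
    moreover have "hd ?q = hd p" using p by (cases p) auto
    ultimately have "?walk ?q" using p ij by auto
    then show False using min[of ?q] ij \<open>j \<noteq> Suc i\<close> by auto
  qed
  have neq: "p ! i \<noteq> p ! j" if ij: "i < j" "j < length p" for i j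
  proof
    assume eq: "p ! i = p ! j"
    let ?q = "take i p @ drop j p"
    have "take i p \<noteq> [] \<Longrightarrow> {last (take i p), hd (drop j p)} \<in> E"
      using adj[of "i - 1"] ij eq by (cases i) (auto simp: take_Suc_conv_app_nth hd_drop_conv_nth)
    then have "successively (\<lambda>u v. {u, v} \<in> E) ?q"
      using sub by (auto simp: successively_append_iff)
    moreover have "set ?q \<subseteq> set p" by (auto dest: in_set_takeD in_set_dropD)
    moreover have "hd ?q = hd p"
      using p ij eq by (cases i) (auto simp: hd_drop_conv_nth hd_append hd_conv_nth)
    ultimately have "?walk ?q" using p ij by auto
    then show False using min[of ?q] ij by auto
  qed
  have "distinct p" unfolding distinct_conv_nth using neq by (metis linorder_neqE_nat)
  then show ?thesis using that p chord by blast
qed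

lemma induced_cycle_of_path:
  assumes simple: "simple_graph E" and p: "p \<noteq> []" "hd p = s" "last p = s'"
    "successively (\<lambda>u v. {u, v} \<in> E) p" "distinct p"
    and chord: "\<And>i j. i < j \<Longrightarrow> j < length p \<Longrightarrow> {p ! i, p ! j} \<in> E \<Longrightarrow> j = Suc i"
    and b: "b \<notin> set p" "{b, s} \<in> E" "{s', b} \<in> E" "\<And>x. x \<in> set p \<Longrightarrow> {b, x} \<in> E \<Longrightarrow> x = s \<or> x = s'"
    and "s \<noteq> s'"
  shows "induced_cycle E (b # p)"
  unfolding induced_cycle_def
proof (intro conjI)
  let ?c = "b # p" and ?n = "Suc (length p)"
  have len: "length p \<ge> 2"
    using p \<open>s \<noteq> s'\<close> by (cases p; cases "tl p") auto
  then show "3 \<le> length ?c" by simp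
  show "distinct ?c" using p b by simp
  have s: "p ! 0 = s" "p ! (length p - 1) = s'" using p by (simp_all add: hd_conv_nth last_conv_nth)
  have adj: "{p ! i, p ! Suc i} \<in> E" if "Suc i < length p" for i
    using p that by (auto simp: successively_conv_nth)
  let ?e = "\<lambda>i. {?c ! i, ?c ! (Suc i mod length ?c)}"
  have e0: "?e 0 = {b, s}" using len s(1) by (cases p) auto
  have en: "?e (length p) = {s', b}" using len s(2) by (cases p) (auto simp: nth_Cons')
  have ei: "?e (Suc i) = {p ! i, p ! Suc i}" if "Suc i < length p" for i using that by simp
  show "induced_edges E (set ?c) = ?e ` {..<length ?c}"
  proof (intro equalityI subsetI)
    fix e assume "e \<in> induced_edges E (set ?c)"
    then have e: "e \<in> E" "e \<subseteq> set ?c" by (auto simp: induced_edges_def)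
    then obtain x y where xy: "e = {x, y}" "x \<noteq> y" using simple by (auto simp: simple_graph_def card_2_iff)
    show "e \<in> ?e ` {..<length ?c}"
    proof (cases "b \<in> e")
      case True
      then obtain z where z: "e = {b, z}" "z \<noteq> b" using xy by auto
      then have "z = s \<or> z = s'" using b(4)[of z] e by auto
      then have "e = ?e 0 \<or> e = ?e (length p)" unfolding e0 en using z by auto
      then show ?thesis by (auto intro: rev_image_eqI)
    next
      case False
      then obtain i j where ij: "x = p ! i" "i < length p" "y = p ! j" "j < length p"
        using xy e by (auto simp: in_set_conv_nth)
      have *: "e \<in> ?e ` {..<length ?c}" if "i < j" "j < length p" "e = {p ! i, p ! j}" for i j
      proof -
        have "j = Suc i" using chord[of i j] that e by auto
        then show ?thesis using ei[of i] that by (intro image_eqI[of _ _ "Suc i"]) auto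
      qed
      show ?thesis using *[of i j] *[of j i] ij xy by (metis insert_commute linorder_neqE_nat)
    qed
  next
    fix e assume "e \<in> ?e ` {..<length ?c}"
    then obtain k where k: "k < length ?c" "e = ?e k" by auto
    have "?c ! k \<in> set ?c" by (rule nth_mem[OF k(1)])
    moreover have "?c ! (Suc k mod length ?c) \<in> set ?c" by (rule nth_mem) simp
    ultimately have "e \<subseteq> set ?c" unfolding k(2) by blast
    moreover have "e \<in> E"
    proof (cases k)
      case 0
      then show ?thesis using k(2) e0 b by simp
    next
      case (Suc i)
      then show ?thesis
        using k en ei[of i] adj[of i] b by (cases "Suc i = length p") auto
    qed
    ultimately show "e \<in> induced_edges E (set ?c)" by (simp add: induced_edges_def)
  qed
qed

text \<open>Take a connected set \<open>A\<close> maximal among those not dominating \<open>S\<close>, and let \<open>T\<close> be its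
  neighbourhood. The rest \<open>B\<close> of \<open>S\<close> is completely joined to \<open>T\<close>, and \<open>T\<close> is a clique because a
  chordless path through \<open>A\<close> closes up with any vertex of \<open>B\<close>; so a simplicial vertex of \<open>B\<close>
  is simplicial in \<open>S\<close>.\<close>

lemma simplicial_vertex_exists:
  fixes E :: "'v::finite set set"
  assumes simple: "simple_graph E" and "chordal E" and "S \<noteq> {}"
  shows "\<exists>v\<in>S. clique E {u \<in> S. {v, u} \<in> E}"
  using assms(3)
proof (induction "card S" arbitrary: S rule: less_induct)
  case less
  show ?case
  proof (cases "clique E S")
    case True
    then show ?thesis using less.prems by (auto simp: clique_def)
  next
    case False
    then obtain x y where xy: "x \<in> S" "y \<in> S" "x \<noteq> y" "{x, y} \<notin> E" by (auto simp: clique_def)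
    define N where "N A = A \<union> {u \<in> S. \<exists>a\<in>A. {a, u} \<in> E}" for A
    let ?good = "\<lambda>A. A \<subseteq> S \<and> induced_connected E A \<and> S - N A \<noteq> {}"
    have base: "?good {x}" using xy by (auto simp: induced_connected_singleton N_def)
    obtain A where "?good A \<and> (\<forall>A'. ?good A' \<longrightarrow> card A' \<le> card A)"
      using finite_type_max_card[of ?good, OF base] by (rule exE)
    then have A: "?good A" and max: "\<And>A'. ?good A' \<Longrightarrow> card A' \<le> card A" by simp_all
    define B where "B = S - N A"
    define T where "T = N A - A"
    have A_ne: "A \<noteq> {}" using A by (auto simp: induced_connected_def)
    have join: "{s, b} \<in> E" if sb: "s \<in> T" "b \<in> B" for s b
    proof (rule ccontr)
      assume no: "{s, b} \<notin> E"
      obtain a where "a \<in> A" "{a, s} \<in> E" "s \<in> S" "s \<notin> A" using sb by (auto simp: T_def N_def)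
      then have "?good (insert s A)"
        using A no sb induced_connected_insert[of E A a s] by (auto simp: B_def T_def N_def)
      from max[OF this] show False using \<open>s \<notin> A\<close> by simp
    qed
    have "card B < card S" using A A_ne by (intro psubset_card_mono) (auto simp: B_def N_def)
    moreover have "B \<noteq> {}" using A by (simp add: B_def)
    ultimately obtain b where b: "b \<in> B" "clique E {u \<in> B. {b, u} \<in> E}" using less.hyps by blast
    have bA: "{b, a} \<notin> E" if "a \<in> A" for a
      using b(1) that by (auto simp: B_def N_def insert_commute)
    have T: "{s, s'} \<in> E" if st: "s \<in> T" "s' \<in> T" "s \<noteq> s'" for s s'
    proof (rule ccontr)
      assume no: "{s, s'} \<notin> E"
      obtain a a' where a: "a \<in> A" "{s, a} \<in> E" "a' \<in> A" "{a', s'} \<in> E"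
        using st by (auto simp: T_def N_def insert_commute)
      obtain p where p: "p \<noteq> []" "hd p = s" "last p = s'" "set p \<subseteq> insert s (insert s' A)"
        "successively (\<lambda>u v. {u, v} \<in> E) p" "distinct p"
        "\<And>i j. i < j \<Longrightarrow> j < length p \<Longrightarrow> {p ! i, p ! j} \<in> E \<Longrightarrow> j = Suc i"
        using chordless_path[OF _ a] A by metis
      have "induced_cycle E (b # p)"
      proof (rule induced_cycle_of_path[OF simple p(1,2,3,5,6,7)])
        show "b \<notin> set p" using p(4) b(1) st by (auto simp: B_def T_def N_def)
        show "{b, s} \<in> E" "{s', b} \<in> E" using join[OF st(1) b(1)] join[OF st(2) b(1)] by (simp_all add: insert_commute)
        show "z = s \<or> z = s'" if "z \<in> set p" "{b, z} \<in> E" for z using that p(4) bA by auto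
      qed (use st in auto)
      \<comment> \<open>\<open>s\<close> and \<open>s'\<close> are distinct and not adjacent, so the
        path has an inner vertex and the cycle through \<open>b\<close> has length at least
        four.\<close>
      moreover have "length p > 2"
      proof (rule ccontr)
        assume "\<not> length p > 2"
        then have "length p = 1 \<or> length p = 2" using p(1) by (cases "length p") auto
        then show False using p(1,2,3,5) st no
          by (auto simp: length_Suc_conv numeral_2_eq_2)
      qed
      ultimately show False using \<open>chordal E\<close> unfolding chordal_def by force
    qed
    have nb: "u \<in> B \<or> u \<in> T" if "u \<in> S" "{b, u} \<in> E" for u
      using that bA by (auto simp: B_def T_def)
    have "clique E {u \<in> S. {b, u} \<in> E}"
      unfolding clique_def
    proof (intro ballI impI)
      fix u v assume uv: "u \<in> {u \<in> S. {b, u} \<in> E}" "v \<in> {u \<in> S. {b, u} \<in> E}" "u \<noteq> v"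
      then consider "u \<in> B" "v \<in> B" | "u \<in> T" "v \<in> B" | "u \<in> B" "v \<in> T" | "u \<in> T" "v \<in> T"
        using nb by blast
      then show "{u, v} \<in> E"
      proof cases
        case 1
        then show ?thesis using b(2) uv by (auto simp: clique_def)
      next
        case 3
        then have "{v, u} \<in> E" using join by blast
        then show ?thesis by (simp add: insert_commute)
      qed (use join T uv in blast)+
    qed
    then show ?thesis using b(1) by (auto simp: B_def)
  qed
qed

text \<open>The induction runs over vertex sets \<open>S\<close>, each of which has a vertex
  simplicial within it: that vertex gets rank 0, and the ranks of the others move up by one.\<close>

lemma perfect_elimination_ordering:
  fixes E :: "'v::finite set set"
  assumes "simple_graph E" "chordal E"
  shows "\<exists>\<rho> :: 'v \<Rightarrow> nat. inj_on \<rho> S \<and> (\<forall>v\<in>S. clique E {u \<in> S. {v, u} \<in> E \<and> \<rho> v < \<rho> u})"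
proof (induction "card S" arbitrary: S)
  case 0
  then show ?case by simp
next
  case (Suc n)
  then have "S \<noteq> {}" by auto
  then obtain v where v: "v \<in> S" "clique E {u \<in> S. {v, u} \<in> E}"
    using simplicial_vertex_exists[OF assms] by blast
  have "n = card (S - {v})" using Suc.hyps(2) v(1) by simp
  then obtain \<rho> :: "'v \<Rightarrow> nat" where \<rho>: "inj_on \<rho> (S - {v})"
    "\<And>w. w \<in> S - {v} \<Longrightarrow> clique E {u \<in> S - {v}. {w, u} \<in> E \<and> \<rho> w < \<rho> u}"
    using Suc.hyps(1) by blast
  let ?r = "\<lambda>x. if x = v then 0 else Suc (\<rho> x)"
  have "inj_on ?r S" using \<rho>(1) by (auto simp: inj_on_def)
  moreover have "clique E {u \<in> S. {w, u} \<in> E \<and> ?r w < ?r u}" if "w \<in> S" for w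
  proof (cases "w = v")
    case True
    then show ?thesis using v(2) by (auto simp: clique_def)
  next
    case False
    then have "{u \<in> S. {w, u} \<in> E \<and> ?r w < ?r u} = {u \<in> S - {v}. {w, u} \<in> E \<and> \<rho> w < \<rho> u}" by auto
    then show ?thesis using \<rho>(2)[of w] that False by simp
  qed
  ultimately show ?case by blast
qed

text \<open>The first vertex \<open>z\<close> of \<open>K\<close> can be deleted as long as it is
  not \<open>v\<close>. Its later neighbours form a clique, so they bridge every cut that was
  crossed only through \<open>z\<close>; and if \<open>z\<close> is adjacent to \<open>b\<close>, so
  is each of its neighbours in \<open>K\<close>. In the end \<open>K = {v}\<close>.\<close>

lemma adjacent_last:
  fixes E :: "'v::finite set set" and \<rho> :: "'v \<Rightarrow> nat"
  assumes \<rho>: "inj \<rho>" "\<And>v. clique E {u. {v, u} \<in> E \<and> \<rho> v < \<rho> u}"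
    and "induced_connected E K" "v \<in> K" "\<And>x. x \<in> K \<Longrightarrow> \<rho> x \<le> \<rho> v"
    and "\<rho> v < \<rho> b" "a \<in> K" "{a, b} \<in> E"
  shows "{v, b} \<in> E"
  using assms(3-8)
proof (induction "card K" arbitrary: K a rule: less_induct)
  case less
  show ?case
  proof (cases "K = {v}")
    case True
    then show ?thesis using less.prems by simp
  next
    case False
    obtain z where z: "z \<in> K" "\<And>x. x \<in> K \<Longrightarrow> \<rho> z \<le> \<rho> x"
      using ex_has_least_nat[of "\<lambda>x. x \<in> K" v \<rho>] less.prems(2) by metis
    have later: "\<rho> z < \<rho> x" if "x \<in> K" "x \<noteq> z" for x
      using z(2)[OF that(1)] that \<rho>(1) by (metis injD le_neq_implies_less)
    have zv: "z \<noteq> v"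
    proof
      assume "z = v"
      then have "x = v" if "x \<in> K" for x using later[of x] less.prems(3)[of x] that by force
      then show False using False less.prems(2) by blast
    qed
    have nb: "{x, y} \<in> E" if "{z, x} \<in> E" "{z, y} \<in> E" "\<rho> z < \<rho> x" "\<rho> z < \<rho> y" "x \<noteq> y" for x y
      using \<rho>(2)[of z] that by (auto simp: clique_def)
    have conn: "induced_connected E (K - {z})"
      unfolding induced_connected_iff_cut
    proof (intro conjI allI impI)
      show "K - {z} \<noteq> {}" using less.prems(2) zv by auto
      fix S assume S: "S \<subseteq> K - {z}" "S \<noteq> {}" "S \<noteq> K - {z}"
      then obtain s r where sr: "s \<in> S" "r \<in> K - {z} - S" by auto
      obtain a1 b1 where c1: "a1 \<in> K" "a1 \<in> S" "b1 \<in> K" "b1 \<notin> S" "{a1, b1} \<in> E"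
        using induced_connected_cutE[OF less.prems(1), of s S r] sr S by blast
      obtain a2 b2 where c2: "a2 \<in> K" "a2 \<in> insert z S" "b2 \<in> K" "b2 \<notin> insert z S" "{a2, b2} \<in> E"
        using induced_connected_cutE[OF less.prems(1), of s "insert z S" r] sr S by blast
      show "\<exists>a\<in>S. \<exists>b\<in>K - {z} - S. {a, b} \<in> E"
      proof -
        consider "b1 \<noteq> z" | "a2 \<noteq> z" | "b1 = z" "a2 = z" by blast
        then show ?thesis
        proof cases
          case 1
          show ?thesis by (rule bexI[of _ a1], rule bexI[of _ b1]) (use 1 c1 in auto)
        next
          case 2
          show ?thesis by (rule bexI[of _ a2], rule bexI[of _ b2]) (use 2 c2 in auto)
        next
          case 3
          have "{z, a1} \<in> E" "{z, b2} \<in> E" using c1 c2 3 by (simp_all add: insert_commute)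
          moreover have neq: "a1 \<noteq> z" "b2 \<noteq> z" "a1 \<noteq> b2" using S c1 c2 by auto
          moreover have "\<rho> z < \<rho> a1" "\<rho> z < \<rho> b2"
            using later[of a1] later[of b2] c1 c2 neq by simp_all
          ultimately have "{a1, b2} \<in> E" by (intro nb[of a1 b2])
          show ?thesis by (rule bexI[of _ a1], rule bexI[of _ b2]) (use \<open>{a1, b2} \<in> E\<close> c1 c2 in auto)
        qed
      qed
    qed
    have "\<exists>a'\<in>K - {z}. {a', b} \<in> E"
    proof (cases "a = z")
      case True
      obtain c d where cd: "c \<in> K" "c \<in> {z}" "d \<in> K" "d \<notin> {z}" "{c, d} \<in> E"
        using induced_connected_cutE[OF less.prems(1), of z "{z}" v] z(1) zv less.prems(2) by blast
      have zb: "\<rho> z < \<rho> b" using later[OF less.prems(2)] zv less.prems(4) by auto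
      have zd: "\<rho> z < \<rho> d" using later[of d] cd by simp
      have "{d, b} \<in> E"
      proof (rule nb[OF _ _ zd zb])
        show "{z, d} \<in> E" "{z, b} \<in> E" using cd less.prems(6) True by simp_all
        show "d \<noteq> b" using less.prems(3)[of d] less.prems(4) cd by auto
      qed
      then show ?thesis using cd by blast
    qed (use less.prems in auto)
    then obtain a' where "a' \<in> K - {z}" "{a', b} \<in> E" by blast
    moreover have "card (K - {z}) < card K" using z(1) by (intro psubset_card_mono) auto
    ultimately show ?thesis
      using less.hyps[of "K - {z}" a'] conn less.prems zv by auto
  qed
qed

section \<open>Greedy induced matchings and clique covers\<close>

definition touching :: "'v set set \<Rightarrow> 'v set \<Rightarrow> 'v set \<Rightarrow> bool" where
  "touching E C C' \<longleftrightarrow> C \<inter> C' \<noteq> {} \<or> (\<exists>a\<in>C. \<exists>b\<in>C'. {a, b} \<in> E)"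

lemma touching_sym: "touching E C C' \<Longrightarrow> touching E C' C"
  unfolding touching_def
proof (elim disjE bexE)
  fix a b assume "a \<in> C" "b \<in> C'" "{a, b} \<in> E"
  then show "C' \<inter> C \<noteq> {} \<or> (\<exists>a\<in>C'. \<exists>b\<in>C. {a, b} \<in> E)"
    by (intro disjI2 bexI[of _ b] bexI[of _ a]) (simp_all add: insert_commute)
qed (simp add: Int_commute)

text \<open>The greedy choice: among the connected \<open>t\<close>-sets take one whose last vertex \<open>v\<close> comes first.
  Every connected \<open>t\<close>-set touching it meets the clique formed by \<open>v\<close> and its later neighbours.\<close>

lemma greedy_matching_cliques:
  fixes E :: "'v::finite set set" and \<rho> :: "'v \<Rightarrow> nat"
  assumes \<rho>: "inj \<rho>" "\<And>v. clique E {u. {v, u} \<in> E \<and> \<rho> v < \<rho> u}" and "t \<ge> 1"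
  shows "\<exists>M Qs. M \<subseteq> {C \<in> connected_sets E t. C \<subseteq> X} \<and> pairwise (\<lambda>C C'. \<not> touching E C C') M \<and>
    (\<forall>Q\<in>set Qs. clique E Q) \<and> length Qs = card M \<and>
    (\<forall>C\<in>connected_sets E t. C \<subseteq> X \<longrightarrow> (\<exists>Q\<in>set Qs. C \<inter> Q \<noteq> {}))"
proof (induction "card X" arbitrary: X rule: less_induct)
  case less
  show ?case
  proof (cases "\<exists>C\<in>connected_sets E t. C \<subseteq> X")
    case False
    then show ?thesis by (intro exI[of _ "{}"] exI[of _ "[]"]) auto
  next
    case True
    then obtain C0 where C0: "C0 \<in> connected_sets E t \<and> C0 \<subseteq> X" by blast
    let ?C = "\<lambda>C. C \<in> connected_sets E t \<and> C \<subseteq> X"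
    obtain C where "?C C \<and> (\<forall>C'. ?C C' \<longrightarrow> Max (\<rho> ` C) \<le> Max (\<rho> ` C'))"
      using ex_has_least_nat[of ?C, OF C0, of "\<lambda>C. Max (\<rho> ` C)"] by (rule exE)
    then have C: "C \<in> connected_sets E t" "C \<subseteq> X"
      and min: "\<And>C'. C' \<in> connected_sets E t \<Longrightarrow> C' \<subseteq> X \<Longrightarrow> Max (\<rho> ` C) \<le> Max (\<rho> ` C')"
      by simp_all
    have connC: "induced_connected E C" "C \<noteq> {}" using C by (auto simp: connected_sets_def induced_connected_def)
    then have "Max (\<rho> ` C) \<in> \<rho> ` C" by (intro Max_in) auto
    then obtain v where v: "v \<in> C" "\<rho> v = Max (\<rho> ` C)" by auto
    define Q where "Q = insert v {u. {v, u} \<in> E \<and> \<rho> v < \<rho> u}"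
    have Q: "clique E Q"
      using \<rho>(2)[of v] by (auto simp: clique_def Q_def insert_commute)
    have notouch: "\<not> touching E C C'"
      if C': "C' \<in> connected_sets E t" "C' \<subseteq> X" "C' \<inter> Q = {}" for C'
    proof
      assume "touching E C C'"
      have conn': "induced_connected E C'" "C' \<noteq> {}" using C' by (auto simp: connected_sets_def induced_connected_def)
      have "Max (\<rho> ` C') \<in> \<rho> ` C'" using conn' by (intro Max_in) auto
      then obtain w where w: "w \<in> C'" "\<rho> w = Max (\<rho> ` C')" by auto
      have "w \<noteq> v" using C'(3) w(1) by (auto simp: Q_def)
      then have wv: "\<rho> v < \<rho> w"
        using min[OF C'(1,2)] v(2) w(2) \<rho>(1) by (metis injD le_neq_implies_less)
      have U: "induced_connected E (C \<union> C')"
        using induced_connected_Un[OF connC(1) conn'(1)] \<open>touching E C C'\<close> by (simp add: touching_def)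
      \<comment> \<open>\<open>K\<close> is a largest connected extension of \<open>C\<close> by
        vertices of \<open>C'\<close> that are not later than \<open>v\<close>. An edge leaving it
        inside \<open>C \<union> C'\<close> ends in a vertex \<open>b\<close> of \<open>C'\<close>
        later than \<open>v\<close>. By \<open>adjacent_last\<close>, \<open>b\<close> is a
        neighbour of \<open>v\<close>, so it lies in \<open>Q\<close>.\<close>
      let ?ok = "\<lambda>K. C \<subseteq> K \<and> K \<subseteq> C \<union> {x \<in> C'. \<rho> x \<le> \<rho> v} \<and> induced_connected E K"
      have base: "?ok C" using connC by auto
      obtain K where "?ok K \<and> (\<forall>K'. ?ok K' \<longrightarrow> card K' \<le> card K)"
        using finite_type_max_card[of ?ok, OF base] by (rule exE)
      then have K: "?ok K" and max: "\<And>K'. ?ok K' \<Longrightarrow> card K' \<le> card K" by simp_all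
      have Kle: "\<rho> x \<le> \<rho> v" if "x \<in> K" for x
        using that K v(2) Max_ge[of "\<rho> ` C"] by auto
      have vw: "v \<in> C \<union> C'" "v \<in> K" "w \<in> C \<union> C'" using v(1) w(1) K by auto
      have wK: "w \<notin> K" using Kle[of w] wv by auto
      obtain a b where ab: "a \<in> C \<union> C'" "a \<in> K" "b \<in> C \<union> C'" "b \<notin> K" "{a, b} \<in> E"
        by (rule induced_connected_cutE[OF U vw wK])
      have "b \<in> C'" using ab K by blast
      have "\<rho> v < \<rho> b"
      proof (rule ccontr)
        assume "\<not> \<rho> v < \<rho> b"
        then have "?ok (insert b K)"
          using K ab \<open>b \<in> C'\<close> induced_connected_insert[of E K a b] by auto
        from max[OF this] show False using ab(4) by simp
      qed
      moreover have "{v, b} \<in> E"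
        by (rule adjacent_last[OF \<rho>, of K v b a]) (use K vw Kle \<open>\<rho> v < \<rho> b\<close> ab in auto)
      ultimately show False using C'(3) \<open>b \<in> C'\<close> by (auto simp: Q_def)
    qed
    \<comment> \<open>Connected sets inside \<open>X - Q\<close> avoid \<open>Q\<close> and so do
      not touch \<open>C\<close>; hence the matching found there can be extended by
      \<open>C\<close>, while \<open>Q\<close> takes care of all other sets.\<close>
    have "X - Q \<subset> X" using v(1) C(2) by (auto simp: Q_def)
    then have smaller: "card (X - Q) < card X" by (intro psubset_card_mono) auto
    from less.hyps[OF smaller] obtain M Qs where IH: "M \<subseteq> {C \<in> connected_sets E t. C \<subseteq> X - Q}"
      "pairwise (\<lambda>C C'. \<not> touching E C C') M" "\<forall>Q\<in>set Qs. clique E Q" "length Qs = card M"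
      "\<forall>C\<in>connected_sets E t. C \<subseteq> X - Q \<longrightarrow> (\<exists>Q\<in>set Qs. C \<inter> Q \<noteq> {})"
      by (elim exE conjE)
    have "C \<notin> M" using IH(1) v(1) by (auto simp: Q_def)
    have sym: "touching E C' C \<longleftrightarrow> touching E C C'" for C'
      by (blast intro: touching_sym)
    have "pairwise (\<lambda>C C'. \<not> touching E C C') (insert C M)"
      unfolding pairwise_insert
    proof (intro conjI allI impI)
      fix C' assume "C' \<in> M \<and> C' \<noteq> C"
      then show "\<not> touching E C C'" using IH(1) notouch by blast
      then show "\<not> touching E C' C" by (simp add: sym)
    qed (rule IH(2))
    moreover have "insert C M \<subseteq> {C \<in> connected_sets E t. C \<subseteq> X}" using IH(1) C by auto
    moreover have "\<forall>Q\<in>set (Q # Qs). clique E Q" using IH(3) Q by simp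
    moreover have "length (Q # Qs) = card (insert C M)" using IH(4) \<open>C \<notin> M\<close> by simp
    moreover have "\<forall>C\<in>connected_sets E t. C \<subseteq> X \<longrightarrow> (\<exists>Q\<in>set (Q # Qs). C \<inter> Q \<noteq> {})"
      using IH(5) by auto
    ultimately show ?thesis by blast
  qed
qed

lemma t_induced_matching_of_not_touching:
  assumes "simple_graph E" "M \<subseteq> connected_sets E t" "pairwise (\<lambda>C C'. \<not> touching E C C') M"
  shows "t_induced_matching E t M"
  unfolding t_induced_matching_def
proof (intro conjI)
  show "disjoint M" using assms(3) by (auto simp: pairwise_def touching_def disjnt_def)
  show "induced_edges E (\<Union>M) = (\<Union>C\<in>M. induced_edges E C)"
  proof (intro equalityI subsetI)
    fix e assume e: "e \<in> induced_edges E (\<Union>M)"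
    then obtain x y where xy: "e = {x, y}" using assms(1) by (auto simp: simple_graph_def induced_edges_def card_2_iff)
    then obtain C C' where C: "x \<in> C" "C \<in> M" "y \<in> C'" "C' \<in> M" using e by (auto simp: induced_edges_def)
    have "touching E C C'" using C e xy by (auto simp: touching_def induced_edges_def)
    then have "C = C'" using assms(3) C by (auto simp: pairwise_def)
    then show "e \<in> (\<Union>C\<in>M. induced_edges E C)" using C e xy by (auto simp: induced_edges_def)
  qed (auto simp: induced_edges_def)
qed (rule assms(2))

text \<open>No edge runs between two members of \<open>M\<close>, so a connected set inside their
  union stays within one member, and equal sizes force equality.\<close>

lemma connected_set_in_induced_matching:
  fixes E :: "'v::finite set set"
  assumes M: "t_induced_matching E t M" and C: "C \<in> connected_sets E t" "C \<subseteq> \<Union>M"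
  shows "C \<in> M"
proof -
  have conn: "induced_connected E C" using C by (simp add: connected_sets_def)
  then obtain x where x: "x \<in> C" by (auto simp: induced_connected_def)
  then obtain C' where C': "C' \<in> M" "x \<in> C'" using C by auto
  have "C \<subseteq> C'"
  proof (rule ccontr)
    assume "\<not> C \<subseteq> C'"
    then obtain y where y: "y \<in> C" "y \<notin> C'" by auto
    obtain a b where ab: "a \<in> C" "a \<in> C'" "b \<in> C" "b \<notin> C'" "{a, b} \<in> E"
      by (rule induced_connected_cutE[OF conn x C'(2) y])
    then have "{a, b} \<in> induced_edges E (\<Union>M)" using C by (auto simp: induced_edges_def)
    then have "{a, b} \<in> (\<Union>C\<in>M. induced_edges E C)"
      using M by (simp add: t_induced_matching_def)
    then obtain C'' where C'': "C'' \<in> M" "{a, b} \<subseteq> C''" by (auto simp: induced_edges_def)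
    have "disjoint M" using M by (simp add: t_induced_matching_def)
    then have "C'' = C'" using disjointD[of M C' C''] C'(1) C'' ab(2) by auto
    then show False using C'' ab by simp
  qed
  moreover have "card C = t" "card C' = t"
    using C C' M by (auto simp: t_induced_matching_def connected_sets_def)
  ultimately have "C = C'" by (metis card_subset_eq finite)
  then show ?thesis using C' by simp
qed

section \<open>The regularity of connected ideals\<close>

text \<open>Let \<open>q\<close> be a vertex of \<open>C\<close> in the clique. If \<open>q\<close>
  lies in \<open>A\<close>, connectedness of \<open>C\<close> gives an edge from \<open>A\<close> to
  a vertex of \<open>C - A\<close>. If not, \<open>q\<close> itself can be added, as it is adjacent
  to the vertices of \<open>A\<close> in the clique.\<close>

lemma greedoid_connected_sets:
  fixes E :: "'v::finite set set"
  assumes "clique E Q"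
  shows "greedoid {A. A = {} \<or> induced_connected E A \<and> A \<inter> Q \<noteq> {}}" (is "greedoid ?F")
  unfolding greedoid_def
proof (intro conjI ballI impI)
  fix A C assume A: "A \<in> ?F" and C: "C \<in> ?F" and less: "card A < card C"
  then have C': "induced_connected E C" "C \<inter> Q \<noteq> {}" by auto
  then obtain q where q: "q \<in> C" "q \<in> Q" by blast
  show "\<exists>x\<in>C - A. insert x A \<in> ?F"
  proof (cases "A = {}")
    case True
    then show ?thesis using q by (intro bexI[of _ q]) (auto simp: induced_connected_singleton)
  next
    case False
    then have A': "induced_connected E A" "A \<inter> Q \<noteq> {}" using A by auto
    then obtain a where a: "a \<in> A" "a \<in> Q" by blast
    have "\<exists>x\<in>C - A. \<exists>y\<in>A. {y, x} \<in> E"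
    proof (cases "q \<in> A")
      case True
      have "\<not> C \<subseteq> A" using less card_mono[of A C] by auto
      then obtain c where c: "c \<in> C" "c \<notin> A" by blast
      obtain y x where "y \<in> C" "y \<in> A" "x \<in> C" "x \<notin> A" "{y, x} \<in> E"
        by (rule induced_connected_cutE[OF C'(1) q(1) True c])
      then show ?thesis by blast
    next
      case False
      have "a \<noteq> q" using a(1) False by blast
      then have "{a, q} \<in> E" using assms a(2) q(2) unfolding clique_def by blast
      then show ?thesis using q(1) False a(1) by blast
    qed
    then obtain x y where xy: "x \<in> C - A" "y \<in> A" "{y, x} \<in> E" by blast
    have "induced_connected E (insert x A)" by (rule induced_connected_insert[OF A'(1) xy(2,3)])
    moreover have "insert x A \<inter> Q \<noteq> {}" using a by blast
    ultimately have "insert x A \<in> ?F" by simp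
    then show ?thesis using xy(1) by (rule bexI)
  qed
qed simp

text \<open>The ideal is the sum of the ideals of the single cliques, and each of these contributes
  \<open>r\<close> to the bound.\<close>

lemma has_sqfree_res_clique_cover:
  fixes E :: "'v::finite set set"
  assumes "\<forall>Q\<in>set Qs. clique E Q"
  shows "has_sqfree_res TYPE('k::comm_ring_1)
    {W. \<exists>Q\<in>set Qs. \<exists>C\<in>connected_sets E (Suc r). C \<inter> Q \<noteq> {} \<and> C \<subseteq> W} (r * length Qs)"
  using assms
proof (induction Qs)
  case Nil
  then show ?case by (simp add: has_sqfree_res_empty)
next
  case (Cons Q Qs)
  let ?F = "{A. A = {} \<or> induced_connected E A \<and> A \<inter> Q \<noteq> {}}"
  let ?U = "\<lambda>Q. {W. \<exists>C\<in>connected_sets E (Suc r). C \<inter> Q \<noteq> {} \<and> C \<subseteq> W}"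
  have "(\<exists>A\<in>?F. card A = Suc r \<and> A \<subseteq> W) \<longleftrightarrow> (\<exists>C\<in>connected_sets E (Suc r). C \<inter> Q \<noteq> {} \<and> C \<subseteq> W)" for W
    by (auto simp: connected_sets_def)
  moreover have "has_sqfree_res TYPE('k) {W. \<exists>A\<in>?F. card A = Suc r \<and> A \<subseteq> W} r"
    by (rule has_sqfree_res_greedoid, rule greedoid_connected_sets) (use Cons.prems in simp)
  ultimately have "has_sqfree_res TYPE('k) (?U Q) r" by simp
  from has_sqfree_res_tensor[OF this Cons.IH] Cons.prems
  have "has_sqfree_res TYPE('k) (?U Q \<union> {W. \<exists>Q\<in>set Qs. W \<in> ?U Q}) (r + r * length Qs)" by simp
  moreover have "?U Q \<union> {W. \<exists>Q\<in>set Qs. W \<in> ?U Q} = {W. \<exists>Q\<in>set (Q # Qs). W \<in> ?U Q}" by auto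
  ultimately show ?case by simp
qed

text \<open>The strand in \<open>X\<close> of the restricted complex is the old strand in
  \<open>X \<inter> W\<close>; in terms of ideals, only the monomial generators supported in
  \<open>W\<close> are kept.\<close>

lemma sqfree_res_restrict:
  assumes "sqfree_res B g l D e U"
  shows "sqfree_res {x \<in> B. l x \<subseteq> W} g l (row_strand l W D) e {X. X \<inter> W \<in> U}"
  unfolding sqfree_res_def
proof (intro conjI allI)
  fix X
  have 1: "{x \<in> {x \<in> B. l x \<subseteq> W}. l x \<subseteq> X} = {x \<in> B. l x \<subseteq> X \<inter> W}" by auto
  have 2: "row_strand l X (row_strand l W D) = row_strand l (X \<inter> W) D" by (auto simp: row_strand_def intro!: ext)
  obtain h where "contraction {x \<in> B. l x \<subseteq> X \<inter> W} g (row_strand l (X \<inter> W) D) e (if X \<inter> W \<in> U then 0 else munit e e) h"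
    using assms unfolding sqfree_res_def by blast
  then show "\<exists>h. contraction {x \<in> {x \<in> B. l x \<subseteq> W}. l x \<subseteq> X} g (row_strand l X (row_strand l W D)) e
      (if X \<in> {X. X \<inter> W \<in> U} then 0 else munit e e) h"
    unfolding 1 2 by auto
qed (use lresD[OF assms] in \<open>auto simp: decreasing_def row_strand_def\<close>)

lemma sqfree_res_resolution:
  fixes D :: "nat \<Rightarrow> nat \<Rightarrow> 'k::field" and l :: "nat \<Rightarrow> 'v::finite set"
  assumes "sqfree_res B g l D e U"
  obtains d \<phi> where "graded_free_resolution (mono_ideal U :: ('v, 'k) mpoly set) d \<phi>"
    "\<forall>i j. count_list (d i) j = card {x \<in> B. g x = i \<and> int (card (l x)) = j}"
  using graded_free_resolution_sqfree_res[OF assms] count_generator_degrees[OF assms] that by blast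

lemma minimal_sqfree_res_resolution:
  fixes D :: "nat \<Rightarrow> nat \<Rightarrow> 'k::field" and l :: "nat \<Rightarrow> 'v::finite set"
  assumes "minimal_sqfree_res B g l D e U"
  obtains d \<phi> where "minimal_graded_free_resolution (mono_ideal U :: ('v, 'k) mpoly set) d \<phi>"
    "\<forall>i j. count_list (d i) j = card {x \<in> B. g x = i \<and> int (card (l x)) = j}"
proof -
  have res: "sqfree_res B g l D e U" and min: "\<And>x y. D x y \<noteq> 0 \<Longrightarrow> l x \<noteq> l y"
    using assms by (auto simp: minimal_sqfree_res_def)
  show ?thesis
    by (rule that[OF minimal_graded_free_resolution_sqfree_res[OF res min]]) (simp_all add: count_generator_degrees[OF res])
qed

text \<open>Two minimal resolutions bound each other's counts, so the one chosen by
  \<open>SOME\<close> may be replaced by any minimal resolution at hand.\<close>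

lemma graded_betti_minimal_resolution:
  fixes I :: "('v::finite, 'k::field) mpoly set"
  assumes "minimal_graded_free_resolution I d \<phi>"
  shows "graded_betti I i j = count_list (d i) j"
proof -
  let ?d = "SOME d. \<exists>\<phi>. minimal_graded_free_resolution I d \<phi>"
  have "\<exists>\<phi>. minimal_graded_free_resolution I ?d \<phi>"
    by (rule someI_ex[of "\<lambda>d. \<exists>\<phi>. minimal_graded_free_resolution I d \<phi>"]) (use assms in blast)
  then obtain \<psi> where \<psi>: "minimal_graded_free_resolution I ?d \<psi>" by blast
  have res: "graded_free_resolution I d \<phi>" "graded_free_resolution I ?d \<psi>"
    using assms \<psi> by (simp_all only: minimal_graded_free_resolution_def)
  have "count_list (?d i) j \<le> count_list (d i) j"
    by (rule minimal_resolution_count_le[OF \<psi> res(1)])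
  moreover have "count_list (d i) j \<le> count_list (?d i) j"
    by (rule minimal_resolution_count_le[OF assms res(2)])
  ultimately show ?thesis by (simp add: graded_betti_def)
qed

text \<open>Restricting to the vertices of an induced matching turns the ideal into one generated by
  monomials with disjoint supports, whose Koszul complex ends in degree \<open>|M| t\<close>.\<close>

lemma sqfree_res_generator_of_induced_matching:
  fixes D :: "nat \<Rightarrow> nat \<Rightarrow> 'k::field" and E :: "'v::finite set set"
  assumes res: "sqfree_res B g l D e {W. \<exists>C\<in>connected_sets E t. C \<subseteq> W}"
    and M: "t_induced_matching E t M"
  shows "\<exists>x\<in>B. g x = card M \<and> card (l x) = card M * t"
proof -
  have Mc: "M \<subseteq> connected_sets E t" "disjoint M" using M by (auto simp: t_induced_matching_def)
  have ne: "{} \<notin> M" using Mc by (auto simp: connected_sets_def induced_connected_def)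
  obtain B' :: "nat set" and g' l' and D' :: "nat \<Rightarrow> nat \<Rightarrow> 'k" and e' x' where K:
    "minimal_sqfree_res B' g' l' D' e' {W. \<exists>C\<in>M. C \<subseteq> W}" "x' \<in> B'" "g' x' = card M" "l' x' = \<Union>M"
    using minimal_sqfree_res_disjoint[OF finite Mc(2) ne] by blast
  have "(\<exists>C\<in>connected_sets E t. C \<subseteq> X \<inter> \<Union>M) \<longleftrightarrow> (\<exists>C\<in>M. C \<subseteq> X)" for X
    using connected_set_in_induced_matching[OF M] Mc(1) by blast
  then have U: "{X. X \<inter> \<Union>M \<in> {W. \<exists>C\<in>connected_sets E t. C \<subseteq> W}} = {W. \<exists>C\<in>M. C \<subseteq> W}" by simp
  obtain d \<phi> where d: "graded_free_resolution (mono_ideal {W. \<exists>C\<in>M. C \<subseteq> W} :: ('v, 'k) mpoly set) d \<phi>"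
    "\<forall>i j. count_list (d i) j = card {x \<in> {x \<in> B. l x \<subseteq> \<Union>M}. g x = i \<and> int (card (l x)) = j}"
    by (rule sqfree_res_resolution[OF sqfree_res_restrict[OF res, of "\<Union>M", unfolded U]])
  obtain d' \<phi>' where d': "minimal_graded_free_resolution (mono_ideal {W. \<exists>C\<in>M. C \<subseteq> W} :: ('v, 'k) mpoly set) d' \<phi>'"
    "\<forall>i j. count_list (d' i) j = card {x \<in> B'. g' x = i \<and> int (card (l' x)) = j}"
    by (rule minimal_sqfree_res_resolution[OF K(1)])
  have "card (\<Union>M) = (\<Sum>C\<in>M. card C)"
    by (rule card_Union_disjoint[OF Mc(2)]) simp
  also have "\<dots> = card M * t" using Mc(1) by (simp add: connected_sets_def subset_iff)
  finally have card: "card (\<Union>M) = card M * t" .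
  have "finite B'" using K(1) lresD(1) by (auto simp: minimal_sqfree_res_def)
  then have "count_list (d' (card M)) (int (card M * t)) \<noteq> 0"
    unfolding d'(2)[rule_format] using K(2-4) card by (auto simp: card_eq_0_iff)
  \<comment> \<open>The Koszul complex is minimal, so every resolution of this quotient has a
    generator in its top degree, in particular the restricted one.\<close>
  then have "count_list (d (card M)) (int (card M * t)) \<noteq> 0"
    using minimal_resolution_count_le[OF d'(1) d(1), of "card M" "int (card M * t)"] by linarith
  then obtain x where x: "x \<in> B" "g x = card M" "int (card (l x)) = int (card M * t)"
    unfolding d(2)[rule_format] by (auto simp: card_eq_0_iff)
  then have "card (l x) = card M * t" by (simp only: of_nat_eq_iff)
  then show ?thesis using x by blast
qed

theorem theorem3p6:
  fixes E :: "'v::finite set set" and t :: nat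
  assumes "simple_graph E" and "chordal E" and "t \<ge> 2"
  shows "reg_quotient (connected_ideal E t :: ('v, 'k::field) mpoly set)
           = (int t - 1) * int (t_induced_matching_number E t)"
proof -
  let ?U = "{W. \<exists>C\<in>connected_sets E t. C \<subseteq> W}" and ?\<nu> = "t_induced_matching_number E t"
  have I: "(connected_ideal E t :: ('v, 'k) mpoly set) = mono_ideal ?U"
    unfolding connected_ideal_def by (rule ideal_generated_monomials)
  \<comment> \<open>\<open>r = t - 1\<close> is the regularity bound for a single clique.\<close>
  obtain r where r: "t = Suc r" using assms(3) by (cases t) auto
  have "{card M |M. t_induced_matching E t M} = card ` {M. t_induced_matching E t M}" by blast
  then have fin: "finite {card M |M. t_induced_matching E t M}" by simp
  have le_\<nu>: "card M \<le> ?\<nu>" if "t_induced_matching E t M" for M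
    unfolding t_induced_matching_number_def using that by (intro Max_ge[OF fin]) blast
  have "t_induced_matching E t {}"
    by (rule t_induced_matching_of_not_touching[OF assms(1)]) auto
  then have "?\<nu> \<in> {card M |M. t_induced_matching E t M}"
    unfolding t_induced_matching_number_def by (intro Max_in[OF fin]) blast
  then obtain M where M: "t_induced_matching E t M" "card M = ?\<nu>" by auto

  obtain \<rho> :: "'v \<Rightarrow> nat" where \<rho>: "inj \<rho>" "\<And>v. clique E {u. {v, u} \<in> E \<and> \<rho> v < \<rho> u}"
    using perfect_elimination_ordering[OF assms(1,2), of UNIV] by auto
  have "t \<ge> 1" using assms(3) by simp
  \<comment> \<open>The number of cliques equals the size of an induced matching and is therefore at
    most \<open>?\<nu>\<close>, which makes the upper bound \<open>r * ?\<nu>\<close>.\<close>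
  from greedy_matching_cliques[OF \<rho> this, of UNIV] obtain M' Qs where
    M': "M' \<subseteq> {C \<in> connected_sets E t. C \<subseteq> UNIV}" "pairwise (\<lambda>C C'. \<not> touching E C C') M'"
    and Qs: "\<forall>Q\<in>set Qs. clique E Q" "length Qs = card M'"
      "\<forall>C\<in>connected_sets E t. C \<subseteq> UNIV \<longrightarrow> (\<exists>Q\<in>set Qs. C \<inter> Q \<noteq> {})"
    by (elim exE conjE)
  have "t_induced_matching E t M'"
    by (rule t_induced_matching_of_not_touching[OF assms(1)]) (use M' in auto)
  then have len: "length Qs \<le> ?\<nu>" using le_\<nu> Qs(2) by simp
  have "?U = {W. \<exists>Q\<in>set Qs. \<exists>C\<in>connected_sets E (Suc r). C \<inter> Q \<noteq> {} \<and> C \<subseteq> W}"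
  proof (intro Collect_cong iffI)
    fix W assume "\<exists>C\<in>connected_sets E t. C \<subseteq> W"
    then obtain C where C: "C \<in> connected_sets E t" "C \<subseteq> W" by (elim bexE)
    have "\<exists>Q\<in>set Qs. C \<inter> Q \<noteq> {}"
      by (rule Qs(3)[rule_format, OF C(1) subset_UNIV])
    then obtain Q where "Q \<in> set Qs" "C \<inter> Q \<noteq> {}" by (elim bexE)
    then show "\<exists>Q\<in>set Qs. \<exists>C\<in>connected_sets E (Suc r). C \<inter> Q \<noteq> {} \<and> C \<subseteq> W"
      using C unfolding r by (intro bexI[of _ Q] bexI[of _ C] conjI)
  qed (auto simp: r)
  moreover have "has_sqfree_res TYPE('k)
      {W. \<exists>Q\<in>set Qs. \<exists>C\<in>connected_sets E (Suc r). C \<inter> Q \<noteq> {} \<and> C \<subseteq> W} (r * length Qs)"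
    by (rule has_sqfree_res_clique_cover[OF Qs(1)])
  ultimately have "has_sqfree_res TYPE('k) ?U (r * length Qs)" by (simp only:)
  then have hl: "has_sqfree_res TYPE('k) ?U (r * ?\<nu>)"
    by (rule has_sqfree_res_mono) (use len in simp)
  have "{} \<notin> ?U" by (auto simp: connected_sets_def induced_connected_def)
  from minimal_sqfree_res_exists[OF hl this] obtain B :: "nat set" and g l and D :: "nat \<Rightarrow> nat \<Rightarrow> 'k" and e
    where res: "minimal_sqfree_res B g l D e ?U" and bound: "\<forall>x\<in>B. card (l x) \<le> g x + r * ?\<nu>"
    by (elim exE conjE)
  have sqfree_res: "sqfree_res B g l D e ?U" using res unfolding minimal_sqfree_res_def by (rule conjunct1)
  note B = lresD(1)[OF sqfree_res] sqfree_res
  obtain d \<phi> where d: "minimal_graded_free_resolution (mono_ideal ?U :: ('v, 'k) mpoly set) d \<phi>"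
    "\<forall>i j. count_list (d i) j = card {x \<in> B. g x = i \<and> int (card (l x)) = j}"
    by (rule minimal_sqfree_res_resolution[OF res])
  have betti: "graded_betti (mono_ideal ?U :: ('v, 'k) mpoly set) i j \<noteq> 0 \<longleftrightarrow>
      (\<exists>x\<in>B. g x = i \<and> int (card (l x)) = j)" for i j
    unfolding graded_betti_minimal_resolution[OF d(1)] d(2)[rule_format] using B(1) by (auto simp: card_eq_0_iff)
  \<comment> \<open>Betti numbers of the minimal resolution count its generators, so the regularity
    is the largest difference between label size and homological degree.\<close>
  have degs: "{j - int i |i j. graded_betti (mono_ideal ?U :: ('v, 'k) mpoly set) i j \<noteq> 0} =
      (\<lambda>x. int (card (l x)) - int (g x)) ` B"
    unfolding betti by auto
  obtain x where x: "x \<in> B" "g x = ?\<nu>" "card (l x) = ?\<nu> * t"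
    using sqfree_res_generator_of_induced_matching[OF B(2) M(1)] M(2) by auto
  have "Max ((\<lambda>x. int (card (l x)) - int (g x)) ` B) = int r * int ?\<nu>"
  proof (rule Max_eqI)
    fix y assume "y \<in> (\<lambda>x. int (card (l x)) - int (g x)) ` B"
    then obtain z where z: "z \<in> B" "y = int (card (l z)) - int (g z)" by auto
    then have "int (card (l z)) \<le> int (g z + r * ?\<nu>)" using bound by (simp only: of_nat_le_iff)
    then show "y \<le> int r * int ?\<nu>" using z(2) by simp
  next
    \<comment> \<open>The generator obtained from a maximum matching has degree
      \<open>?\<nu>\<close> and label size \<open>?\<nu> * t\<close>, so it attains the
      bound.\<close>
    have "int r * int ?\<nu> = int (card (l x)) - int (g x)" using x r by (simp add: algebra_simps)
    then show "int r * int ?\<nu> \<in> (\<lambda>x. int (card (l x)) - int (g x)) ` B" using x(1) by (rule image_eqI)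
  qed (use B(1) in simp)
  moreover have "int t - 1 = int r" using r by simp
  ultimately show ?thesis unfolding reg_quotient_def I degs by simp
qed

unused_thms

end
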